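(* Let $k\geq 3$ and $m\geq 2$ be integers, let $1<\alpha<2$, and let $$\Omega_m=-2^{\alpha-1}\frac{\Gamma(1-\alpha)}{\left(\Gamma\left(1-\frac{\alpha}{2}\right)\right)^2}\left(\frac{\Gamma\left(1+\frac{\alpha}{2}\right)}{\Gamma\left(2-\frac{\alpha}{2}\right)}-\frac{\Gamma\left(m+\frac{\alpha}{2}\right)}{\Gamma\left(1+m-\frac{\alpha}{2}\right)}\right).$$ Then there exists a family of $m$-fold solutions $(\Omega,R)$, with $R-1\in X^k_m$, of the equation $F(\Omega,R)=0$ (for this $\alpha$), that bifurcates from the disk $R\equiv1$ at $\Omega=\Omega_m$.
   Context: All functions are real-valued and $2\pi$-periodic, $\mathbb{T}=\mathbb{R}/2\pi\mathbb{Z}$, and all integrals are over $\mathbb{T}$. Let $C(\alpha)=\frac{1}{2\pi}\frac{\Gamma(\alpha/2)}{2^{1-\alpha}\Gamma\left(\frac{2-\alpha}{2}\right)}$. The functional: for $\Omega\in\mathbb{R}$ and a positive function $R$ on $\mathbb{T}$, put $D(x,y)=(R(x)-R(y))^2+4R(x)R(y)\sin^2\left(\frac{x-y}{2}\right)$ and $$F(\Omega,R)(x)=\Omega R'(x)-F_1(R)(x)-F_2(R)(x)-F_3(R)(x),$$ $$F_1(R)(x)=\frac{C(\alpha)}{R(x)}\int\frac{\sin(x-y)}{D(x,y)^{\alpha/2}}\left(R(x)R(y)+R'(x)R'(y)\right)dy,$$ $$F_2(R)(x)=C(\alpha)\int\frac{\cos(x-y)}{D(x,y)^{\alpha/2}}\left(R'(y)-R'(x)\right)dy,$$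 $$F_3(R)(x)=C(\alpha)\frac{R'(x)}{R(x)}\int\frac{\cos(x-y)}{D(x,y)^{\alpha/2}}\left(R(x)-R(y)\right)dy.$$ (Zeros of $F$ are the V-states of the generalized surface quasi-geostrophic equation: patches with boundary $(R(x)\cos x,R(x)\sin x)$ rotating with constant angular velocity $\Omega$.) One has $F(\Omega,1)=0$ for every $\Omega$. The space: $X^k_m$ is the set of $f\in H^k(\mathbb{T})$ of the form $f(x)=\sum_{j\ge1}a_{jm}\cos(jmx)$, with the $H^k$ norm. Meaning of bifurcation (standard): a family of solutions with $R-1$ in a Banach space $X$ bifurcates from the disk at $\Omega_m$ if there are $\varepsilon>0$ and a continuous curve $s\in(-\varepsilon,\varepsilon)\mapsto(\Omega(s),R(s)-1)\in\mathbb{R}\times X$ with $\Omega(0)=\Omega_m$, $R(0)=1$, $R(s)\neq 1$ for $s\ne0$, $R(s)>0$, and $F(\Omega(s),R(s))=0$ for all $s$. *)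

theory Defs
  imports "HOL-Analysis.Analysis"
begin

text \<open>
  Functions on the circle are \<open>2\<pi>\<close>-periodic functions \<open>real \<Rightarrow> real\<close>; integrals over the circle
  are Lebesgue integrals over \<open>[-\<pi>, \<pi>]\<close>.
\<close>

definition C_gsqg :: "real \<Rightarrow> real" where
  "C_gsqg \<alpha> = 1 / (2 * pi) * (Gamma (\<alpha> / 2) / (2 powr (1 - \<alpha>) * Gamma ((2 - \<alpha>) / 2)))"

definition D_fun :: "(real \<Rightarrow> real) \<Rightarrow> real \<Rightarrow> real \<Rightarrow> real" where
  "D_fun R x y = (R x - R y)\<^sup>2 + 4 * R x * R y * (sin ((x - y) / 2))\<^sup>2"

text \<open>
  For positive \<open>R\<close> of class \<open>C\<^sup>2\<close> and \<open>1 < \<alpha> < 2\<close> the three integrands below are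
  \<open>O(\<bar>x - y\<bar> powr (1 - \<alpha>))\<close> near the diagonal, so the integrals converge absolutely and no
  principal value is involved.
\<close>

definition F1 :: "real \<Rightarrow> (real \<Rightarrow> real) \<Rightarrow> real \<Rightarrow> real" where
  "F1 \<alpha> R x = C_gsqg \<alpha> / R x *
     (LINT y:{-pi..pi}|lborel. sin (x - y) / D_fun R x y powr (\<alpha> / 2)
        * (R x * R y + deriv R x * deriv R y))"

definition F2 :: "real \<Rightarrow> (real \<Rightarrow> real) \<Rightarrow> real \<Rightarrow> real" where
  "F2 \<alpha> R x = C_gsqg \<alpha> *
     (LINT y:{-pi..pi}|lborel. cos (x - y) / D_fun R x y powr (\<alpha> / 2)
        * (deriv R y - deriv R x))"

definition F3 :: "real \<Rightarrow> (real \<Rightarrow> real) \<Rightarrow> real \<Rightarrow> real" where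
  "F3 \<alpha> R x = C_gsqg \<alpha> * (deriv R x / R x) *
     (LINT y:{-pi..pi}|lborel. cos (x - y) / D_fun R x y powr (\<alpha> / 2)
        * (R x - R y))"

definition F_gsqg :: "real \<Rightarrow> real \<Rightarrow> (real \<Rightarrow> real) \<Rightarrow> real \<Rightarrow> real" where
  "F_gsqg \<alpha> \<Omega> R x = \<Omega> * deriv R x - F1 \<alpha> R x - F2 \<alpha> R x - F3 \<alpha> R x"

definition fourier_coeff :: "(real \<Rightarrow> real) \<Rightarrow> int \<Rightarrow> complex" where
  "fourier_coeff f n = complex_of_real (1 / (2 * pi)) *
     (LINT x:{-pi..pi}|lborel. complex_of_real (f x) * exp (- \<i> * of_int n * of_real x))"

definition sobolev_space :: "nat \<Rightarrow> (real \<Rightarrow> real) set" where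
  "sobolev_space k = {f. (\<forall>x. f (x + 2 * pi) = f x)
     \<and> f \<in> borel_measurable lborel
     \<and> set_integrable lborel {-pi..pi} (\<lambda>x. (f x)\<^sup>2)
     \<and> (\<lambda>n::int. (1 + (of_int n)\<^sup>2) ^ k * (cmod (fourier_coeff f n))\<^sup>2) summable_on UNIV}"

definition sobolev_norm :: "nat \<Rightarrow> (real \<Rightarrow> real) \<Rightarrow> real" where
  "sobolev_norm k f =
     sqrt (\<Sum>\<^sub>\<infinity>n::int. (1 + (of_int n)\<^sup>2) ^ k * (cmod (fourier_coeff f n))\<^sup>2)"

text \<open>
  The index \<open>j \<ge> 1\<close> of the cosine series is shifted to \<open>Suc j\<close>. Requiring the series to converge
  to \<open>f\<close> at every point selects the continuous representative of the class of \<open>f\<close> (\<open>k \<ge> 1\<close>).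
\<close>

definition X_space :: "nat \<Rightarrow> nat \<Rightarrow> (real \<Rightarrow> real) set" where
  "X_space k m = {f \<in> sobolev_space k.
     \<exists>a :: nat \<Rightarrow> real. \<forall>x. (\<lambda>j. a j * cos (real (Suc j * m) * x)) sums f x}"

text \<open>
  \<open>X\<close> is the Banach space containing the perturbations \<open>R - 1\<close>, and \<open>N\<close> is its norm.
\<close>

definition bifurcates_from_disk ::
  "real \<Rightarrow> (real \<Rightarrow> real) set \<Rightarrow> ((real \<Rightarrow> real) \<Rightarrow> real) \<Rightarrow> real \<Rightarrow> bool" where
  "bifurcates_from_disk \<alpha> X N \<Omega>\<^sub>0 \<longleftrightarrow>
     (\<exists>\<epsilon>>0. \<exists>(\<Omega> :: real \<Rightarrow> real) (R :: real \<Rightarrow> real \<Rightarrow> real).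
        (\<forall>s\<in>{-\<epsilon><..<\<epsilon>}. (\<lambda>x. R s x - 1) \<in> X)
      \<and> continuous_on {-\<epsilon><..<\<epsilon>} \<Omega>
      \<and> (\<forall>t\<in>{-\<epsilon><..<\<epsilon>}.
           ((\<lambda>s. N (\<lambda>x. (R s x - 1) - (R t x - 1))) \<longlongrightarrow> 0) (at t within {-\<epsilon><..<\<epsilon>}))
      \<and> \<Omega> 0 = \<Omega>\<^sub>0
      \<and> R 0 = (\<lambda>x. 1)
      \<and> (\<forall>s\<in>{-\<epsilon><..<\<epsilon>}. s \<noteq> 0 \<longrightarrow> R s \<noteq> (\<lambda>x. 1))
      \<and> (\<forall>s\<in>{-\<epsilon><..<\<epsilon>}. \<forall>x. R s x > 0)
      \<and> (\<forall>s\<in>{-\<epsilon><..<\<epsilon>}. \<forall>x. F_gsqg \<alpha> (\<Omega> s) (R s) x = 0))"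

definition \<Omega>_bif :: "real \<Rightarrow> nat \<Rightarrow> real" where
  "\<Omega>_bif \<alpha> m = - (2 powr (\<alpha> - 1)) * (Gamma (1 - \<alpha>) / (Gamma (1 - \<alpha> / 2))\<^sup>2)
     * (Gamma (1 + \<alpha> / 2) / Gamma (2 - \<alpha> / 2)
        - Gamma (real m + \<alpha> / 2) / Gamma (1 + real m - \<alpha> / 2))"

end

theory Submission
  imports Defs "HOL-Real_Asymp.Real_Asymp"
begin

text \<open>Multiplying \<open>F = 0\<close> by \<open>R\<close> collects the three integrals into one, whose integrand is
  \<open>sin u (R R\<^sub>y + R' R'\<^sub>y) + cos u (R R'\<^sub>y - R' R\<^sub>y)\<close> over \<open>D powr (\<alpha> / 2)\<close>, where \<open>u = x - y\<close>.
  For fixed \<open>u\<close> the difference quotient \<open>(R - R\<^sub>y) / (2 sin (u / 2))\<close> is a bounded Fourier multiplier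
  of \<open>R\<close>, so \<open>D / (2 sin (u / 2))\<^sup>2\<close> is a small perturbation of \<open>1\<close> in a Wiener algebra and its power is
  a binomial series there. The integral over \<open>u\<close> then costs exactly \<open>\<alpha>\<close> derivatives. The
  linearisation is a multiplier of order \<open>\<alpha>\<close> whose only nonconstant zero modes are \<open>\<plusminus>m\<close>, so its inverse
  on the other modes gives them back.
  After a Lyapunov--Schmidt splitting the equation becomes a contraction, uniformly in the amplitude
  \<open>s\<close>. Exponential weights in the Wiener norm give every Sobolev regularity at once.\<close>

section \<open>A weighted Wiener algebra\<close>

text \<open>One term dictates the estimates. For R = 1 + \<open>pert g\<close> the increment of R'
  has no linear decay at the diagonal in norm: divided by the chord, its symbol grows like |n|^(2 -
  \<alpha>). Integrated against the kernel, however, a mode difference costs only |n|^(\<alpha> -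
  1), and the increment enters linearly; so it stays undivided and all other factors are bounded
  pointwise in u. The inversion rests on explicit eigenvalues. Mode n is neutral at one angular
  velocity; the successive differences of these velocities satisfy a two-term recurrence, which is
  solved by Gamma quotients. The quotients increase strictly, which excludes other resonances, and
  grow at least like n^(\<alpha> - 1), which together with the derivative in the equation restores
  the full order \<alpha>. Constants lie in the kernel of the linearisation because of its factor n;
  parity removes them, since an even R gives an odd equation. Coefficients are complex, so reality,
  parity and m-fold symmetry are imposed through a closed real subspace that the contraction
  preserves.\<close>

text \<open>The weight is submultiplicative, so that the space below is an algebra, and it dominates
  every Sobolev weight.\<close>

definition weight :: "int \<Rightarrow> real" where
  "weight n = 2 ^ nat \<bar>n\<bar>"

lemma weight_pos [simp]: "weight n > 0" and weight_nonneg [simp]: "weight n \<ge> 0" and weight_ge_1: "weight n \<ge> 1"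
  by (simp_all add: weight_def)

lemma weight_add: "weight (n + k) \<le> weight n * weight k"
proof -
  have "nat \<bar>n + k\<bar> \<le> nat \<bar>n\<bar> + nat \<bar>k\<bar>" by linarith
  then show ?thesis unfolding weight_def power_add [symmetric] by (intro power_increasing) auto
qed

lemma square_le_two_power: "real n ^ 2 \<le> 2 * 2 ^ n"
proof (induction n rule: less_induct)
  case (less n)
  show ?case
  proof (cases "n < 4")
    case True
    then have "n \<in> {0,1,2,3}" by auto
    then show ?thesis by auto
  next
    case False
    \<comment> \<open>The step from k to k + 1 needs 2 k + 1 \<le> k^2, which holds from k = 3 on;
      this fixes the range checked by evaluation.\<close>
    define k where "k = n - 1"
    have k: "n = Suc k" "k \<ge> 3" using False by (auto simp: k_def)
    have "real (Suc k) ^ 2 \<le> 2 * real k ^ 2"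
    proof -
      have "3 * real k \<le> real k * real k" using k by (intro mult_right_mono) auto
      moreover have "3 \<le> real k" using k by auto
      ultimately show ?thesis unfolding power2_eq_square of_nat_Suc by argo
    qed
    also have "\<dots> \<le> 2 * (2 * 2 ^ k)" using less.IH[of k] k by simp
    finally show ?thesis using k by simp
  qed
qed

lemma square_le_weight: "real_of_int n ^ 2 \<le> 2 * weight n"
  using square_le_two_power[of "nat \<bar>n\<bar>"] by (simp add: weight_def)

text \<open>A type of its own, so that completeness, the algebra structure and separability are
  class instances, as power series and Bochner integrals with values in it require.\<close>

typedef wiener = "{a :: int \<Rightarrow> complex. (\<lambda>n. cmod (a n) * weight n) summable_on UNIV}"
  morphisms coef Wiener
  by (rule exI[of _ "\<lambda>_. 0"]) simp

lemma coef_summable: "(\<lambda>n. cmod (coef a n) * weight n) summable_on UNIV"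
  using coef[of a] by simp

lemma coef_Wiener: "(\<lambda>n. cmod (a n) * weight n) summable_on UNIV \<Longrightarrow> coef (Wiener a) = a"
  by (simp add: Wiener_inverse)

lemma wiener_eqI: "(\<And>n. coef a n = coef b n) \<Longrightarrow> a = b"
  by (metis coef_inject ext)

instantiation wiener :: real_normed_vector
begin

definition zero_wiener :: wiener where "0 = Wiener (\<lambda>_. 0)"
definition plus_wiener :: "wiener \<Rightarrow> wiener \<Rightarrow> wiener" where
  "a + b = Wiener (\<lambda>n. coef a n + coef b n)"
definition uminus_wiener :: "wiener \<Rightarrow> wiener" where
  "- a = Wiener (\<lambda>n. - coef a n)"
definition minus_wiener :: "wiener \<Rightarrow> wiener \<Rightarrow> wiener" where
  "a - b = Wiener (\<lambda>n. coef a n - coef b n)"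
definition scaleR_wiener :: "real \<Rightarrow> wiener \<Rightarrow> wiener" where
  "r *\<^sub>R a = Wiener (\<lambda>n. r *\<^sub>R coef a n)"
definition norm_wiener :: "wiener \<Rightarrow> real" where
  "norm a = (\<Sum>\<^sub>\<infinity>n. cmod (coef a n) * weight n)"
definition dist_wiener_def: "dist (a :: wiener) b = norm (a - b)"
definition sgn_wiener_def: "sgn (a :: wiener) = inverse (norm a) *\<^sub>R a"
definition uniformity_wiener_def:
  "(uniformity :: (wiener \<times> wiener) filter) = (INF e\<in>{0 <..}. principal {(x, y). dist x y < e})"
definition open_wiener_def: "open (U :: wiener set) \<longleftrightarrow> (\<forall>x\<in>U. eventually (\<lambda>(x', y). x' = x \<longrightarrow> y \<in> U) uniformity)"

lemma coef_zero: "coef 0 n = 0"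
  by (simp add: zero_wiener_def coef_Wiener)

lemma summable_add_bound:
  fixes f :: "int \<Rightarrow> complex"
  assumes "\<And>n. cmod (f n) \<le> cmod (coef a n) + cmod (coef b n)"
  shows "(\<lambda>n. cmod (f n) * weight n) summable_on UNIV"
proof (rule summable_on_comparison_test)
  show "(\<lambda>n. cmod (coef a n) * weight n + cmod (coef b n) * weight n) summable_on UNIV"
    by (intro summable_on_add coef_summable)
qed (use assms in \<open>auto simp flip: distrib_right intro!: mult_right_mono\<close>)

lemma coef_add: "coef (a + b) n = coef a n + coef b n"
  unfolding plus_wiener_def
  by (subst coef_Wiener) (auto intro!: summable_add_bound[of _ a b] norm_triangle_ineq)

lemma coef_diff: "coef (a - b) n = coef a n - coef b n"
  unfolding minus_wiener_def
  by (subst coef_Wiener) (auto intro!: summable_add_bound[of _ a b] norm_triangle_ineq4)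

lemma coef_minus: "coef (- a) n = - coef a n"
  unfolding uminus_wiener_def
  by (subst coef_Wiener) (auto intro!: summable_add_bound[of _ a a])

lemma coef_scaleR: "coef (r *\<^sub>R a) n = r *\<^sub>R coef a n"
  unfolding scaleR_wiener_def
  by (subst coef_Wiener)
     (auto simp: mult.assoc intro!: summable_on_cmult_right coef_summable)

instance
proof
  fix a b c :: wiener and r s :: real
  show "a + b + c = a + (b + c)" "a + b = b + a" "0 + a = a" "- a + a = 0" "a - b = a + - b"
    "r *\<^sub>R (a + b) = r *\<^sub>R a + r *\<^sub>R b" "(r + s) *\<^sub>R a = r *\<^sub>R a + s *\<^sub>R a"
    "r *\<^sub>R s *\<^sub>R a = (r * s) *\<^sub>R a" "1 *\<^sub>R a = a"
    by (auto intro!: wiener_eqI simp: coef_add coef_zero coef_minus coef_diff coef_scaleR algebra_simps)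
  show "dist a b = norm (a - b)" by (rule dist_wiener_def)
  show "sgn a = inverse (norm a) *\<^sub>R a" by (rule sgn_wiener_def)
  show "uniformity = (INF e\<in>{0 <..}. principal {(x, y :: wiener). dist x y < e})"
    by (rule uniformity_wiener_def)
  show "open U = (\<forall>x\<in>U. eventually (\<lambda>(x', y). x' = x \<longrightarrow> y \<in> U) uniformity)" for U :: "wiener set"
    by (rule open_wiener_def)
  show "norm a = 0 \<longleftrightarrow> a = 0"
  proof
    assume "norm a = 0"
    then have "cmod (coef a n) * weight n = 0" for n
      using nonneg_infsum_le_0D[of "\<lambda>n. cmod (coef a n) * weight n" UNIV n] coef_summable[of a]
      by (simp add: norm_wiener_def)
    then show "a = 0"
      by (intro wiener_eqI) (metis coef_zero mult_eq_0_iff norm_eq_zero weight_pos less_irrefl)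
  qed (simp add: norm_wiener_def coef_zero)
  show "norm (a + b) \<le> norm a + norm b"
  proof -
    have "norm (a + b) \<le> (\<Sum>\<^sub>\<infinity>n. cmod (coef a n) * weight n + cmod (coef b n) * weight n)"
      unfolding norm_wiener_def coef_add
      by (intro infsum_mono summable_add_bound[of _ a b] summable_on_add coef_summable)
         (auto intro!: mult_right_mono norm_triangle_ineq simp flip: distrib_right)
    then show ?thesis
      by (simp add: norm_wiener_def infsum_add coef_summable)
  qed
  show "norm (r *\<^sub>R a) = \<bar>r\<bar> * norm a"
    unfolding norm_wiener_def coef_scaleR norm_scaleR mult.assoc
    by (rule infsum_cmult_right) (rule coef_summable)
qed

end

lemma coef_sum: "coef (sum f A) n = (\<Sum>i\<in>A. coef (f i) n)"
  by (induction A rule: infinite_finite_induct) (auto simp: coef_zero coef_add)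

lemma coef_has_norm: "((\<lambda>n. cmod (coef a n) * weight n) has_sum norm a) UNIV"
  unfolding norm_wiener_def by (rule has_sum_infsum) (rule coef_summable)

lemma sum_coef_le_norm: "finite F \<Longrightarrow> (\<Sum>n\<in>F. cmod (coef a n) * weight n) \<le> norm a"
  unfolding norm_wiener_def by (rule finite_sum_le_infsum) (auto intro: coef_summable)

lemma norm_coef_weight_le: "cmod (coef a n) * weight n \<le> norm a"
  using sum_coef_le_norm[of "{n}" a] by simp

lemma norm_coef_le: "cmod (coef a n) \<le> norm a"
  using norm_coef_weight_le[of a n] mult_left_mono[OF weight_ge_1[of n], of "cmod (coef a n)"] by simp

lemma bounded_linear_coef: "bounded_linear (\<lambda>a. coef a n)"
  by (rule bounded_linear_intro[of _ 1]) (auto simp: coef_add coef_scaleR norm_coef_le)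

text \<open>The hypothesis involves finite sums only, so it can be checked by termwise estimates and
  limits before membership in the type is known.\<close>

lemma Wiener_bounded:
  assumes "\<And>F. finite F \<Longrightarrow> (\<Sum>n\<in>F. cmod (f n) * weight n) \<le> B"
  shows "coef (Wiener f) = f" "norm (Wiener f) \<le> B"
proof -
  have s: "(\<lambda>n. cmod (f n) * weight n) summable_on UNIV"
    by (rule nonneg_bdd_above_summable_on) (auto intro!: bdd_aboveI2[of _ _ B] assms)
  then show c: "coef (Wiener f) = f" by (rule coef_Wiener)
  show "norm (Wiener f) \<le> B" unfolding norm_wiener_def c
    by (rule infsum_le_finite_sums[OF s]) (use assms in auto)
qed

text \<open>Coefficientwise limits exist; letting the second index tend to infinity in finite
  sections of the Cauchy estimate turns it into a bound for the distance to the limit.\<close>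

instance wiener :: banach
proof
  fix X :: "nat \<Rightarrow> wiener" assume X: "Cauchy X"
  have "\<exists>l. (\<lambda>i. coef (X i) n) \<longlonglongrightarrow> l" for n
    using bounded_linear.Cauchy[OF bounded_linear_coef X, of n]
    by (simp add: Cauchy_convergent_iff convergent_def)
  then obtain l where l: "\<And>n. (\<lambda>i. coef (X i) n) \<longlonglongrightarrow> l n" by metis
  have key: "\<exists>N. \<forall>i\<ge>N. \<forall>F. finite F \<longrightarrow> (\<Sum>n\<in>F. cmod (coef (X i) n - l n) * weight n) \<le> e" if "e > 0" for e
  proof -
    obtain N where N: "\<And>i j. i \<ge> N \<Longrightarrow> j \<ge> N \<Longrightarrow> norm (X i - X j) < e"
      using CauchyD[OF X \<open>e > 0\<close>] by blast
    have "(\<Sum>n\<in>F. cmod (coef (X i) n - l n) * weight n) \<le> e" if "i \<ge> N" "finite F" for i F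
    proof (rule tendsto_upperbound)
      show "(\<lambda>j. \<Sum>n\<in>F. cmod (coef (X i) n - coef (X j) n) * weight n)
              \<longlonglongrightarrow> (\<Sum>n\<in>F. cmod (coef (X i) n - l n) * weight n)"
        by (intro tendsto_intros l)
      have "(\<Sum>n\<in>F. cmod (coef (X i) n - coef (X j) n) * weight n) \<le> e" if "j \<ge> N" for j
        using sum_coef_le_norm[OF \<open>finite F\<close>, of "X i - X j"] N[OF \<open>i \<ge> N\<close> that]
        by (simp add: coef_diff)
      then show "\<forall>\<^sub>F j in sequentially. (\<Sum>n\<in>F. cmod (coef (X i) n - coef (X j) n) * weight n) \<le> e"
        by (auto simp: eventually_sequentially)
    qed simp
    then show ?thesis by blast
  qed
  define D where "D i = Wiener (\<lambda>n. coef (X i) n - l n)" for i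
  have D: "\<exists>N. \<forall>i\<ge>N. coef (D i) = (\<lambda>n. coef (X i) n - l n) \<and> norm (D i) \<le> e" if "e > 0" for e
    using key[OF that] Wiener_bounded unfolding D_def by meson
  obtain N where N: "\<And>i. i \<ge> N \<Longrightarrow> coef (D i) = (\<lambda>n. coef (X i) n - l n)"
    using D[of 1] by auto
  \<comment> \<open>The limit sequence \<open>l\<close> is not yet known to be summable, but
    \<open>coef (X N)\<close> minus \<open>l\<close> is; subtracting yields the limit as an element
    of the type.\<close>
  define L where "L = X N - D N"
  have DL: "D i = X i - L" if "i \<ge> N" for i
    by (rule wiener_eqI) (simp add: L_def coef_diff N that)
  have "X \<longlonglongrightarrow> L"
  proof (rule LIMSEQ_I)
    fix e :: real assume "e > 0"
    obtain M where M: "\<And>i. i \<ge> M \<Longrightarrow> norm (D i) \<le> e / 2"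
      using D[of "e / 2"] \<open>e > 0\<close> by auto
    show "\<exists>no. \<forall>n\<ge>no. norm (X n - L) < e"
      by (rule exI[of _ "max M N"]) (use M DL \<open>e > 0\<close> in fastforce)
  qed
  then show "convergent X" by (auto simp: convergent_def)
qed

lemma has_sum_diff:
  fixes f g :: "'a \<Rightarrow> 'b :: real_normed_vector"
  assumes "(f has_sum a) A" "(g has_sum b) A"
  shows "((\<lambda>x. f x - g x) has_sum (a - b)) A"
  using has_sum_add[OF assms(1), of "\<lambda>x. - g x" "- b"] assms(2) by (simp add: has_sum_uminus)

lemma has_sum_product:
  fixes f :: "'a \<Rightarrow> 'c :: {banach, real_normed_field}" and g :: "'b \<Rightarrow> 'c"
  assumes "(\<lambda>k. norm (f k)) summable_on A" "(\<lambda>l. norm (g l)) summable_on B"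
  shows "((\<lambda>(k, l). f k * g l) has_sum infsum f A * infsum g B) (A \<times> B)"
proof (rule has_sum_SigmaI)
  have g: "g summable_on B" and f: "f summable_on A"
    using assms by (simp_all add: abs_summable_summable)
  show "((\<lambda>l. case (k, l) of (k, l) \<Rightarrow> f k * g l) has_sum f k * infsum g B) B" if "k \<in> A" for k
    using has_sum_cmult_right[OF has_sum_infsum[OF g]] by simp
  show "((\<lambda>k. f k * infsum g B) has_sum infsum f A * infsum g B) A"
    using has_sum_cmult_left[OF has_sum_infsum[OF f]] by simp
  have "(\<lambda>p. norm ((\<lambda>(k, l). f k * g l) p)) summable_on (A \<times> B)"
    unfolding Infinite_Sum.abs_summable_on_Sigma_iff
    using assms by (simp add: norm_mult infsum_cmult_right' abs_mult
        summable_on_cmult_right summable_on_cmult_left)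
  then show "(\<lambda>(k, l). f k * g l) summable_on (A \<times> B)" by (rule abs_summable_summable)
qed

section \<open>Evaluation of an element as a trigonometric series\<close>

definition ev :: "wiener \<Rightarrow> real \<Rightarrow> complex" where
  "ev a x = (\<Sum>\<^sub>\<infinity>n. coef a n * cis (of_int n * x))"

definition mode :: "int \<Rightarrow> complex \<Rightarrow> wiener" where
  "mode n c = Wiener (\<lambda>k. if k = n then c else 0)"

lemma le_mult_weight: "0 \<le> c \<Longrightarrow> c \<le> c * weight n"
  using mult_left_mono[OF weight_ge_1[of n], of c] by simp

lemma coef_abs_summable: "(\<lambda>n. cmod (coef a n)) summable_on UNIV"
  by (rule summable_on_comparison_test[OF coef_summable[of a]]) (auto intro: le_mult_weight)

lemma ev_abs_summable: "(\<lambda>n. cmod (coef a n * cis (of_int n * x))) summable_on UNIV"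
  using coef_abs_summable[of a] by (simp add: norm_mult)

lemma ev_has_sum: "((\<lambda>n. coef a n * cis (of_int n * x)) has_sum ev a x) UNIV"
  unfolding ev_def by (rule has_sum_infsum[OF abs_summable_summable[OF ev_abs_summable]])

lemma coef_mode: "coef (mode n c) k = (if k = n then c else 0)"
proof -
  have "(\<lambda>k. cmod (if k = n then c else 0) * weight k) summable_on UNIV"
    by (rule finite_nonzero_values_imp_summable_on) (rule finite_subset[of _ "{n}"], auto)
  then show ?thesis unfolding mode_def by (subst coef_Wiener) auto
qed

text \<open>The norm is additive over disjoint sets of frequencies, so the norm of a truncation
  error is exactly the tail of the series defining \<open>norm a\<close>.\<close>

lemma mode_has_sum: "((\<lambda>n. mode n (coef a n)) has_sum a) UNIV"
proof -
  have *: "norm (a - (\<Sum>n\<in>F. mode n (coef a n))) = norm a - (\<Sum>n\<in>F. cmod (coef a n) * weight n)"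
    if F: "finite F" for F
  proof -
    let ?b = "a - (\<Sum>n\<in>F. mode n (coef a n))"
    have c: "coef ?b k = (if k \<in> F then 0 else coef a k)" for k
      using F by (simp add: coef_diff coef_sum coef_mode)
    have "((\<lambda>n. if n \<in> F then cmod (coef a n) * weight n else 0) has_sum (\<Sum>n\<in>F. cmod (coef a n) * weight n)) UNIV"
      using F by (intro has_sum_finite_neutralI[of F]) auto
    from has_sum_add[OF this coef_has_norm[of ?b]]
    have "((\<lambda>n. cmod (coef a n) * weight n) has_sum (\<Sum>n\<in>F. cmod (coef a n) * weight n) + norm ?b) UNIV"
      by (rule has_sum_cong[THEN iffD1, rotated]) (auto simp: c)
    from has_sum_unique[OF this coef_has_norm] show ?thesis by simp
  qed
  have "((\<lambda>F. norm a - (\<Sum>n\<in>F. cmod (coef a n) * weight n)) \<longlongrightarrow> norm a - norm a) (finite_subsets_at_top UNIV)"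
    using coef_has_norm[of a] unfolding has_sum_def by (intro tendsto_intros)
  then have "((\<lambda>F. norm (a - (\<Sum>n\<in>F. mode n (coef a n)))) \<longlongrightarrow> norm a - norm a) (finite_subsets_at_top UNIV)"
    by (rule Lim_transform_eventually) (auto intro!: eventually_finite_subsets_at_top_weakI simp: *)
  then have "((\<lambda>F. norm (a - (\<Sum>n\<in>F. mode n (coef a n)))) \<longlongrightarrow> 0) (finite_subsets_at_top UNIV)"
    by simp
  then show ?thesis
    unfolding has_sum_def by (subst tendsto_dist_iff) (simp add: dist_norm norm_minus_commute)
qed

text \<open>Density of trigonometric polynomials. Linearity is over the reals only, hence test
  elements with an arbitrary complex coefficient \<open>c\<close>.\<close>

lemma wiener_linear_eqI:
  fixes S T :: "wiener \<Rightarrow> 'b :: real_normed_vector"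
  assumes "bounded_linear S" "bounded_linear T" "\<And>n c. S (mode n c) = T (mode n c)"
  shows "S a = T a"
proof -
  have "((\<lambda>n. S (mode n (coef a n))) has_sum S a) UNIV"
    "((\<lambda>n. T (mode n (coef a n))) has_sum T a) UNIV"
    using has_sum_bounded_linear[OF assms(1) mode_has_sum[of a]]
      has_sum_bounded_linear[OF assms(2) mode_has_sum[of a]] by (simp_all add: o_def)
  then show ?thesis using assms(3) by (simp add: has_sum_unique)
qed

lemma norm_mode: "norm (mode n c) = cmod c * weight n"
proof -
  have "((\<lambda>k. cmod (coef (mode n c) k) * weight k) has_sum cmod c * weight n) UNIV"
    by (rule has_sum_finite_neutralI[of "{n}"]) (auto simp: coef_mode)
  then show ?thesis by (rule has_sum_unique[OF coef_has_norm])
qed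

lemma mode_diff: "mode n (b - c) = mode n b - mode n c"
  by (rule wiener_eqI) (simp add: coef_mode coef_diff)

lemma ev_mode: "ev (mode n c) x = c * cis (of_int n * x)"
proof -
  have "((\<lambda>k. coef (mode n c) k * cis (of_int k * x)) has_sum c * cis (of_int n * x)) UNIV"
    by (rule has_sum_finite_neutralI[of "{n}"]) (auto simp: coef_mode)
  then show ?thesis by (rule has_sum_unique[OF ev_has_sum])
qed

lemma norm_ev_le: "cmod (ev a x) \<le> norm a"
proof -
  have "cmod (ev a x) \<le> (\<Sum>\<^sub>\<infinity>n. cmod (coef a n * cis (of_int n * x)))"
    unfolding ev_def by (rule norm_infsum_bound) (rule ev_abs_summable)
  also have "\<dots> \<le> norm a"
    unfolding norm_wiener_def
    by (rule infsum_mono[OF ev_abs_summable coef_summable])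
       (auto simp: norm_mult intro: le_mult_weight)
  finally show ?thesis .
qed

lemma ev_add: "ev (a + b) x = ev a x + ev b x"
  using has_sum_unique[OF ev_has_sum[of "a + b" x]] has_sum_add[OF ev_has_sum[of a x] ev_has_sum[of b x]]
  by (simp add: coef_add distrib_right)

lemma ev_scaleR: "ev (r *\<^sub>R a) x = r *\<^sub>R ev a x"
  using has_sum_unique[OF ev_has_sum[of "r *\<^sub>R a" x]]
    has_sum_bounded_linear[OF bounded_linear_scaleR_right[of r] ev_has_sum[of a x]]
  by (simp add: coef_scaleR o_def)

lemma bounded_linear_ev: "bounded_linear (\<lambda>a. ev a x)"
  by (rule bounded_linear_intro[of _ 1]) (auto simp: ev_add ev_scaleR norm_ev_le)

lemma ev_diff: "ev (a - b) x = ev a x - ev b x" and ev_zero: "ev 0 x = 0" and ev_minus: "ev (- a) x = - ev a x"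
  using linear_diff[OF bounded_linear.linear[OF bounded_linear_ev[of x]]]
    linear_0[OF bounded_linear.linear[OF bounded_linear_ev[of x]]]
    linear_neg[OF bounded_linear.linear[OF bounded_linear_ev[of x]]] by auto

lemma abs_le_weight: "\<bar>real_of_int n\<bar> \<le> weight n"
proof -
  have "nat \<bar>n\<bar> < 2 ^ nat \<bar>n\<bar>" by (rule less_exp)
  then have "real (nat \<bar>n\<bar>) < real (2 ^ nat \<bar>n\<bar>)" by (simp only: of_nat_less_iff)
  then show ?thesis by (simp add: weight_def)
qed

lemma norm_cis_diff: "cmod (cis s - cis t) = 2 * \<bar>sin ((s - t) / 2)\<bar>"
proof -
  have "cis s - cis t = cis t * (cis (s - t) - 1)" by (simp add: cis_mult algebra_simps)
  then have "cmod (cis s - cis t) = cmod (exp (\<i> * of_real (s - t)) - 1)"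
    by (simp add: norm_mult cis_conv_exp)
  then show ?thesis by (simp only: dist_exp_i_1)
qed

lemma norm_cis_diff_le: "cmod (cis s - cis t) \<le> \<bar>s - t\<bar>"
  unfolding norm_cis_diff using abs_sin_x_le_abs_x[of "(s - t) / 2"] by simp

text \<open>Mean value inequality for \<open>cis t - \<i> * of_real t\<close>, whose derivative
  \<open>\<i> * (cis s - 1)\<close> has modulus at most |s|.\<close>

lemma norm_cis_taylor: "cmod (cis t - 1 - \<i> * of_real t) \<le> t\<^sup>2"
proof -
  have "norm ((\<lambda>t. cis t - \<i> * of_real t) t - (\<lambda>t. cis t - \<i> * of_real t) 0)
        \<le> \<bar>t\<bar> * norm (t - 0)"
  proof (rule differentiable_bound[where S = "closed_segment 0 t" and f' = "\<lambda>s h. h *\<^sub>R (\<i> * cis s - \<i>)"])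
    fix s assume s: "s \<in> closed_segment 0 t"
    show "((\<lambda>t. cis t - \<i> * of_real t) has_derivative (\<lambda>h. h *\<^sub>R (\<i> * cis s - \<i>)))
            (at s within closed_segment 0 t)"
      by (auto intro!: derivative_eq_intros simp: algebra_simps scaleR_conv_of_real)
    have "onorm (\<lambda>h :: real. h *\<^sub>R (\<i> * cis s - \<i>)) \<le> cmod (\<i> * cis s - \<i>)"
      by (rule onorm_le) (simp add: mult.commute)
    also have "\<dots> = cmod (\<i> * (cis s - cis 0))" by (simp add: algebra_simps)
    also have "\<dots> \<le> \<bar>s\<bar>" using norm_cis_diff_le[of s 0] by (simp add: norm_mult)
    also have "\<dots> \<le> \<bar>t\<bar>" using s by (auto simp: closed_segment_eq_real_ivl split: if_splits)
    finally show "onorm (\<lambda>h :: real. h *\<^sub>R (\<i> * cis s - \<i>)) \<le> \<bar>t\<bar>" .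
  qed auto
  then show ?thesis by (simp add: power2_eq_square algebra_simps)
qed

lemma norm_ev_series_le:
  assumes "(f has_sum s) UNIV" "\<And>n. cmod (f n) \<le> B * (cmod (coef a n) * weight n)"
  shows "cmod s \<le> B * norm a"
proof -
  have b: "(\<lambda>n. B * (cmod (coef a n) * weight n)) summable_on UNIV"
    by (intro summable_on_cmult_right coef_summable)
  have f: "(\<lambda>n. cmod (f n)) summable_on UNIV"
    by (rule Infinite_Sum.abs_summable_on_comparison_test'[OF b]) (use assms in auto)
  have "cmod s \<le> (\<Sum>\<^sub>\<infinity>n. cmod (f n))"
    using norm_infsum_bound[OF f] assms(1) by (simp add: infsumI)
  also have "\<dots> \<le> (\<Sum>\<^sub>\<infinity>n. B * (cmod (coef a n) * weight n))"
    by (rule infsum_mono[OF f b]) (use assms in auto)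
  also have "\<dots> = B * norm a"
    by (simp add: infsum_cmult_right coef_summable norm_wiener_def)
  finally show ?thesis .
qed

lemma norm_ev_diff_le: "cmod (ev a x - ev a y) \<le> \<bar>x - y\<bar> * norm a"
proof (rule norm_ev_series_le)
  show "((\<lambda>n. coef a n * (cis (of_int n * x) - cis (of_int n * y))) has_sum ev a x - ev a y) UNIV"
    using has_sum_diff[OF ev_has_sum[of a x] ev_has_sum[of a y]] by (simp add: algebra_simps)
  fix n
  have "cmod (cis (of_int n * x) - cis (of_int n * y)) \<le> \<bar>real_of_int n\<bar> * \<bar>x - y\<bar>"
    using norm_cis_diff_le[of "of_int n * x" "of_int n * y"]
    by (simp flip: abs_mult right_diff_distrib)
  also have "\<dots> \<le> weight n * \<bar>x - y\<bar>" by (intro mult_right_mono abs_le_weight) auto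
  finally have "cmod (cis (of_int n * x) - cis (of_int n * y)) \<le> weight n * \<bar>x - y\<bar>" .
  from mult_left_mono[OF this, of "cmod (coef a n)"]
  show "cmod (coef a n * (cis (of_int n * x) - cis (of_int n * y))) \<le> \<bar>x - y\<bar> * (cmod (coef a n) * weight n)"
    by (simp add: norm_mult mult_ac)
qed

lemma continuous_ev [continuous_intros]: "continuous_on A (ev a)"
proof (rule continuous_on_subset[OF _ subset_UNIV], rule lipschitz_on_continuous_on[of "norm a"])
  show "(norm a)-lipschitz_on UNIV (ev a)"
    by (rule lipschitz_onI) (use norm_ev_diff_le in \<open>auto simp: dist_norm mult.commute\<close>)
qed

text \<open>The hypothesis says that the formal derivative belongs to the space. The weight absorbs
  the n^2 in the Taylor remainder of each mode, so the error of the linear approximation is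
  quadratic in y - x.\<close>

lemma ev_has_vector_derivative:
  assumes "\<And>n. coef b n = \<i> * of_int n * coef a n"
  shows "(ev a has_vector_derivative ev b x) (at x)"
proof -
  have *: "cmod (ev a y - ev a x - (y - x) *\<^sub>R ev b x) \<le> (2 * (y - x)\<^sup>2) * norm a" for y
  proof (rule norm_ev_series_le)
    let ?f = "\<lambda>n. coef a n * (cis (of_int n * x) * (cis (of_int n * (y - x)) - 1 - \<i> * of_real (of_int n * (y - x))))"
    have "((\<lambda>n. coef a n * cis (of_int n * y) - coef a n * cis (of_int n * x)
            - (y - x) *\<^sub>R (coef b n * cis (of_int n * x))) has_sum
            (ev a y - ev a x - (y - x) *\<^sub>R ev b x)) UNIV"
      using has_sum_bounded_linear[OF bounded_linear_scaleR_right[of "y - x"] ev_has_sum[of b x]]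
      by (intro has_sum_diff ev_has_sum) (simp add: o_def)
    moreover have "coef a n * cis (of_int n * y) - coef a n * cis (of_int n * x)
            - (y - x) *\<^sub>R (coef b n * cis (of_int n * x)) = ?f n" for n
    proof -
      have "cis (of_int n * y) = cis (of_int n * x) * cis (of_int n * (y - x))"
        by (simp add: cis_mult algebra_simps)
      then show ?thesis by (simp add: assms algebra_simps scaleR_conv_of_real)
    qed
    ultimately show "(?f has_sum (ev a y - ev a x - (y - x) *\<^sub>R ev b x)) UNIV" by simp
    fix n
    have "cmod (?f n) \<le> cmod (coef a n) * (of_int n * (y - x))\<^sup>2"
      unfolding norm_mult norm_cis mult_1_left by (intro mult_left_mono norm_cis_taylor) auto
    also have "\<dots> \<le> cmod (coef a n) * ((2 * weight n) * (y - x)\<^sup>2)"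
      unfolding power_mult_distrib by (intro mult_left_mono mult_right_mono square_le_weight) auto
    finally show "cmod (?f n) \<le> 2 * (y - x)\<^sup>2 * (cmod (coef a n) * weight n)" by (simp add: algebra_simps)
  qed
  show ?thesis
    unfolding has_vector_derivative_def has_derivative_at2
  proof (intro conjI)
    have "((\<lambda>y. 2 * \<bar>y - x\<bar> * norm a) \<longlongrightarrow> 2 * \<bar>x - x\<bar> * norm a) (at x)" by (intro tendsto_intros)
    then have lim: "((\<lambda>y. 2 * \<bar>y - x\<bar> * norm a) \<longlongrightarrow> 0) (at x)" by simp
    have "norm ((ev a y - (ev a x + (y - x) *\<^sub>R ev b x)) /\<^sub>R norm (y - x)) \<le> 2 * \<bar>y - x\<bar> * norm a"
      if "y \<noteq> x" for y
    proof -
      have "norm ((ev a y - (ev a x + (y - x) *\<^sub>R ev b x)) /\<^sub>R norm (y - x))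
          = cmod (ev a y - ev a x - (y - x) *\<^sub>R ev b x) / \<bar>y - x\<bar>"
        by (simp add: divide_inverse diff_diff_eq mult.commute)
      also have "\<dots> \<le> ((2 * (y - x)\<^sup>2) * norm a) / \<bar>y - x\<bar>"
        by (intro divide_right_mono *) auto
      also have "(y - x)\<^sup>2 = \<bar>y - x\<bar> * \<bar>y - x\<bar>" by (simp add: power2_eq_square)
      also have "2 * (\<bar>y - x\<bar> * \<bar>y - x\<bar>) * norm a / \<bar>y - x\<bar> = 2 * \<bar>y - x\<bar> * norm a"
        using that by (simp del: abs_mult_self_eq)
      finally show ?thesis .
    qed
    then show "((\<lambda>y. (1 / norm (y - x)) *\<^sub>R (ev a y - (ev a x + (y - x) *\<^sub>R ev b x))) \<longlongrightarrow> 0) (at x)"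
      unfolding divide_inverse mult_1_left
      by (intro Lim_null_comparison[OF _ lim]) (auto simp: eventually_at_filter)
  qed (rule bounded_linear_scaleR_left)
qed

lemma ev_set_integrable: "set_integrable lborel {s..t} (\<lambda>x. ev a x * cis (r * x))"
  by (rule borel_integrable_atLeastAtMost') (intro continuous_intros)

lemma LINT_cis:
  assumes "n \<noteq> (0 :: int)"
  shows "(LINT x:{-pi..pi}|lborel. cis (of_int n * x)) = 0"
proof -
  have "((\<lambda>x. cis (of_int n * x)) has_integral
          cis (of_int n * pi) / (\<i> * of_int n) - cis (of_int n * - pi) / (\<i> * of_int n)) {-pi..pi}"
    by (rule fundamental_theorem_of_calculus)
       (use assms in \<open>auto intro!: derivative_eq_intros simp: has_vector_derivative_def scaleR_conv_of_real field_simps\<close>)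
  moreover have "set_integrable lborel {-pi..pi} (\<lambda>x. cis (of_int n * x))"
    by (rule borel_integrable_atLeastAtMost') (intro continuous_intros)
  moreover have "cis (of_int n * pi) = cis (of_int n * - pi)"
    by (simp add: complex_eq_iff sin_zero_iff_int2)
  ultimately show ?thesis
    by (simp add: set_borel_integral_eq_integral integral_unique)
qed

text \<open>Both sides are bounded linear in \<open>a\<close>, so orthogonality of single modes
  suffices. The formula makes \<open>ev\<close> injective and identifies \<open>coef\<close> with
  the Fourier coefficients that define the Sobolev spaces.\<close>

lemma coef_eq_integral:
  "coef a n = of_real (1 / (2 * pi)) * (LINT x:{-pi..pi}|lborel. ev a x * cis (- of_int n * x))"
proof (rule wiener_linear_eqI[where a = a, OF bounded_linear_coef])
  have "bounded_linear (\<lambda>a. (LINT x:{-pi..pi}|lborel. ev a x * cis (- of_int n * x)))"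
  proof (rule bounded_linear_intro[of _ "2 * pi"])
    show "(LINT x:{-pi..pi}|lborel. ev (a + b) x * cis (- of_int n * x)) =
      (LINT x:{-pi..pi}|lborel. ev a x * cis (- of_int n * x)) + (LINT x:{-pi..pi}|lborel. ev b x * cis (- of_int n * x))"
      for a b
      unfolding ev_add distrib_right by (rule set_integral_add) (rule ev_set_integrable)+
    show "(LINT x:{-pi..pi}|lborel. ev (r *\<^sub>R a) x * cis (- of_int n * x)) =
      r *\<^sub>R (LINT x:{-pi..pi}|lborel. ev a x * cis (- of_int n * x))" for r a
      by (simp add: ev_scaleR)
    show "norm (LINT x:{-pi..pi}|lborel. ev a x * cis (- of_int n * x)) \<le> norm a * (2 * pi)" for a
    proof -
      have "norm (LINT x:{-pi..pi}|lborel. ev a x * cis (- of_int n * x))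
            \<le> (LINT x:{-pi..pi}|lborel. norm (ev a x * cis (- of_int n * x)))"
        by (rule set_integral_norm_bound) (rule ev_set_integrable)
      also have "\<dots> \<le> (LINT x:{-pi..pi}|lborel. norm a)"
        by (rule set_integral_mono[OF set_integrable_norm[OF ev_set_integrable]])
           (auto simp: norm_mult norm_ev_le borel_integrable_atLeastAtMost')
      finally show ?thesis by (simp add: set_lebesgue_integral_def mult.commute)
    qed
  qed
  then show "bounded_linear (\<lambda>a. of_real (1 / (2 * pi)) * (LINT x:{-pi..pi}|lborel. ev a x * cis (- of_int n * x)))"
    by (rule bounded_linear_const_mult)
  show "coef (mode k c) n = of_real (1 / (2 * pi)) * (LINT x:{-pi..pi}|lborel. ev (mode k c) x * cis (- of_int n * x))"
    for k c
  proof (cases "k = n")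
    case True
    have "ev (mode k c) x * cis (- of_int n * x) = c" for x
      using True by (simp add: ev_mode mult.assoc cis_mult)
    then show ?thesis
      using True by (simp add: coef_mode set_lebesgue_integral_def scaleR_conv_of_real del: of_int_minus)
  next
    case False
    have "ev (mode k c) x * cis (- of_int n * x) = c * cis (of_int (k - n) * x)" for x
      by (simp add: ev_mode cis_mult algebra_simps)
    then show ?thesis using False by (simp add: coef_mode LINT_cis del: of_int_diff)
  qed
qed

lemma ev_inject: "(\<And>x. ev a x = ev b x) \<Longrightarrow> a = b"
  by (rule wiener_eqI) (simp add: coef_eq_integral)

section \<open>The convolution product\<close>

lemma bij_shear: "bij_betw (\<lambda>(n, k). (k, n - k)) UNIV (UNIV :: (int \<times> int) set)"
  by (rule bij_betw_byWitness[where f' = "\<lambda>(k, l). (k + l, k)"]) auto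

text \<open>Submultiplicativity of the weight bounds the weighted double family by a product of two
  summable families, regrouped along n = k + l.\<close>

lemma
  fixes a b :: wiener
  shows conv_summable: "(\<lambda>k. cmod (coef a k * coef b (n - k))) summable_on UNIV"
    and conv_norm_summable: "(\<lambda>n. cmod (\<Sum>\<^sub>\<infinity>k. coef a k * coef b (n - k)) * weight n) summable_on UNIV"
    and conv_norm_le: "(\<Sum>\<^sub>\<infinity>n. cmod (\<Sum>\<^sub>\<infinity>k. coef a k * coef b (n - k)) * weight n) \<le> norm a * norm b"
proof -
  let ?P = "\<lambda>n k. cmod (coef a k * coef b (n - k)) * weight n"
  let ?Q = "\<lambda>n k. (cmod (coef a k) * weight k) * (cmod (coef b (n - k)) * weight (n - k))"
  have "((\<lambda>(k, l). (cmod (coef a k) * weight k) * (cmod (coef b l) * weight l)) has_sum norm a * norm b) (UNIV \<times> UNIV)"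
    unfolding norm_wiener_def by (rule has_sum_product) (use coef_summable in auto)
  then have "((\<lambda>p. (\<lambda>(k, l). (cmod (coef a k) * weight k) * (cmod (coef b l) * weight l)) ((\<lambda>(n, k). (k, n - k)) p))
      has_sum norm a * norm b) UNIV"
    unfolding has_sum_reindex_bij_betw[OF bij_shear] by simp
  then have Q: "((\<lambda>(n, k). ?Q n k) has_sum norm a * norm b) (UNIV \<times> UNIV)"
    by (simp add: case_prod_unfold)
  have PQ: "?P n k \<le> ?Q n k" for n k
  proof -
    have "weight n \<le> weight k * weight (n - k)" using weight_add[of k "n - k"] by simp
    then have "?P n k \<le> cmod (coef a k * coef b (n - k)) * (weight k * weight (n - k))"
      by (intro mult_left_mono) auto
    then show ?thesis by (simp add: norm_mult mult_ac)
  qed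
  have P: "(\<lambda>(n, k). ?P n k) summable_on (UNIV \<times> UNIV)"
    by (rule summable_on_comparison_test[OF has_sum_imp_summable[OF Q]]) (use PQ in auto)
  have "(\<lambda>k. ?P n k) summable_on UNIV" for n
    using summable_on_SigmaD1[OF P, of n] by simp
  then show S: "(\<lambda>k. cmod (coef a k * coef b (n - k))) summable_on UNIV" for n
    by (rule summable_on_comparison_test) (auto intro: le_mult_weight)
  have le: "cmod (\<Sum>\<^sub>\<infinity>k. coef a k * coef b (n - k)) * weight n \<le> (\<Sum>\<^sub>\<infinity>k. ?P n k)" for n
    using norm_infsum_bound[OF S[of n]]
    by (simp add: infsum_cmult_left[OF S[of n]] mult_right_mono)
  have sum: "(\<lambda>n. \<Sum>\<^sub>\<infinity>k. ?P n k) summable_on UNIV"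
    using summable_on_Sigma_banach[OF P] by simp
  then show N: "(\<lambda>n. cmod (\<Sum>\<^sub>\<infinity>k. coef a k * coef b (n - k)) * weight n) summable_on UNIV"
    by (rule summable_on_comparison_test) (use le in auto)
  have "(\<Sum>\<^sub>\<infinity>n. cmod (\<Sum>\<^sub>\<infinity>k. coef a k * coef b (n - k)) * weight n) \<le> (\<Sum>\<^sub>\<infinity>n. \<Sum>\<^sub>\<infinity>k. ?P n k)"
    by (rule infsum_mono[OF N sum]) (rule le)
  also have "\<dots> = infsum (\<lambda>(n, k). ?P n k) (UNIV \<times> UNIV)"
    by (rule infsum_Sigma'_banach[OF P])
  also have "\<dots> \<le> infsum (\<lambda>(n, k). ?Q n k) (UNIV \<times> UNIV)"
    by (rule infsum_mono[OF P has_sum_imp_summable[OF Q]]) (use PQ in auto)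
  also have "\<dots> = norm a * norm b" using Q by (rule infsumI)
  finally show "(\<Sum>\<^sub>\<infinity>n. cmod (\<Sum>\<^sub>\<infinity>k. coef a k * coef b (n - k)) * weight n) \<le> norm a * norm b" .
qed

instantiation wiener :: "{times, one}"
begin

definition times_wiener :: "wiener \<Rightarrow> wiener \<Rightarrow> wiener" where
  "a * b = Wiener (\<lambda>n. \<Sum>\<^sub>\<infinity>k. coef a k * coef b (n - k))"
definition one_wiener :: wiener where "1 = mode 0 1"

instance ..

end

lemma coef_mult: "coef (a * b) n = (\<Sum>\<^sub>\<infinity>k. coef a k * coef b (n - k))"
  unfolding times_wiener_def by (simp add: coef_Wiener[OF conv_norm_summable])

lemma norm_mult_wiener: "norm (a * b) \<le> norm a * (norm b :: real)" for a b :: wiener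
  using conv_norm_le[of a b] by (simp add: norm_wiener_def coef_mult)

lemma ev_mult: "ev (a * b) x = ev a x * ev b x"
proof -
  let ?G = "\<lambda>n k. (coef a k * cis (of_int k * x)) * (coef b (n - k) * cis (of_int (n - k) * x))"
  have "((\<lambda>(k, l). (coef a k * cis (of_int k * x)) * (coef b l * cis (of_int l * x)))
      has_sum ev a x * ev b x) (UNIV \<times> UNIV)"
    unfolding ev_def by (rule has_sum_product) (rule ev_abs_summable)+
  then have "((\<lambda>p. (\<lambda>(k, l). (coef a k * cis (of_int k * x)) * (coef b l * cis (of_int l * x)))
      ((\<lambda>(n, k). (k, n - k)) p)) has_sum ev a x * ev b x) UNIV"
    unfolding has_sum_reindex_bij_betw[OF bij_shear] by simp
  then have G: "((\<lambda>(n, k). ?G n k) has_sum ev a x * ev b x) (UNIV \<times> UNIV)"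
    by (simp add: case_prod_unfold)
  have "((\<lambda>n. coef (a * b) n * cis (of_int n * x)) has_sum ev a x * ev b x) UNIV"
  proof (rule has_sum_SigmaD[OF G])
    fix n :: int
    have "?G n k = coef a k * coef b (n - k) * cis (of_int n * x)" for k
    proof -
      have "cis (of_int k * x) * cis (of_int (n - k) * x) = cis (of_int n * x)"
        by (simp add: cis_mult algebra_simps)
      then show ?thesis by (metis (no_types, lifting) mult.assoc mult.left_commute)
    qed
    moreover have "((\<lambda>k. coef a k * coef b (n - k) * cis (of_int n * x)) has_sum coef (a * b) n * cis (of_int n * x)) UNIV"
      unfolding coef_mult
      by (intro has_sum_cmult_left has_sum_infsum) (rule abs_summable_summable[OF conv_summable])
    ultimately show "((\<lambda>k. case (n, k) of (n, k) \<Rightarrow> ?G n k) has_sum coef (a * b) n * cis (of_int n * x)) UNIV"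
      by (simp only: prod.case)
  qed
  then show ?thesis by (rule has_sum_unique[OF ev_has_sum])
qed

lemma ev_one: "ev 1 x = 1"
  by (simp add: one_wiener_def ev_mode)

text \<open>The ring axioms are inherited from pointwise multiplication because \<^const>\<open>ev\<close> is injective.\<close>

instance wiener :: "{real_normed_algebra_1, comm_ring_1}"
proof
  fix a b c :: wiener and r :: real
  show "a * b * c = a * (b * c)" "a * b = b * a" "1 * a = a" "a * 1 = a"
    "(a + b) * c = a * c + b * c" "a * (b + c) = a * b + a * c"
    "r *\<^sub>R a * b = r *\<^sub>R (a * b)" "a * r *\<^sub>R b = r *\<^sub>R (a * b)"
    by (rule ev_inject; simp add: ev_mult ev_add ev_one ev_scaleR algebra_simps)+
  have "ev 0 0 \<noteq> ev 1 0" by (simp add: ev_one ev_zero)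
  then show "(0 :: wiener) \<noteq> 1" by metis
  show "norm (a * b) \<le> norm a * norm b" by (rule norm_mult_wiener)
  show "norm (1 :: wiener) = 1" by (simp add: one_wiener_def norm_mode weight_def)
qed

lemma ev_power: "ev (a ^ n) x = ev a x ^ n"
  by (induction n) (simp_all add: ev_one ev_mult)

text \<open>Separability makes \<^typ>\<open>wiener\<close> a target type for Bochner integration.\<close>

definition rat_mode :: "(int \<times> rat \<times> rat) list \<Rightarrow> wiener" where
  "rat_mode xs = (\<Sum>(n, p, q)\<leftarrow>xs. mode n (Complex (of_rat p) (of_rat q)))"

lemma rat_approx: "\<exists>p q. cmod (c - Complex (of_rat p) (of_rat q)) < e" if "e > 0"
proof -
  obtain p where p: "Re c - e / 2 < of_rat p" "of_rat p < Re c + e / 2"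
    using of_rat_dense[of "Re c - e / 2" "Re c + e / 2"] \<open>e > 0\<close> by auto
  obtain q where q: "Im c - e / 2 < of_rat q" "of_rat q < Im c + e / 2"
    using of_rat_dense[of "Im c - e / 2" "Im c + e / 2"] \<open>e > 0\<close> by auto
  have "cmod (c - Complex (of_rat p) (of_rat q)) \<le> \<bar>Re c - of_rat p\<bar> + \<bar>Im c - of_rat q\<bar>"
    using cmod_le[of "c - Complex (of_rat p) (of_rat q)"] by simp
  also have "\<dots> < e" using p q by linarith
  finally show ?thesis by blast
qed

lemma rat_mode_approx_mode: "\<exists>xs. norm (mode n c - rat_mode xs) < e" if e: "e > 0"
proof -
  obtain p q where "cmod (c - Complex (of_rat p) (of_rat q)) < e / weight n"
    using rat_approx[of "e / weight n" c] e by auto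
  then have "norm (mode n c - rat_mode [(n, p, q)]) < e"
    by (simp add: rat_mode_def norm_mode field_simps flip: mode_diff)
  then show ?thesis by blast
qed

lemma rat_mode_approx_sum:
  assumes "finite F" "e > 0"
  shows "\<exists>xs. norm ((\<Sum>n\<in>F. mode n (f n)) - rat_mode xs) < e"
  using assms
proof (induction F arbitrary: e)
  case empty
  then show ?case by (intro exI[of _ "[]"]) (simp add: rat_mode_def)
next
  case (insert n F)
  obtain xs where xs: "norm ((\<Sum>n\<in>F. mode n (f n)) - rat_mode xs) < e / 2"
    using insert.IH[of "e / 2"] insert.prems by auto
  obtain ys where ys: "norm (mode n (f n) - rat_mode ys) < e / 2"
    using rat_mode_approx_mode[of "e / 2" n "f n"] insert.prems by auto
  have "norm ((\<Sum>n\<in>insert n F. mode n (f n)) - rat_mode (ys @ xs)) =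
      norm ((mode n (f n) - rat_mode ys) + ((\<Sum>n\<in>F. mode n (f n)) - rat_mode xs))"
    using insert.hyps by (simp add: rat_mode_def algebra_simps)
  also have "\<dots> < e" by (rule norm_triangle_lt) (use xs ys in linarith)
  finally show ?case by blast
qed

lemma rat_mode_dense: "\<exists>xs. dist a (rat_mode xs) < e" if e: "e > 0"
proof -
  have "\<exists>F. finite F \<and> F \<subseteq> UNIV \<and> dist (\<Sum>n\<in>F. mode n (coef a n)) a \<le> e / 2"
    using has_sum_finite_approximation[OF mode_has_sum[of a], of "e / 2"] e by auto
  then obtain F where F: "finite F" "dist (\<Sum>n\<in>F. mode n (coef a n)) a \<le> e / 2" by blast
  obtain xs where "norm ((\<Sum>n\<in>F. mode n (coef a n)) - rat_mode xs) < e / 2"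
    using rat_mode_approx_sum[OF F(1), of "e / 2" "coef a"] e by auto
  then have "dist (\<Sum>n\<in>F. mode n (coef a n)) (rat_mode xs) < e / 2" by (simp add: dist_norm)
  with F(2) have "dist a (rat_mode xs) < e"
    using dist_triangle3[of a "rat_mode xs" "\<Sum>n\<in>F. mode n (coef a n)"] by linarith
  then show ?thesis by blast
qed

instance wiener :: second_countable_topology
proof
  define B where "B = (\<lambda>(xs, q). ball (rat_mode xs) (of_rat q)) ` UNIV"
  have "topological_basis B"
  proof (rule topological_basisI)
    fix U :: "wiener set" and a assume U: "open U" "a \<in> U"
    then obtain e where e: "e > 0" "ball a e \<subseteq> U" by (meson openE)
    obtain q where q: "0 < (of_rat q :: real)" "of_rat q < e / 2"
      using of_rat_dense[of 0 "e / 2"] e by auto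
    obtain xs where xs: "dist a (rat_mode xs) < of_rat q" using rat_mode_dense[OF q(1)] by blast
    have "ball (rat_mode xs) (of_rat q) \<subseteq> ball a e"
    proof
      fix b assume "b \<in> ball (rat_mode xs) (of_rat q)"
      then show "b \<in> ball a e"
        using dist_triangle[of a b "rat_mode xs"] xs q by simp
    qed
    moreover have "a \<in> ball (rat_mode xs) (of_rat q)" using xs by (simp add: dist_commute)
    ultimately show "\<exists>B'\<in>B. a \<in> B' \<and> B' \<subseteq> U"
      using e unfolding B_def by blast
  qed (auto simp: B_def)
  then have "open = generate_topology B" by (rule topological_basis_imp_subbasis)
  moreover have "countable B" unfolding B_def by simp
  ultimately show "\<exists>B :: wiener set set. countable B \<and> open = generate_topology B" by blast
qed

section \<open>Fourier multipliers and the binomial series\<close>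

definition multiplier :: "(int \<Rightarrow> complex) \<Rightarrow> wiener \<Rightarrow> wiener" where
  "multiplier \<mu> a = Wiener (\<lambda>n. \<mu> n * coef a n)"

lemma
  assumes "\<And>n. cmod (\<mu> n) \<le> B"
  shows coef_multiplier: "coef (multiplier \<mu> a) n = \<mu> n * coef a n"
    and norm_multiplier_le: "norm (multiplier \<mu> a) \<le> B * norm a"
proof -
  have "(\<Sum>n\<in>F. cmod (\<mu> n * coef a n) * weight n) \<le> B * norm a" if "finite F" for F
  proof -
    have "B \<ge> 0" using order_trans[OF norm_ge_zero assms] .
    have "(\<Sum>n\<in>F. cmod (\<mu> n * coef a n) * weight n) \<le> (\<Sum>n\<in>F. B * (cmod (coef a n) * weight n))"
      unfolding norm_mult mult.assoc by (intro sum_mono mult_right_mono assms) auto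
    also have "\<dots> \<le> B * norm a"
      unfolding sum_distrib_left [symmetric] using \<open>B \<ge> 0\<close> that
      by (intro mult_left_mono sum_coef_le_norm)
    finally show ?thesis .
  qed
  note * = Wiener_bounded[of "\<lambda>n. \<mu> n * coef a n", OF this]
  show "coef (multiplier \<mu> a) n = \<mu> n * coef a n" "norm (multiplier \<mu> a) \<le> B * norm a"
    using * by (simp_all add: multiplier_def)
qed

lemma bounded_linear_multiplier:
  assumes "\<And>n. cmod (\<mu> n) \<le> B"
  shows "bounded_linear (multiplier \<mu>)"
  using norm_multiplier_le[OF assms]
  by (intro bounded_linear_intro[of _ B])
     (auto intro!: wiener_eqI simp: coef_multiplier[OF assms] coef_add coef_scaleR algebra_simps)

lemma multiplier_diff: "(\<And>n. cmod (\<mu> n) \<le> B) \<Longrightarrow> multiplier \<mu> (a - b) = multiplier \<mu> a - multiplier \<mu> b"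
  by (intro wiener_eqI) (simp add: coef_multiplier[where B = B] coef_diff algebra_simps)

lemma multiplier_zero: "(\<And>n. cmod (\<mu> n) \<le> B) \<Longrightarrow> multiplier \<mu> 0 = 0"
  by (intro wiener_eqI) (simp add: coef_multiplier[where B = B] coef_zero)

lemma ev_multiplier_has_sum:
  assumes "\<And>n. cmod (\<mu> n) \<le> B"
  shows "((\<lambda>n. \<mu> n * coef a n * cis (of_int n * x)) has_sum ev (multiplier \<mu> a) x) UNIV"
  using ev_has_sum[of "multiplier \<mu> a" x] by (simp add: coef_multiplier[OF assms])

lemma ev_multiplier_shift:
  assumes "\<And>n. cmod (\<mu> n) \<le> B"
  shows "ev (multiplier (\<lambda>n. \<mu> n * cis (- of_int n * u)) a) x = ev (multiplier \<mu> a) (x - u)"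
proof (rule has_sum_unique[OF ev_multiplier_has_sum[of _ B]])
  show "cmod (\<mu> n * cis (- of_int n * u)) \<le> B" for n by (simp add: norm_mult assms)
  have "\<mu> n * cis (- of_int n * u) * coef a n * cis (of_int n * x) = \<mu> n * coef a n * cis (of_int n * (x - u))" for n
  proof -
    have "cis (- of_int n * u) * cis (of_int n * x) = cis (of_int n * (x - u))"
      by (simp add: cis_mult algebra_simps)
    then show ?thesis by (metis (no_types, lifting) mult.assoc mult.left_commute)
  qed
  then show "((\<lambda>n. \<mu> n * cis (- of_int n * u) * coef a n * cis (of_int n * x)) has_sum ev (multiplier \<mu> a) (x - u)) UNIV"
    using ev_multiplier_has_sum[OF assms, where a = a and x = "x - u"] by (simp only:)
qed

lemma filterlim_symmetric_intervals:
  "filterlim (\<lambda>N :: nat. {- int N..int N}) (finite_subsets_at_top UNIV) sequentially"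
  unfolding filterlim_finite_subsets_at_top
proof safe
  fix F :: "int set" assume "finite F"
  then have "finite ((\<lambda>n. nat \<bar>n\<bar>) ` F)" by simp
  then obtain K where K: "\<And>n. n \<in> F \<Longrightarrow> nat \<bar>n\<bar> \<le> K"
    by (meson finite_nat_set_iff_bounded_le imageI)
  show "\<forall>\<^sub>F N in sequentially. finite {- int N..int N} \<and> F \<subseteq> {- int N..int N} \<and> {- int N..int N} \<subseteq> UNIV"
    using eventually_ge_at_top[of K]
  proof eventually_elim
    case (elim N)
    have "n \<in> {- int N..int N}" if "n \<in> F" for n using K[OF that] elim by auto
    then show ?case by auto
  qed
qed

text \<open>Unordered sums become limits of sequences, the form in which measurability of limits and
  monotone convergence apply.\<close>

lemma has_sum_imp_LIMSEQ:
  fixes f :: "int \<Rightarrow> 'a :: {comm_monoid_add, topological_space}"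
  assumes "(f has_sum s) UNIV"
  shows "(\<lambda>N. \<Sum>n\<in>{- int N..int N}. f n) \<longlonglongrightarrow> s"
  using filterlim_compose[OF assms[unfolded has_sum_def] filterlim_symmetric_intervals] by simp

lemma bounded_linear_mode: "bounded_linear (mode n)"
  by (rule bounded_linear_intro[of _ "weight n"])
     (auto intro!: wiener_eqI simp: coef_mode coef_add coef_scaleR norm_mode)

lemma borel_measurable_multiplier:
  assumes [measurable]: "\<And>n. (\<lambda>u. \<mu> u n) \<in> borel_measurable M"
    and bound: "\<And>u n. u \<in> space M \<Longrightarrow> cmod (\<mu> u n) \<le> B u"
  shows "(\<lambda>u. multiplier (\<mu> u) a) \<in> borel_measurable M"
proof (rule borel_measurable_LIMSEQ_metric)
  have mode [measurable]: "mode n \<in> borel_measurable borel" for n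
    by (intro borel_measurable_continuous_onI linear_continuous_on bounded_linear_mode)
  show "(\<lambda>u. \<Sum>n\<in>{- int N..int N}. mode n (\<mu> u n * coef a n)) \<in> borel_measurable M" for N
    by measurable
  show "(\<lambda>N. \<Sum>n\<in>{- int N..int N}. mode n (\<mu> u n * coef a n)) \<longlonglongrightarrow> multiplier (\<mu> u) a" if "u \<in> space M" for u
    using has_sum_imp_LIMSEQ[OF mode_has_sum[of "multiplier (\<mu> u) a"]]
    by (simp add: coef_multiplier[OF bound[OF that]])
qed

text \<open>The per-mode integrals are summed by monotone convergence; a pointwise bound in \<open>u\<close> of the
  norm would lose a logarithm at the exponent that occurs below.\<close>

lemma
  assumes [measurable]: "\<And>n. (\<lambda>u. \<mu> u n) \<in> borel_measurable M" "\<kappa> \<in> borel_measurable M"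
    and bound: "\<And>u n. u \<in> space M \<Longrightarrow> cmod (\<mu> u n) \<le> B u"
    and pos: "\<And>u. u \<in> space M \<Longrightarrow> (0 :: real) \<le> \<kappa> u"
    and int: "\<And>n. integrable M (\<lambda>u. \<kappa> u * cmod (\<mu> u n))"
    and le: "\<And>n. (LINT u|M. \<kappa> u * cmod (\<mu> u n)) \<le> C"
  shows integrable_norm_multiplier: "integrable M (\<lambda>u. \<kappa> u * norm (multiplier (\<mu> u) a))"
    and integral_norm_multiplier_le: "(LINT u|M. \<kappa> u * norm (multiplier (\<mu> u) a)) \<le> C * norm a"
proof -
  define f where "f N u = (\<Sum>n\<in>{- int N..int N}. (\<kappa> u * cmod (\<mu> u n)) * (cmod (coef a n) * weight n))" for N u
  have C: "C \<ge> 0"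
    by (rule order_trans[OF integral_nonneg_AE le[of 0]]) (auto intro!: AE_I2 simp: pos)
  have f_int: "integrable M (f N)" for N
    unfolding f_def by (intro Bochner_Integration.integrable_sum integrable_mult_left int)
  have f_le: "integral\<^sup>L M (f N) \<le> C * norm a" for N
  proof -
    have "integral\<^sup>L M (f N) = (\<Sum>n\<in>{- int N..int N}. (LINT u|M. \<kappa> u * cmod (\<mu> u n)) * (cmod (coef a n) * weight n))"
      unfolding f_def by (subst Bochner_Integration.integral_sum) (auto intro!: integrable_mult_left int)
    also have "\<dots> \<le> (\<Sum>n\<in>{- int N..int N}. C * (cmod (coef a n) * weight n))"
      by (intro sum_mono mult_right_mono le) auto
    also have "\<dots> \<le> C * norm a"
      unfolding sum_distrib_left [symmetric] by (intro mult_left_mono sum_coef_le_norm C) auto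
    finally show ?thesis .
  qed
  have f_mono: "mono (\<lambda>N. f N u)" if "u \<in> space M" for u
    unfolding f_def by (intro monoI sum_mono2) (auto intro!: mult_nonneg_nonneg pos that)
  have f_lim: "(\<lambda>N. f N u) \<longlonglongrightarrow> \<kappa> u * norm (multiplier (\<mu> u) a)" if "u \<in> space M" for u
  proof -
    have "((\<lambda>n. (\<kappa> u * cmod (\<mu> u n)) * (cmod (coef a n) * weight n)) has_sum \<kappa> u * norm (multiplier (\<mu> u) a)) UNIV"
      using has_sum_cmult_right[OF coef_has_norm[of "multiplier (\<mu> u) a"], of "\<kappa> u"]
      by (simp add: coef_multiplier[OF bound[OF that]] norm_mult mult.assoc)
    then show ?thesis unfolding f_def by (rule has_sum_imp_LIMSEQ)
  qed
  have I_mono: "incseq (\<lambda>N. integral\<^sup>L M (f N))"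
    by (intro incseq_SucI integral_mono f_int) (rule monoD[OF f_mono], auto)
  obtain L where L: "(\<lambda>N. integral\<^sup>L M (f N)) \<longlonglongrightarrow> L"
    using incseq_convergent[OF I_mono, of "C * norm a"] f_le by metis
  have [measurable]: "(\<lambda>u. multiplier (\<mu> u) a) \<in> borel_measurable M"
    by (rule borel_measurable_multiplier[OF _ bound]) auto
  have meas: "(\<lambda>u. \<kappa> u * norm (multiplier (\<mu> u) a)) \<in> borel_measurable M" by measurable
  note mc = f_int AE_I2[OF f_mono] AE_I2[OF f_lim] L meas
  show "integrable M (\<lambda>u. \<kappa> u * norm (multiplier (\<mu> u) a))"
    by (rule integrable_monotone_convergence[OF mc])
  have "(LINT u|M. \<kappa> u * norm (multiplier (\<mu> u) a)) = L"
    by (rule integral_monotone_convergence[OF mc])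
  then show "(LINT u|M. \<kappa> u * norm (multiplier (\<mu> u) a)) \<le> C * norm a"
    using LIMSEQ_le_const2[OF L] f_le by auto
qed

section \<open>Real powers near 1 by the binomial series\<close>

lemma norm_power_diff_le:
  fixes p q :: "'a :: {real_normed_algebra_1, comm_ring_1}"
  assumes "norm p \<le> r" "norm q \<le> r"
  shows "norm (p ^ Suc k - q ^ Suc k) \<le> real (Suc k) * r ^ k * norm (p - q)"
proof (induction k)
  case 0
  show ?case by simp
next
  case (Suc k)
  have r: "r \<ge> 0" using assms(1) norm_ge_zero[of p] by linarith
  have "p ^ Suc (Suc k) - q ^ Suc (Suc k) = p * (p ^ Suc k - q ^ Suc k) + (p - q) * q ^ Suc k"
    by (simp add: algebra_simps)
  then have "norm (p ^ Suc (Suc k) - q ^ Suc (Suc k)) \<le> norm p * norm (p ^ Suc k - q ^ Suc k) + norm (p - q) * norm (q ^ Suc k)"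
    by (metis norm_triangle_mono norm_mult_ineq)
  also have "\<dots> \<le> r * (real (Suc k) * r ^ k * norm (p - q)) + norm (p - q) * r ^ Suc k"
    using assms r by (intro add_mono mult_mono Suc.IH order_trans[OF norm_power_ineq] power_mono) auto
  also have "\<dots> = real (Suc (Suc k)) * r ^ Suc k * norm (p - q)" by (simp add: algebra_simps)
  finally show ?case .
qed

definition binom_ser :: "real \<Rightarrow> 'a :: {real_normed_algebra_1, banach} \<Rightarrow> 'a" where
  "binom_ser b p = (\<Sum>k. (b gchoose k) *\<^sub>R p ^ k)"

text \<open>Passing from k to k + 1 multiplies the coefficient by (b - k) / (k + 1), of modulus at
  most 1 because -1 \<le> b \<le> 0. The exponent of interest is b = -\<alpha> / 2.\<close>

lemma abs_gbinomial_le_1: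
  assumes "- 1 \<le> b" "b \<le> (0 :: real)"
  shows "\<bar>b gchoose k\<bar> \<le> 1"
proof (induction k)
  case (Suc k)
  have "(b gchoose Suc k) = (b gchoose k) * ((b - real k) / real (Suc k))"
    by (simp add: gbinomial_prod_rev field_simps)
  moreover have "\<bar>(b - real k) / real (Suc k)\<bar> \<le> 1"
    using assms by (simp add: abs_if field_simps)
  ultimately show ?case
    using mult_mono[OF Suc.IH, of "\<bar>(b - real k) / real (Suc k)\<bar>" 1] by (simp add: abs_mult)
qed simp

context
  fixes b :: real
  assumes b: "- 1 \<le> b" "b \<le> 0"
begin

lemma norm_binom_term_le:
  fixes p :: "'a :: {real_normed_algebra_1, banach}"
  shows "norm ((b gchoose k) *\<^sub>R p ^ k) \<le> norm p ^ k"
  using mult_mono[OF abs_gbinomial_le_1[OF b, of k] norm_power_ineq[of p k]] by simp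

lemma summable_binom_ser:
  fixes p :: "'a :: {real_normed_algebra_1, banach}"
  assumes "norm p < 1"
  shows "summable (\<lambda>k. (b gchoose k) *\<^sub>R p ^ k)"
  by (rule summable_comparison_test'[of "\<lambda>k. norm p ^ k" 0])
     (use assms in \<open>auto intro!: summable_geometric norm_binom_term_le simp del: norm_scaleR\<close>)

text \<open>Evaluation at a point is a continuous ring homomorphism, so it carries the series in the
  algebra to the real binomial series; this identifies the algebraic power with the pointwise
  one.\<close>

lemma ev_binom_ser:
  assumes "norm p < 1" "ev p x = of_real r"
  shows "ev (binom_ser b p) x = of_real ((1 + r) powr b)"
proof -
  have "cmod (of_real r) < 1" using norm_ev_le[of p x] assms by simp
  then have r: "(\<lambda>k. (b gchoose k) * r ^ k) sums (1 + r) powr b"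
    by (intro gen_binomial_real) simp
  have "(\<lambda>k. ev ((b gchoose k) *\<^sub>R p ^ k) x) sums ev (binom_ser b p) x"
    unfolding binom_ser_def
    by (intro bounded_linear.sums[OF bounded_linear_ev] summable_sums summable_binom_ser assms)
  moreover have "ev ((b gchoose k) *\<^sub>R p ^ k) x = of_real ((b gchoose k) * r ^ k)" for k
    unfolding ev_scaleR ev_power assms by (simp add: scaleR_conv_of_real)
  ultimately show ?thesis
    using sums_of_real[OF r, where 'a = complex] by (simp only: sums_unique2)
qed

lemma borel_measurable_binom_ser:
  fixes p :: "'b \<Rightarrow> wiener"
  assumes [measurable]: "p \<in> borel_measurable M" and "\<And>u. u \<in> space M \<Longrightarrow> norm (p u) < 1"
  shows "(\<lambda>u. binom_ser b (p u)) \<in> borel_measurable M"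
proof (rule borel_measurable_LIMSEQ_metric)
  show "(\<lambda>u. \<Sum>k<N. (b gchoose k) *\<^sub>R p u ^ k) \<in> borel_measurable M" for N by measurable
  show "(\<lambda>N. \<Sum>k<N. (b gchoose k) *\<^sub>R p u ^ k) \<longlonglongrightarrow> binom_ser b (p u)" if "u \<in> space M" for u
    unfolding binom_ser_def by (intro summable_LIMSEQ summable_binom_ser assms that)
qed

text \<open>Only terms of index k + 2 remain. In the estimate of p^(k + 2) - q^(k + 2) one factor of
  the radius supplies the small factor and the other k factors, each at most 1/2, make the series
  converge.\<close>

lemma binom_ser_quadratic:
  fixes p q :: wiener
  assumes p: "norm p \<le> 1 / 2" and q: "norm q \<le> 1 / 2"
  shows "norm ((binom_ser b p - 1 - b *\<^sub>R p) - (binom_ser b q - 1 - b *\<^sub>R q))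
         \<le> 8 * (norm p + norm q) * norm (p - q)"
proof -
  let ?t = "\<lambda>p k. (b gchoose k) *\<^sub>R p ^ k :: wiener"
  have split: "binom_ser b x - 1 - b *\<^sub>R x = (\<Sum>k. ?t x (k + 2))" "summable (\<lambda>k. ?t x (k + 2))"
    if "norm x \<le> 1 / 2" for x
  proof -
    have s: "summable (?t x)" by (rule summable_binom_ser) (use that in auto)
    show "binom_ser b x - 1 - b *\<^sub>R x = (\<Sum>k. ?t x (k + 2))"
      unfolding binom_ser_def by (subst suminf_split_initial_segment[OF s, of 2]) (simp add: numeral_2_eq_2)
    show "summable (\<lambda>k. ?t x (k + 2))" using s by (rule summable_ignore_initial_segment)
  qed
  \<comment> \<open>The factor 2 comes from k + 2 \<le> 2 (k + 1); the sum of (k + 1) / 2^k is 4,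
    and 8 = 2 * 4.\<close>
  define d where "d = 2 * (norm p + norm q) * norm (p - q)"
  have d: "d \<ge> 0" by (simp add: d_def)
  have tm: "norm (?t p (k + 2) - ?t q (k + 2)) \<le> d * (real (Suc k) * (1 / 2) ^ k)" for k
  proof -
    define r where "r = max (norm p) (norm q)"
    have r: "r \<ge> 0" "r \<le> 1 / 2" "r \<le> norm p + norm q" using p q by (auto simp: r_def le_max_iff_disj)
    have "norm (?t p (k + 2) - ?t q (k + 2)) = \<bar>b gchoose (k + 2)\<bar> * norm (p ^ Suc (Suc k) - q ^ Suc (Suc k))"
      by (simp flip: scaleR_diff_right)
    also have "\<dots> \<le> 1 * (real (Suc (Suc k)) * r ^ Suc k * norm (p - q))"
      by (intro mult_mono abs_gbinomial_le_1 b norm_power_diff_le) (auto simp: r_def)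
    also have "\<dots> = (real (Suc (Suc k)) * (r * r ^ k)) * norm (p - q)" by simp
    also have "\<dots> \<le> ((2 * real (Suc k)) * ((norm p + norm q) * (1 / 2) ^ k)) * norm (p - q)"
      using r by (intro mult_mono power_mono) auto
    also have "\<dots> = d * (real (Suc k) * (1 / 2) ^ k)" unfolding d_def by (simp only: mult_ac)
    finally show ?thesis .
  qed
  have "(\<lambda>k. real (Suc k) * (1 / 2) ^ k) sums (1 / (1 - 1 / 2)\<^sup>2)"
    using geometric_deriv_sums[of "1 / 2 :: real"] by simp
  then have g: "(\<lambda>k. d * (real (Suc k) * (1 / 2) ^ k)) sums (d * 4)"
    by (intro sums_mult) (simp add: power2_eq_square)
  have "(binom_ser b p - 1 - b *\<^sub>R p) - (binom_ser b q - 1 - b *\<^sub>R q) = (\<Sum>k. ?t p (k + 2) - ?t q (k + 2))"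
    using split[OF p] split[OF q] by (simp add: suminf_diff)
  also have "norm \<dots> \<le> (\<Sum>k. d * (real (Suc k) * (1 / 2) ^ k))"
    by (rule norm_suminf_le[OF tm sums_summable[OF g]])
  also have "\<dots> = d * 4" using g by (rule sums_unique[symmetric])
  finally show ?thesis by (simp add: d_def algebra_simps)
qed

end

section \<open>The kernel on the circle\<close>

text \<open>The integration variable is \<open>u = x - y\<close>, taken in \<open>(0, 2\<pi>)\<close> so that the chord length
  \<open>2 sin (u / 2)\<close> is positive.\<close>

definition circle :: "real measure" where "circle = restrict_space lborel {0<..<2 * pi}"

definition chord :: "real \<Rightarrow> real" where "chord u = 2 * sin (u / 2)"

lemma space_circle: "space circle = {0<..<2 * pi}"
  by (simp add: circle_def space_restrict_space)

lemma measurable_circle [measurable_cong]: "sets circle = sets (restrict_space borel {0<..<2 * pi})"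
  by (simp add: circle_def sets_restrict_space)

lemma borel_measurable_circle: "f \<in> borel_measurable borel \<Longrightarrow> f \<in> borel_measurable circle"
  unfolding circle_def by (rule measurable_restrict_space1) simp

lemma integrable_circle_iff:
  fixes f :: "real \<Rightarrow> 'a :: {banach, second_countable_topology}"
  shows "integrable circle f \<longleftrightarrow> set_integrable lborel {0<..<2 * pi} f"
  unfolding circle_def set_integrable_def by (rule integrable_restrict_space) simp

lemma integral_circle:
  fixes f :: "real \<Rightarrow> 'a :: {banach, second_countable_topology}"
  shows "integral\<^sup>L circle f = (LINT u:{0<..<2 * pi}|lborel. f u)"
  unfolding circle_def set_lebesgue_integral_def by (rule integral_restrict_space) simp

lemma integral_circle_eq_has_integral:
  fixes f :: "real \<Rightarrow> real"
  assumes "integrable circle f" "(f has_integral I) {0..2 * pi}"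
  shows "integral\<^sup>L circle f = I"
  using set_borel_integral_eq_integral[OF assms(1)[unfolded integrable_circle_iff]] assms(2)
  by (simp add: integral_circle has_integral_Icc_iff_Ioo integral_unique)

lemma nonneg_has_integral_circle:
  fixes f :: "real \<Rightarrow> real"
  assumes [measurable]: "f \<in> borel_measurable borel"
    and "\<And>u. u \<in> {0..2 * pi} \<Longrightarrow> 0 \<le> f u" "(f has_integral I) {0..2 * pi}"
  shows "integrable circle f" "integral\<^sup>L circle f = I"
proof -
  have "f absolutely_integrable_on {0<..<2 * pi}"
    using assms(2,3) by (intro nonnegative_absolutely_integrable_1)
      (auto simp: has_integral_Icc_iff_Ioo has_integral_integrable)
  then have "integrable lborel (\<lambda>u. indicator {0<..<2 * pi} u *\<^sub>R f u)"
    unfolding set_integrable_def by (subst (asm) integrable_completion) auto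
  then show "integrable circle f" by (simp add: integrable_circle_iff set_integrable_def)
  then show "integral\<^sup>L circle f = I" using assms(3) by (rule integral_circle_eq_has_integral)
qed

lemma
  fixes f :: "real \<Rightarrow> 'a :: {banach, second_countable_topology}"
  shows integrable_circle_reflect: "integrable circle f \<Longrightarrow> integrable circle (\<lambda>u. f (2 * pi - u))"
    and integral_circle_reflect: "integral\<^sup>L circle (\<lambda>u. f (2 * pi - u)) = integral\<^sup>L circle f"
proof -
  have ind: "indicator {0<..<2 * pi} (2 * pi - u) = (indicator {0<..<2 * pi} u :: real)" for u :: real
    by (auto simp: indicator_def)
  show "integrable circle f \<Longrightarrow> integrable circle (\<lambda>u. f (2 * pi - u))"
    using lborel_integrable_real_affine[of "\<lambda>u. indicator {0<..<2 * pi} u *\<^sub>R f u" "- 1" "2 * pi"]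
    by (simp add: integrable_circle_iff set_integrable_def ind)
  show "integral\<^sup>L circle (\<lambda>u. f (2 * pi - u)) = integral\<^sup>L circle f"
    using lborel_integral_real_affine[of "- 1" "\<lambda>u. indicator {0<..<2 * pi} u *\<^sub>R f u" "2 * pi"]
    by (simp add: integral_circle set_lebesgue_integral_def ind)
qed

lemma integral_circle_odd:
  fixes f :: "real \<Rightarrow> real"
  assumes "\<And>u. f (2 * pi - u) = - f u"
  shows "integral\<^sup>L circle f = 0"
  using integral_circle_reflect[of f] by (simp add: assms)

section \<open>The chord length and integrals of its powers\<close>

lemma chord_pos: "u \<in> {0<..<2 * pi} \<Longrightarrow> 0 < chord u"
  unfolding chord_def by (auto intro!: sin_gt_zero)

lemma chord_le_2: "chord u \<le> 2"
  unfolding chord_def by simp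

lemma chord_reflect: "chord (2 * pi - u) = chord u"
  by (simp add: chord_def diff_divide_distrib)

lemma chord_measurable [measurable]: "chord \<in> borel_measurable borel"
  unfolding chord_def by measurable

lemma chord_square: "chord u ^ 2 = 2 - 2 * cos u"
  using cos_double_sin[of "u / 2"] by (simp add: chord_def power_mult_distrib)

text \<open>The substitution t = (1 - cos (u / 2)) / 2 maps (0, 2 pi) onto (0, 1) with t (1 - t) =
  (chord u / 4)^2, which gives a symmetric Beta integral. The constant collects the powers of 4 and
  the factor sin (u / 2) / 4 = chord u / 8 of the substitution.\<close>

lemma integral_chord_powr:
  fixes e :: real
  assumes "e > - 1"
  shows "integrable circle (\<lambda>u. chord u powr e)"
    and "integral\<^sup>L circle (\<lambda>u. chord u powr e) = 8 * 4 powr (e - 1) * Beta ((e + 1) / 2) ((e + 1) / 2)"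
proof -
  define b where "b = (e + 1) / 2"
  define f where "f t = t powr (b - 1) * (1 - t) powr (b - 1)" for t :: real
  define g where "g u = (1 - cos (u / 2)) / 2" for u :: real
  have b: "b > 0" using assms by (simp add: b_def)
  have g_ends: "g 0 = 0" "g (2 * pi) = 1" by (simp_all add: g_def)
  have f_int: "set_integrable lborel {g 0..g (2 * pi)} f"
    unfolding f_def g_ends by (rule integrable_Beta) fact+
  have g': "(g has_real_derivative sin (u / 2) / 4) (at u)" for u
    unfolding g_def by (auto intro!: derivative_eq_intros)
  have g'_nonneg: "sin (u / 2) / 4 \<ge> 0" if "u \<in> {0..2 * pi}" for u
    using that by (auto intro!: sin_ge_zero)
  have g'_cont: "continuous_on {0..2 * pi} (\<lambda>u. sin (u / 2) / 4 :: real)"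
    by (intro continuous_intros) auto
  note sub = integral_substitution[OF f_int g' g'_cont g'_nonneg]
  have s1: "set_integrable lborel {0..2 * pi} (\<lambda>u. f (g u) * (sin (u / 2) / 4))"
    and s2: "(LBINT t. f t * indicator {g 0..g (2 * pi)} t)
      = (LBINT u. f (g u) * (sin (u / 2) / 4) * indicator {0..2 * pi} u)"
    using sub by simp_all
  have eq: "f (g u) * (sin (u / 2) / 4) = chord u powr e / (8 * 4 powr (e - 1))" if "u \<in> {0<..<2 * pi}" for u
  proof -
    have c: "cos (u / 2) < 1" "- 1 < cos (u / 2)"
      using that cos_monotone_0_pi[of 0 "u / 2"] cos_monotone_0_pi[of "u / 2" pi] by auto
    have "g u * (1 - g u) = (chord u / 4) ^ 2"
      using sin_squared_eq[of "u / 2"] by (simp add: g_def chord_def power_divide power_mult_distrib)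
        (simp add: power2_eq_square field_simps)
    moreover have "0 < g u" "0 < 1 - g u" using c by (auto simp: g_def field_simps)
    ultimately have "f (g u) = ((chord u / 4) ^ 2) powr (b - 1)"
      by (simp add: f_def flip: powr_mult)
    also have "\<dots> = (chord u / 4) powr (2 * (b - 1))"
      using chord_pos[OF that] by (simp add: powr_powr flip: powr_numeral)
    also have "2 * (b - 1) = e - 1" by (simp add: b_def)
    also have "(chord u / 4) powr (e - 1) = chord u powr (e - 1) / 4 powr (e - 1)"
      using chord_pos[OF that] by (simp add: powr_divide)
    finally have "f (g u) * (sin (u / 2) / 4) = chord u powr (e - 1) * chord u / (8 * 4 powr (e - 1))"
      by (simp add: chord_def mult_ac)
    then show ?thesis
      using chord_pos[OF that] by (simp add: powr_mult_base powr_diff)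
  qed
  have "integrable circle (\<lambda>u. f (g u) * (sin (u / 2) / 4))"
    unfolding integrable_circle_iff by (rule set_integrable_subset[OF s1]) auto
  then have "integrable circle (\<lambda>u. chord u powr e / (8 * 4 powr (e - 1)))"
    by (rule Bochner_Integration.integrable_cong[OF refl, THEN iffD1, rotated]) (rule eq, simp only: space_circle)
  then show int: "integrable circle (\<lambda>u. chord u powr e)"
    using integrable_mult_right[of "8 * 4 powr (e - 1)" circle "\<lambda>u. chord u powr e / (8 * 4 powr (e - 1))"]
    by simp
  have "Beta b b = (LBINT t. f t * indicator {g 0..g (2 * pi)} t)"
  proof -
    have "Beta b b = integral {0..1} f"
      using integral_unique[OF has_integral_Beta_real[OF b b]] by (simp add: f_def[abs_def])
    also have "\<dots> = (LINT t:{0..1}|lborel. f t)"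
      by (rule set_borel_integral_eq_integral(2)[OF f_int[unfolded g_ends], symmetric])
    finally show ?thesis unfolding g_ends by (simp add: set_lebesgue_integral_def mult.commute)
  qed
  also have "\<dots> = (LINT u:{0..2 * pi}|lborel. f (g u) * (sin (u / 2) / 4))"
    unfolding s2 set_lebesgue_integral_def real_scaleR_def by (simp only: mult.commute)
  also have "\<dots> = integral {0..2 * pi} (\<lambda>u. f (g u) * (sin (u / 2) / 4))"
    by (rule set_borel_integral_eq_integral(2)[OF s1])
  also have "\<dots> = integral {0<..<2 * pi} (\<lambda>u. f (g u) * (sin (u / 2) / 4))"
    by (simp add: integral_open_interval_real)
  also have "\<dots> = integral {0<..<2 * pi} (\<lambda>u. chord u powr e / (8 * 4 powr (e - 1)))"
    by (rule integral_cong) (rule eq)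
  also have "\<dots> = integral {0<..<2 * pi} (\<lambda>u. chord u powr e) / (8 * 4 powr (e - 1))"
    by simp
  also have "integral {0<..<2 * pi} (\<lambda>u. chord u powr e) = integral\<^sup>L circle (\<lambda>u. chord u powr e)"
    using set_borel_integral_eq_integral(2)[OF int[unfolded integrable_circle_iff]] by (simp add: integral_circle)
  finally show "integral\<^sup>L circle (\<lambda>u. chord u powr e) = 8 * 4 powr (e - 1) * Beta ((e + 1) / 2) ((e + 1) / 2)"
    by (simp add: b_def field_simps)
qed

text \<open>Up to pi / 3 the derivative of sin is at least 1/2; beyond it sin is at least sqrt 3 /
  2, while x / 2 is at most pi / 4.\<close>

lemma sin_ge_half: "x / 2 \<le> sin x" if "0 \<le> x" "x \<le> pi / 2"
proof (cases "x \<le> pi / 3")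
  case True
  have "(\<lambda>x. sin x - x / 2) 0 \<le> (\<lambda>x. sin x - x / 2) x"
  proof (rule DERIV_nonneg_imp_nondecreasing[OF \<open>0 \<le> x\<close>])
    fix t assume t: "0 \<le> t" "t \<le> x"
    have "cos (pi / 3) \<le> cos t" using t True by (intro cos_monotone_0_pi_le) auto
    then show "\<exists>y. ((\<lambda>x. sin x - x / 2) has_real_derivative y) (at t) \<and> 0 \<le> y"
      by (intro exI[of _ "cos t - 1 / 2"]) (auto intro!: derivative_eq_intros simp: cos_60)
  qed
  then show ?thesis by simp
next
  case False
  have "sin (pi / 3) \<le> sin x" using False that by (intro sin_monotone_2pi_le) auto
  moreover have "(1.7 :: real) \<le> sqrt 3" by (rule real_le_rsqrt) (simp add: power2_eq_square)
  ultimately show ?thesis using that pi_approx by (simp add: sin_60)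
qed

lemma chord_ge: "u / 2 \<le> chord u" if "0 \<le> u" "u \<le> pi"
  using sin_ge_half[of "u / 2"] that by (simp add: chord_def)

text \<open>|z^k - 1| \<le> k |z - 1| on the unit circle. Measuring by the chord instead of |u|
  makes the bound effective at both ends of (0, 2 pi).\<close>

lemma norm_cis_multiple_le: "cmod (cis (- of_int n * u) - 1) \<le> \<bar>of_int n\<bar> * \<bar>chord u\<bar>"
proof -
  have nat: "cmod (z ^ k - 1) \<le> real k * cmod (z - 1)" if "cmod z = 1" for z k
    using norm_power_diff[of z 1 k] that by simp
  have 1: "cmod (cis t - 1) = 2 * \<bar>sin (t / 2)\<bar>" for t
    using norm_cis_diff[of t 0] by simp
  have "cmod (cis (- of_int n * u) - 1) = cmod (cis (real (nat \<bar>n\<bar>) * u) - 1)"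
    unfolding 1 by (cases "n \<ge> 0") (auto simp: abs_if)
  also have "\<dots> = cmod (cis u ^ nat \<bar>n\<bar> - 1)" by (simp only: Complex.DeMoivre)
  also have "\<dots> \<le> real (nat \<bar>n\<bar>) * cmod (cis u - 1)" by (rule nat) simp
  finally show ?thesis unfolding 1 by (simp add: chord_def abs_mult)
qed

section \<open>The singular kernel\<close>

locale gsqg =
  fixes \<alpha> :: real
  assumes alpha: "1 < \<alpha>" "\<alpha> < 2"
begin

text \<open>For the disk R = 1 the squared distance D is the squared chord, so this is
  \<open>D powr (- \<alpha> / 2)\<close> there.\<close>

definition kernel :: "real \<Rightarrow> real" where "kernel u = chord u powr (- \<alpha>)"

lemma kernel_measurable [measurable]: "kernel \<in> borel_measurable borel"
  unfolding kernel_def by measurable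

lemma kernel_nonneg: "0 \<le> kernel u"
  by (simp add: kernel_def)

lemma kernel_reflect: "kernel (2 * pi - u) = kernel u"
  by (simp add: kernel_def chord_reflect)

lemma kernel_chord: "u \<in> {0<..<2 * pi} \<Longrightarrow> kernel u * chord u = chord u powr (1 - \<alpha>)"
  using chord_pos[of u] by (simp add: kernel_def powr_mult_base mult.commute)

lemma kernel_w2: "u \<in> {0<..<2 * pi} \<Longrightarrow> kernel u * (chord u)\<^sup>2 = chord u powr (2 - \<alpha>)"
  using chord_pos[of u] by (simp add: kernel_def powr_mult_base mult.commute power2_eq_square mult.assoc)

lemma kernel_sin: "u \<in> {0<..<2 * pi} \<Longrightarrow> kernel u * sin u = chord u powr (1 - \<alpha>) * cos (u / 2)"
  using sin_double[of "u / 2"] by (simp flip: kernel_chord) (simp add: chord_def)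

lemma integrable_kernel_chord: "integrable circle (\<lambda>u. kernel u * chord u)"
  using integral_chord_powr(1)[of "1 - \<alpha>"] alpha
  by (subst Bochner_Integration.integrable_cong[OF refl, of _ _ "\<lambda>u. chord u powr (1 - \<alpha>)"])
     (auto simp: space_circle kernel_chord)

text \<open>One factor of the chord is enough at the diagonal: kernel times chord is the chord to
  the power 1 - \<alpha>, integrable since 1 - \<alpha> > -1.\<close>

lemma integrable_kernel_bound:
  fixes g :: "real \<Rightarrow> 'a :: {banach, second_countable_topology}"
  assumes "g \<in> borel_measurable circle" "\<And>u. u \<in> {0<..<2 * pi} \<Longrightarrow> norm (g u) \<le> B * chord u"
  shows "integrable circle (\<lambda>u. kernel u *\<^sub>R g u)"
proof (rule Bochner_Integration.integrable_bound)
  show "integrable circle (\<lambda>u. B * (kernel u * chord u))" by (intro integrable_mult_right integrable_kernel_chord)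
  show "AE u in circle. norm (kernel u *\<^sub>R g u) \<le> norm (B * (kernel u * chord u))"
  proof (intro AE_I2)
    fix u assume "u \<in> space circle"
    then have "norm (g u) \<le> B * chord u" using assms(2) by (simp add: space_circle)
    then have "kernel u * norm (g u) \<le> kernel u * (B * chord u)" by (intro mult_left_mono kernel_nonneg)
    also have "\<dots> \<le> \<bar>B * (kernel u * chord u)\<bar>" by (simp add: mult_ac)
    finally show "norm (kernel u *\<^sub>R g u) \<le> norm (B * (kernel u * chord u))" by (simp add: kernel_nonneg)
  qed
  show "(\<lambda>u. kernel u *\<^sub>R g u) \<in> borel_measurable circle"
    by (intro borel_measurable_scaleR assms(1) borel_measurable_circle kernel_measurable)
qed

lemma integrable_kernel_bound_real:
  fixes g :: "real \<Rightarrow> real"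
  assumes "g \<in> borel_measurable borel" "\<And>u. u \<in> {0<..<2 * pi} \<Longrightarrow> \<bar>g u\<bar> \<le> B * chord u"
  shows "integrable circle (\<lambda>u. kernel u * g u)"
  using integrable_kernel_bound[of g B] assms borel_measurable_circle[OF assms(1)] by simp

lemma abs_sin_le_chord: "u \<in> {0<..<2 * pi} \<Longrightarrow> \<bar>sin u\<bar> \<le> 1 * chord u"
  using sin_double[of "u / 2"] chord_pos[of u] mult_left_le[of "\<bar>cos (u / 2)\<bar>" "chord u"]
  by (simp add: chord_def abs_mult)

text \<open>The boundary terms of this integration by parts vanish because \<open>2 - \<alpha> > 0\<close>.\<close>

lemma integral_kernel_by_parts:
  fixes h h' :: "real \<Rightarrow> real"
  assumes h: "\<And>u. (h has_real_derivative h' u) (at u)"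
    and bound: "\<And>u. \<bar>h u\<bar> \<le> B" "\<And>u. \<bar>h' u\<bar> \<le> B'"
    and [measurable]: "h' \<in> borel_measurable borel"
  shows "(LINT u|circle. kernel u * (sin u * h u)) = - (LINT u|circle. kernel u * ((chord u)\<^sup>2 * h' u)) / (2 - \<alpha>)"
proof -
  have B: "0 \<le> B" "0 \<le> B'" using bound[of 0] by linarith+
  have hc: "continuous_on S h" for S
    by (rule DERIV_continuous_on) (use h in \<open>auto intro: has_field_derivative_at_within\<close>)
  have [measurable]: "h \<in> borel_measurable borel" by (intro borel_measurable_continuous_onI hc)
  have i1: "integrable circle (\<lambda>u. kernel u * (sin u * h u))"
  proof (rule integrable_kernel_bound_real[of _ B])
    fix u assume "u \<in> {0<..<2 * pi}"
    then have "\<bar>sin u\<bar> * \<bar>h u\<bar> \<le> (1 * chord u) * B" using chord_pos[of u] B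
      by (intro mult_mono abs_sin_le_chord bound) auto
    then show "\<bar>sin u * h u\<bar> \<le> B * chord u" by (simp add: abs_mult mult.commute)
  qed measurable
  have i2: "integrable circle (\<lambda>u. kernel u * ((chord u)\<^sup>2 * h' u))"
  proof (rule integrable_kernel_bound_real[of _ "2 * B'"])
    fix u assume "u \<in> {0<..<2 * pi}"
    then have chord: "0 < chord u" by (rule chord_pos)
    have "(chord u * chord u) * \<bar>h' u\<bar> \<le> (2 * chord u) * B'"
      using chord_le_2[of u] chord B by (intro mult_mono bound) auto
    then show "\<bar>(chord u)\<^sup>2 * h' u\<bar> \<le> 2 * B' * chord u" by (simp add: abs_mult power2_eq_square mult_ac)
  qed measurable
  \<comment> \<open>This is the derivative of \<open>chord u powr (2 - \<alpha>) * h u\<close>,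
    because kernel times sin u equals
    \<open>chord u powr (1 - \<alpha>) * cos (u / 2)\<close>.\<close>
  define F' where "F' u = (2 - \<alpha>) * (kernel u * (sin u * h u)) + kernel u * ((chord u)\<^sup>2 * h' u)" for u
  have "(F' has_integral (chord (2 * pi) powr (2 - \<alpha>) * h (2 * pi) - chord 0 powr (2 - \<alpha>) * h 0)) {0..2 * pi}"
  proof (rule fundamental_theorem_of_calculus_interior)
    show "continuous_on {0..2 * pi} (\<lambda>u. chord u powr (2 - \<alpha>) * h u)"
      unfolding chord_def using alpha
      by (intro continuous_intros hc continuous_on_powr') (auto intro!: sin_ge_zero continuous_intros)
    fix u assume u: "u \<in> {0<..<2 * pi}"
    have "((\<lambda>u. chord u powr (2 - \<alpha>)) has_real_derivative (2 - \<alpha>) * chord u powr (1 - \<alpha>) * cos (u / 2)) (at u)"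
    proof -
      have "(chord has_real_derivative cos (u / 2)) (at u)"
        unfolding chord_def by (auto intro!: derivative_eq_intros)
      from DERIV_fun_powr[OF this chord_pos[OF u], of "2 - \<alpha>"] show ?thesis by simp
    qed
    then have "((\<lambda>u. chord u powr (2 - \<alpha>) * h u) has_real_derivative
       (2 - \<alpha>) * chord u powr (1 - \<alpha>) * cos (u / 2) * h u + h' u * chord u powr (2 - \<alpha>)) (at u)"
      by (rule DERIV_mult[OF _ h])
    also have "(2 - \<alpha>) * chord u powr (1 - \<alpha>) * cos (u / 2) * h u + h' u * chord u powr (2 - \<alpha>) = F' u"
    proof -
      have "kernel u * (sin u * h u) = chord u powr (1 - \<alpha>) * cos (u / 2) * h u"
        using kernel_sin[OF u] by (simp flip: mult.assoc)
      moreover have "kernel u * ((chord u)\<^sup>2 * h' u) = h' u * chord u powr (2 - \<alpha>)"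
        using kernel_w2[OF u] by (simp add: mult.commute flip: mult.assoc)
      ultimately show ?thesis unfolding F'_def by (simp only: mult.assoc)
    qed
    finally show "((\<lambda>u. chord u powr (2 - \<alpha>) * h u) has_vector_derivative F' u) (at u)"
      by (simp add: has_real_derivative_iff_has_vector_derivative)
  qed simp
  then have "(F' has_integral 0) {0..2 * pi}" by (simp add: chord_def)
  moreover have "integrable circle F'" unfolding F'_def using i1 i2 by simp
  ultimately have "integral\<^sup>L circle F' = 0" by (intro integral_circle_eq_has_integral)
  then have "(2 - \<alpha>) * (LINT u|circle. kernel u * (sin u * h u)) + (LINT u|circle. kernel u * ((chord u)\<^sup>2 * h' u)) = 0"
    unfolding F'_def using i1 i2 by simp
  then show ?thesis using alpha by (simp add: field_simps)
qed


text \<open>Below 1 / n the phase n v is at most 1 and a linear bound for its increment is the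
  better one; above 1 / n the trivial bound 2 is used. The first piece converges since \<alpha> < 2,
  the second is governed by its lower end since \<alpha> > 1, and each gives one summand of the
  constant.\<close>

lemma shift_majorant:
  assumes n: "1 \<le> (n :: real)"
  defines "H \<equiv> \<lambda>v. if v \<le> 1 / n then n * v powr (1 - \<alpha>) else 2 * v powr (- \<alpha>)"
  shows "integrable circle H" "integral\<^sup>L circle H \<le> (1 / (2 - \<alpha>) + 2 / (\<alpha> - 1)) * n powr (\<alpha> - 1)"
proof -
  have n1: "0 < 1 / n" "1 / n \<le> 2 * pi" 
    using n pi_gt3 by (auto simp: divide_le_eq intro: order_trans[of 1 "2 * pi * 1"])
  have "((\<lambda>v. n * v powr (1 - \<alpha>)) has_integral n * ((1 / n) powr (1 - \<alpha> + 1) / (1 - \<alpha> + 1))) {0..1 / n}"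
    using alpha n by (intro has_integral_mult_right has_integral_powr_from_0) auto
  then have 1: "(H has_integral n * ((1 / n) powr (1 - \<alpha> + 1) / (1 - \<alpha> + 1))) {0..1 / n}"
    by (rule has_integral_eq[rotated]) (auto simp: H_def)
  have "((\<lambda>v. 2 * v powr (- \<alpha>)) has_integral
      2 * (2 * pi) powr (1 - \<alpha>) / (1 - \<alpha>) - 2 * (1 / n) powr (1 - \<alpha>) / (1 - \<alpha>)) {1 / n..2 * pi}"
  proof (rule fundamental_theorem_of_calculus)
    fix v assume "v \<in> {1 / n..2 * pi}"
    then have v: "v > 0" using n1(1) unfolding atLeastAtMost_iff by linarith
    have "((\<lambda>v. 2 * v powr (1 - \<alpha>) / (1 - \<alpha>)) has_real_derivative 2 * v powr (- \<alpha>)) (at v)"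
      using has_real_derivative_powr[OF v, of "1 - \<alpha>", THEN DERIV_cmult, of "2 / (1 - \<alpha>)"] alpha
      by simp
    then show "((\<lambda>v. 2 * v powr (1 - \<alpha>) / (1 - \<alpha>)) has_vector_derivative 2 * v powr (- \<alpha>)) (at v within {1 / n..2 * pi})"
      by (simp add: has_real_derivative_iff_has_vector_derivative has_vector_derivative_at_within)
  qed (use n1 in simp)
  then have 2: "(H has_integral 2 * (2 * pi) powr (1 - \<alpha>) / (1 - \<alpha>) - 2 * (1 / n) powr (1 - \<alpha>) / (1 - \<alpha>)) {1 / n..2 * pi}"
    by (rule has_integral_spike_finite[of "{1 / n}", rotated 2]) (auto simp: H_def)
  have H: "(H has_integral n * ((1 / n) powr (1 - \<alpha> + 1) / (1 - \<alpha> + 1))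
      + (2 * (2 * pi) powr (1 - \<alpha>) / (1 - \<alpha>) - 2 * (1 / n) powr (1 - \<alpha>) / (1 - \<alpha>))) {0..2 * pi}"
    by (rule has_integral_combine[OF _ _ 1 2]) (use n1 in auto)
  have meas: "H \<in> borel_measurable borel" unfolding H_def by measurable
  have pos: "0 \<le> H v" for v using n by (simp add: H_def)
  show "integrable circle H" by (rule nonneg_has_integral_circle(1)[OF meas pos H])
  have "integral\<^sup>L circle H = n * ((1 / n) powr (1 - \<alpha> + 1) / (1 - \<alpha> + 1))
      + (2 * (2 * pi) powr (1 - \<alpha>) / (1 - \<alpha>) - 2 * (1 / n) powr (1 - \<alpha>) / (1 - \<alpha>))"
    by (rule nonneg_has_integral_circle(2)[OF meas pos H])
  also have "n * ((1 / n) powr (1 - \<alpha> + 1) / (1 - \<alpha> + 1)) = n powr (\<alpha> - 1) / (2 - \<alpha>)"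
  proof -
    have "n * (1 / n) powr (2 - \<alpha>) = n powr (\<alpha> - 1)"
      using n by (simp add: powr_divide powr_diff powr_numeral power2_eq_square field_simps)
    then show ?thesis by simp
  qed
  also have "2 * (2 * pi) powr (1 - \<alpha>) / (1 - \<alpha>) - 2 * (1 / n) powr (1 - \<alpha>) / (1 - \<alpha>)
      \<le> 2 / (\<alpha> - 1) * n powr (\<alpha> - 1)"
  proof -
    have "(1 / n) powr (1 - \<alpha>) = n powr (\<alpha> - 1)"
      using n by (simp add: powr_divide powr_diff field_simps)
    moreover have "2 * (2 * pi) powr (1 - \<alpha>) / (1 - \<alpha>) \<le> 0"
      using alpha by (intro divide_nonneg_neg) auto
    moreover have "2 * n powr (\<alpha> - 1) / (1 - \<alpha>) = - (2 / (\<alpha> - 1) * n powr (\<alpha> - 1))"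
      using alpha by (simp add: field_simps)
    ultimately show ?thesis by simp
  qed
  finally show "integral\<^sup>L circle H \<le> (1 / (2 - \<alpha>) + 2 / (\<alpha> - 1)) * n powr (\<alpha> - 1)"
    by (simp add: algebra_simps)
qed

text \<open>The factor 8 is 4 times 2: 4 bounds \<open>2 powr \<alpha>\<close>, from comparing the
  chord with u / 2, and 2 counts the two ends of the circle.\<close>

definition shift_const :: real where "shift_const = 8 * (1 / (2 - \<alpha>) + 2 / (\<alpha> - 1))"

text \<open>This is the source of the order \<alpha>: the increment of mode n costs \<alpha> - 1
  powers of |n| after integration, and the derivative R' adds one more.\<close>

lemma
  shows integrable_shift: "integrable circle (\<lambda>u. kernel u * cmod (cis (- of_int n * u) - 1))"
    and integral_shift_le:
      "n \<noteq> 0 \<Longrightarrow> (LINT u|circle. kernel u * cmod (cis (- of_int n * u) - 1)) \<le> shift_const * \<bar>of_int n\<bar> powr (\<alpha> - 1)"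
proof -
  have c [measurable]: "cis \<in> borel_measurable borel"
    by (intro borel_measurable_continuous_onI continuous_intros)
  have "(\<lambda>u. cmod (cis (- of_int n * u) - 1)) \<in> borel_measurable borel" by measurable
  then show int: "integrable circle (\<lambda>u. kernel u * cmod (cis (- of_int n * u) - 1))"
    by (rule integrable_kernel_bound_real[of _ "\<bar>of_int n\<bar>"])
       (use norm_cis_multiple_le[of n] chord_pos in \<open>simp add: abs_of_pos\<close>, metis abs_of_pos)
  assume "n \<noteq> 0"
  define N where "N = \<bar>real_of_int n\<bar>"
  have N: "1 \<le> N" using \<open>n \<noteq> 0\<close> by (simp add: N_def)
  define H where "H v = (if v \<le> 1 / N then N * v powr (1 - \<alpha>) else 2 * v powr (- \<alpha>))" for v
  note H = shift_majorant[OF N, folded H_def]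
  have key: "kernel u * cmod (cis (- of_int n * u) - 1) \<le> 4 * H u" if u: "0 < u" "u \<le> pi" for u
  proof -
    have "kernel u \<le> (u / 2) powr (- \<alpha>)"
      unfolding kernel_def using alpha u chord_ge[of u] by (intro powr_mono2') auto
    also have "\<dots> = 2 powr \<alpha> * u powr (- \<alpha>)"
      using u by (simp add: powr_divide powr_minus field_simps)
    also have "\<dots> \<le> 4 * u powr (- \<alpha>)"
      using powr_mono[of \<alpha> 2 "2 :: real"] alpha by (intro mult_right_mono) auto
    finally have k: "kernel u \<le> 4 * u powr (- \<alpha>)" .
    have "\<bar>chord u\<bar> \<le> u" using abs_sin_x_le_abs_x[of "u / 2"] u by (simp add: chord_def abs_mult)
    then have c1: "cmod (cis (- of_int n * u) - 1) \<le> N * u"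
      using norm_cis_multiple_le[of n u] mult_left_mono[of "\<bar>chord u\<bar>" u N] by (simp add: N_def)
    have c2: "cmod (cis (- of_int n * u) - 1) \<le> 2"
      using norm_triangle_ineq4[of "cis (- of_int n * u)" 1] by simp
    show ?thesis
    proof (cases "u \<le> 1 / N")
      case True
      have "kernel u * cmod (cis (- of_int n * u) - 1) \<le> (4 * u powr (- \<alpha>)) * (N * u)"
        by (intro mult_mono k c1) auto
      also have "\<dots> = 4 * (N * (u * u powr (- \<alpha>)))" by simp
      also have "u * u powr (- \<alpha>) = u powr (1 - \<alpha>)" using u by (simp add: powr_mult_base)
      finally show ?thesis using True by (simp add: H_def)
    next
      case False
      have "kernel u * cmod (cis (- of_int n * u) - 1) \<le> (4 * u powr (- \<alpha>)) * 2"
        by (intro mult_mono k c2) auto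
      then show ?thesis using False by (simp add: H_def)
    qed
  qed
  have H0: "0 \<le> H u" for u using N by (simp add: H_def)
  \<comment> \<open>The far end of the circle reduces to the near one: u -> 2 pi - u preserves the
    kernel and conjugates the exponential, n being an integer.\<close>
  have le: "kernel u * cmod (cis (- of_int n * u) - 1) \<le> 4 * (H u + H (2 * pi - u))" if "u \<in> space circle" for u
  proof (cases "u \<le> pi")
    case True
    then show ?thesis using key[of u] H0[of "2 * pi - u"] that by (auto simp: space_circle)
  next
    case False
    have "cmod (cis (- of_int n * (2 * pi - u)) - 1) = cmod (cis (- of_int n * u) - 1)"
    proof -
      have "cis (- of_int n * (2 * pi - u)) = cis (of_int n * u) * cis (2 * pi * of_int (- n))"
        by (simp add: cis_mult algebra_simps)
      also have "cis (2 * pi * of_int (- n)) = 1" by (rule cis_multiple_2pi) auto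
      finally have "cis (- of_int n * (2 * pi - u)) = cnj (cis (- of_int n * u))" by (simp add: cis_cnj)
      then have "cmod (cis (- of_int n * (2 * pi - u)) - 1) = cmod (cnj (cis (- of_int n * u) - 1))" by simp
      then show ?thesis by (simp only: complex_mod_cnj)
    qed
    then show ?thesis using key[of "2 * pi - u"] H0[of u] that False by (auto simp: space_circle kernel_reflect)
  qed
  have "(LINT u|circle. kernel u * cmod (cis (- of_int n * u) - 1)) \<le> (LINT u|circle. 4 * (H u + H (2 * pi - u)))"
    by (intro integral_mono int le integrable_mult_right Bochner_Integration.integrable_add H integrable_circle_reflect)
  also have "\<dots> = 8 * integral\<^sup>L circle H"
    using H(1) integrable_circle_reflect[OF H(1)] integral_circle_reflect[of H] by simp
  also have "\<dots> \<le> shift_const * \<bar>of_int n\<bar> powr (\<alpha> - 1)"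
    using mult_left_mono[OF H(2), of 8] unfolding shift_const_def N_def by (simp only: mult.assoc)
  finally show "(LINT u|circle. kernel u * cmod (cis (- of_int n * u) - 1)) \<le> shift_const * \<bar>of_int n\<bar> powr (\<alpha> - 1)" .
qed

end

section \<open>The dispersion relation\<close>

lemma cis_int_reflect: "cis (of_int n * (2 * pi - u)) = cis (- of_int n * u)"
proof -
  have "cis (of_int n * (2 * pi - u)) = cis (- of_int n * u) * cis (2 * pi * of_int n)"
    by (simp add: cis_mult algebra_simps)
  also have "cis (2 * pi * of_int n) = 1" by (rule cis_multiple_2pi) auto
  finally show ?thesis by simp
qed

lemma cos_int_reflect: "cos (of_int n * (2 * pi - u)) = cos (of_int n * u)"
  and sin_int_reflect: "sin (of_int n * (2 * pi - u)) = - sin (of_int n * u)"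
  using cis_int_reflect[of n u] by (auto simp: complex_eq_iff)

lemma cos_2pi_minus: "cos (2 * pi - u) = cos u" and sin_2pi_minus: "sin (2 * pi - u) = - sin u"
  using cos_int_reflect[of 1 u] sin_int_reflect[of 1 u] by simp_all

lemma Bernoulli_powr: "(1 + x) powr p \<le> 1 + p * x" if "0 \<le> x" "0 \<le> p" "p \<le> (1 :: real)"
proof -
  have "(\<lambda>x. 1 + p * x - (1 + x) powr p) 0 \<le> (\<lambda>x. 1 + p * x - (1 + x) powr p) x"
  proof (rule DERIV_nonneg_imp_nondecreasing[OF \<open>0 \<le> x\<close>])
    fix t assume t: "0 \<le> t" "t \<le> x"
    have "((\<lambda>x. 1 + p * x - (1 + x) powr p) has_real_derivative p - p * (1 + t) powr (p - 1)) (at t)"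
      using t by (auto intro!: derivative_eq_intros)
    moreover have "(1 + t) powr (p - 1) \<le> 1"
      using t that powr_mono[of "p - 1" 0 "1 + t"] by simp
    then have "p * (1 + t) powr (p - 1) \<le> p * 1" using that by (intro mult_left_mono)
    ultimately show "\<exists>y. ((\<lambda>x. 1 + p * x - (1 + x) powr p) has_real_derivative y) (at t) \<and> 0 \<le> y"
      by (intro exI[of _ "p - p * (1 + t) powr (p - 1)"]) auto
  qed
  then show ?thesis by simp
qed

lemma Gamma_duplication_real:
  assumes "x > (0 :: real)"
  shows "Gamma x * Gamma (x + 1 / 2) = 2 powr (1 - 2 * x) * sqrt pi * Gamma (2 * x)"
proof -
  have n: "complex_of_real x \<notin> \<int>\<^sub>\<le>\<^sub>0" "complex_of_real x + 1 / 2 \<notin> \<int>\<^sub>\<le>\<^sub>0"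
    using assms by (auto elim!: nonpos_Ints_cases simp: complex_eq_iff)
  have "complex_of_real (Gamma x * Gamma (x + 1 / 2))
      = Gamma (complex_of_real x) * Gamma (complex_of_real x + 1 / 2)"
    using Gamma_complex_of_real[of "x + 1 / 2"] by (simp add: Gamma_complex_of_real)
  also have "\<dots> = exp ((1 - 2 * complex_of_real x) * of_real (ln 2)) * of_real (sqrt pi) * Gamma (2 * complex_of_real x)"
    by (rule Gamma_legendre_duplication[OF n])
  also have "\<dots> = complex_of_real (exp ((1 - 2 * x) * ln 2) * sqrt pi * Gamma (2 * x))"
  proof -
    have "complex_of_real (exp ((1 - 2 * x) * ln 2)) = exp ((1 - 2 * complex_of_real x) * of_real (ln 2))"
      by (simp flip: exp_of_real)
    then show ?thesis using Gamma_complex_of_real[of "2 * x"] by simp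
  qed
  finally show ?thesis by (simp only: of_real_eq_iff) (simp add: powr_def)
qed

section \<open>The eigenvalues as integrals over the circle\<close>

context gsqg
begin

text \<open>Up to the factor \<open>C_gsqg \<alpha>\<close>, the angular velocity for which mode n
  lies in the kernel of the linearisation at the disk. It vanishes at n = 1, the mode of
  infinitesimal translations.\<close>

definition velocity_integral :: "int \<Rightarrow> real" where "velocity_integral n = (LINT u|circle. kernel u * (cos (of_int n * u) - cos u))"

text \<open>\<open>linear_symbol n u\<close> is the symbol at the mode \<open>n\<close> of the integrand linearised at the disk, without its
  kernel.\<close>

definition linear_symbol :: "int \<Rightarrow> real \<Rightarrow> complex" where
  "linear_symbol n u = of_real (sin u * (1 - \<alpha> / 2)) * (1 + cis (- of_int n * u))
     + of_real (cos u) * (\<i> * of_int n * (cis (- of_int n * u) - 1))"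

lemma cis_measurable [measurable]: "cis \<in> borel_measurable borel"
  by (intro borel_measurable_continuous_onI continuous_intros)

lemma linear_symbol_bound:
  assumes "u \<in> {0<..<2 * pi}"
  shows "cmod (linear_symbol n u) \<le> (2 + (of_int n)\<^sup>2) * chord u"
proof -
  have s: "\<bar>sin u\<bar> \<le> chord u" using abs_sin_le_chord[OF assms] by simp
  have a: "\<bar>1 - \<alpha> / 2\<bar> \<le> 1" using alpha by simp
  have "cmod (of_real (sin u * (1 - \<alpha> / 2)) * (1 + cis (- of_int n * u))) \<le> (chord u * 1) * 2"
    unfolding norm_mult norm_of_real abs_mult
    using s a norm_triangle_ineq[of 1 "cis (- of_int n * u)"] by (intro mult_mono) auto
  moreover have "cmod (of_real (cos u) * (\<i> * of_int n * (cis (- of_int n * u) - 1)))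
      \<le> 1 * (\<bar>of_int n\<bar> * (\<bar>of_int n\<bar> * \<bar>chord u\<bar>))"
    unfolding norm_mult[of "of_real (cos u)"] norm_of_real
    using norm_cis_multiple_le[of n u]
    by (intro mult_mono) (auto simp: norm_mult intro: mult_left_mono)
  ultimately show ?thesis
    unfolding linear_symbol_def using chord_pos[OF assms]
    by (intro order_trans[OF norm_triangle_ineq]) (simp add: algebra_simps power2_eq_square)
qed

lemma integrable_linear_symbol: "integrable circle (\<lambda>u. kernel u *\<^sub>R linear_symbol n u)"
proof (rule integrable_kernel_bound[OF _ linear_symbol_bound])
  show "linear_symbol n \<in> borel_measurable circle"
    unfolding linear_symbol_def by (intro borel_measurable_circle) measurable
qed

lemma one_minus_cos_bound:
  assumes u: "u \<in> {0<..<2 * pi}"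
  shows "\<bar>1 - cos (of_int n * u)\<bar> \<le> \<bar>of_int n\<bar> * chord u"
  using norm_cis_multiple_le[of n u] chord_pos[OF u] abs_Re_le_cmod[of "cis (- of_int n * u) - 1"] by simp

lemma Re_linear_symbol: "Re (linear_symbol n u) = sin u * (1 - \<alpha> / 2) * (1 + cos (of_int n * u)) + cos u * (of_int n * sin (of_int n * u))"
  and Im_linear_symbol: "Im (linear_symbol n u) = - (1 - \<alpha> / 2) * (sin u * sin (of_int n * u)) + of_int n * (cos u * (cos (of_int n * u) - 1))"
  by (simp_all add: linear_symbol_def algebra_simps)

text \<open>The real part is odd under u -> 2 pi - u. In the imaginary part, integration by parts
  turns the product of sines into n (1 - cos u) cos (n u), its denominator 2 - \<alpha> cancelling
  the factor 1 - \<alpha> / 2; added to n cos u (cos (n u) - 1) this leaves n (cos (n u) - cos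
  u).\<close>

lemma integral_linear_symbol: "(LINT u|circle. kernel u *\<^sub>R linear_symbol n u) = \<i> * of_int n * of_real (velocity_integral n)"
proof (rule complex_eqI)
  have "Re (LINT u|circle. kernel u *\<^sub>R linear_symbol n u) = (LINT u|circle. Re (kernel u *\<^sub>R linear_symbol n u))"
    by (rule integral_Re[OF integrable_linear_symbol, symmetric])
  also have "\<dots> = 0"
  proof (rule integral_circle_odd)
    fix u
    show "Re (kernel (2 * pi - u) *\<^sub>R linear_symbol n (2 * pi - u)) = - Re (kernel u *\<^sub>R linear_symbol n u)"
      unfolding scaleR_complex.sel Re_linear_symbol kernel_reflect cos_2pi_minus sin_2pi_minus cos_int_reflect sin_int_reflect
      by (simp add: algebra_simps)
  qed
  finally show "Re (LINT u|circle. kernel u *\<^sub>R linear_symbol n u) = Re (\<i> * of_int n * of_real (velocity_integral n))" by simp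
next
  have i1: "integrable circle (\<lambda>u. kernel u * (sin u * sin (of_int n * u)))"
  proof (rule integrable_kernel_bound_real[of _ 1])
    fix u assume u: "u \<in> {0<..<2 * pi}"
    have "\<bar>sin u\<bar> * \<bar>sin (of_int n * u)\<bar> \<le> (1 * chord u) * 1"
      using chord_pos[OF u] by (intro mult_mono abs_sin_le_chord u) auto
    then show "\<bar>sin u * sin (of_int n * u)\<bar> \<le> 1 * chord u" by (simp add: abs_mult)
  qed measurable
  have i2: "integrable circle (\<lambda>u. kernel u * (cos u * (cos (of_int n * u) - 1)))"
  proof (rule integrable_kernel_bound_real[of _ "\<bar>of_int n\<bar>"])
    fix u assume u: "u \<in> {0<..<2 * pi}"
    have "\<bar>cos u\<bar> * \<bar>1 - cos (of_int n * u)\<bar> \<le> 1 * (\<bar>of_int n\<bar> * chord u)"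
      by (intro mult_mono one_minus_cos_bound u) auto
    then show "\<bar>cos u * (cos (of_int n * u) - 1)\<bar> \<le> \<bar>of_int n\<bar> * chord u"
      by (simp add: abs_mult abs_minus_commute)
  qed measurable
  have i3: "integrable circle (\<lambda>u. kernel u * ((1 - cos u) * cos (of_int n * u)))"
  proof (rule integrable_kernel_bound_real[of _ 1])
    fix u assume u: "u \<in> {0<..<2 * pi}"
    have "\<bar>1 - cos u\<bar> * \<bar>cos (of_int n * u)\<bar> \<le> (\<bar>of_int 1\<bar> * chord u) * 1"
      using one_minus_cos_bound[OF u, of 1] chord_pos[OF u] by (intro mult_mono) auto
    then show "\<bar>(1 - cos u) * cos (of_int n * u)\<bar> \<le> 1 * chord u" by (simp add: abs_mult)
  qed measurable
  have parts: "(LINT u|circle. kernel u * (sin u * sin (of_int n * u)))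
      = - (LINT u|circle. kernel u * ((chord u)\<^sup>2 * (of_int n * cos (of_int n * u)))) / (2 - \<alpha>)"
    by (rule integral_kernel_by_parts[of _ _ 1 "\<bar>of_int n\<bar>"])
       (auto intro!: derivative_eq_intros simp: abs_mult mult_left_le)
  have "(LINT u|circle. kernel u * ((chord u)\<^sup>2 * (of_int n * cos (of_int n * u))))
      = (LINT u|circle. 2 * of_int n * (kernel u * ((1 - cos u) * cos (of_int n * u))))"
    by (intro Bochner_Integration.integral_cong refl) (simp add: chord_square algebra_simps)
  also have "\<dots> = 2 * of_int n * (LINT u|circle. kernel u * ((1 - cos u) * cos (of_int n * u)))"
    by (rule integral_mult_right_zero)
  finally have q: "(LINT u|circle. kernel u * ((chord u)\<^sup>2 * (of_int n * cos (of_int n * u))))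
      = 2 * of_int n * (LINT u|circle. kernel u * ((1 - cos u) * cos (of_int n * u)))" .
  have half: "(1 - \<alpha> / 2) * X = - Y" if "X = - (2 * Y) / (2 - \<alpha>)" for X Y :: real
    using that alpha by (simp add: field_simps)
  have p: "(1 - \<alpha> / 2) * (LINT u|circle. kernel u * (sin u * sin (of_int n * u)))
      = - (of_int n * (LINT u|circle. kernel u * ((1 - cos u) * cos (of_int n * u))))"
    by (rule half) (use parts[unfolded q] in \<open>simp only: mult.assoc\<close>)
  have "Im (LINT u|circle. kernel u *\<^sub>R linear_symbol n u) = (LINT u|circle. Im (kernel u *\<^sub>R linear_symbol n u))"
    by (rule integral_Im[OF integrable_linear_symbol, symmetric])
  also have "(\<lambda>u. Im (kernel u *\<^sub>R linear_symbol n u)) = (\<lambda>u. - (1 - \<alpha> / 2) * (kernel u * (sin u * sin (of_int n * u)))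
       + of_int n * (kernel u * (cos u * (cos (of_int n * u) - 1))))"
    unfolding scaleR_complex.sel Im_linear_symbol by (simp add: fun_eq_iff algebra_simps)
  also have "(LINT u|circle. - (1 - \<alpha> / 2) * (kernel u * (sin u * sin (of_int n * u)))
       + of_int n * (kernel u * (cos u * (cos (of_int n * u) - 1))))
     = - ((1 - \<alpha> / 2) * (LINT u|circle. kernel u * (sin u * sin (of_int n * u))))
       + of_int n * (LINT u|circle. kernel u * (cos u * (cos (of_int n * u) - 1)))"
    using i1 i2 by simp (simp only: minus_mult_left minus_diff_eq)
  also have "\<dots> = of_int n * ((LINT u|circle. kernel u * ((1 - cos u) * cos (of_int n * u)))
      + (LINT u|circle. kernel u * (cos u * (cos (of_int n * u) - 1))))"
    unfolding p by (simp add: algebra_simps)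
  also have "(LINT u|circle. kernel u * ((1 - cos u) * cos (of_int n * u)))
      + (LINT u|circle. kernel u * (cos u * (cos (of_int n * u) - 1)))
      = (LINT u|circle. kernel u * ((1 - cos u) * cos (of_int n * u)) + kernel u * (cos u * (cos (of_int n * u) - 1)))"
    using i2 i3 by simp
  also have "\<dots> = velocity_integral n" unfolding velocity_integral_def by (intro Bochner_Integration.integral_cong refl) (simp add: algebra_simps)
  finally show "Im (LINT u|circle. kernel u *\<^sub>R linear_symbol n u) = Im (\<i> * of_int n * of_real (velocity_integral n))" by simp
qed

section \<open>Recurrence for the differences of the eigenvalues\<close>

definition sine_moment :: "nat \<Rightarrow> real" where
  "sine_moment j = (LINT u|circle. kernel u * (chord u * sin ((real j + 1 / 2) * u)))"

lemma integrable_sine_moment: "integrable circle (\<lambda>u. kernel u * (chord u * sin (r * u)))"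
proof (rule integrable_kernel_bound_real[of _ 1])
  fix u assume u: "u \<in> {0<..<2 * pi}"
  show "\<bar>chord u * sin (r * u)\<bar> \<le> 1 * chord u"
    using chord_pos[OF u] by (simp add: abs_mult mult_left_le)
qed measurable

lemma integrable_velocity_integral: "integrable circle (\<lambda>u. kernel u * (cos (of_int n * u) - cos u))"
proof (rule integrable_kernel_bound_real[of _ "\<bar>of_int n\<bar> + 1"])
  fix u assume u: "u \<in> {0<..<2 * pi}"
  show "\<bar>cos (of_int n * u) - cos u\<bar> \<le> (\<bar>of_int n\<bar> + 1) * chord u"
  proof -
    have "\<bar>1 - cos (of_int n * u)\<bar> \<le> \<bar>of_int n\<bar> * chord u" "\<bar>1 - cos u\<bar> \<le> chord u"
      using one_minus_cos_bound[OF u, of n] one_minus_cos_bound[OF u, of 1] by simp_all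
    then show ?thesis unfolding distrib_right by linarith
  qed
qed measurable

text \<open>The difference of two consecutive cosines is a chord times a sine at the half-integer
  frequency between them. These moments obey a two-term recurrence, so the eigenvalues follow by
  summation.\<close>

lemma velocity_integral_Suc: "velocity_integral (int (Suc j)) = velocity_integral (int j) - sine_moment j"
proof -
  have "velocity_integral (int (Suc j)) - velocity_integral (int j)
      = (LINT u|circle. kernel u * (cos (of_int (int (Suc j)) * u) - cos u) - kernel u * (cos (of_int (int j) * u) - cos u))"
    unfolding velocity_integral_def by (rule Bochner_Integration.integral_diff[symmetric]) (rule integrable_velocity_integral)+
  also have "\<dots> = (LINT u|circle. - (kernel u * (chord u * sin ((real j + 1 / 2) * u))))"
  proof (intro Bochner_Integration.integral_cong refl)
    fix u
    have "cos (real (Suc j) * u) - cos (real j * u) = - (chord u * sin ((real j + 1 / 2) * u))"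
      using cos_add[of "(real j + 1 / 2) * u" "u / 2"] cos_diff[of "(real j + 1 / 2) * u" "u / 2"]
      by (simp add: chord_def algebra_simps)
    then show "kernel u * (cos (of_int (int (Suc j)) * u) - cos u) - kernel u * (cos (of_int (int j) * u) - cos u)
       = - (kernel u * (chord u * sin ((real j + 1 / 2) * u)))"
      unfolding right_diff_distrib [symmetric] by simp
  qed
  also have "\<dots> = - sine_moment j" by (simp add: sine_moment_def)
  finally show ?thesis by simp
qed

text \<open>Integration by parts against sin (n u) with n = j + 1. By the addition formulas sin u
  sin (n u) is half the sum of the two neighbouring moment integrands, and the squared chord times
  cos (n u) is their difference.\<close>

lemma sine_moment_Suc: "sine_moment (Suc j) * (real j + 2 - \<alpha> / 2) = sine_moment j * (real j + \<alpha> / 2)"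
proof -
  let ?n = "real (Suc j)"
  have parts: "(LINT u|circle. kernel u * (sin u * sin (?n * u)))
      = - (LINT u|circle. kernel u * ((chord u)\<^sup>2 * (?n * cos (?n * u)))) / (2 - \<alpha>)"
    by (rule integral_kernel_by_parts[of _ _ 1 "?n"])
       (auto intro!: derivative_eq_intros simp: abs_mult mult_left_le)
  let ?a = "\<lambda>u. kernel u * (chord u * sin ((real (Suc j) + 1 / 2) * u))"
  let ?b = "\<lambda>u. kernel u * (chord u * sin ((real j + 1 / 2) * u))"
  have tr: "sin ((real (Suc j) + 1 / 2) * u) = sin (?n * u) * cos (u / 2) + cos (?n * u) * sin (u / 2)"
    "sin ((real j + 1 / 2) * u) = sin (?n * u) * cos (u / 2) - cos (?n * u) * sin (u / 2)" for u
    using sin_add[of "?n * u" "u / 2"] sin_diff[of "?n * u" "u / 2"] by (simp_all add: algebra_simps)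
  have "(LINT u|circle. kernel u * (sin u * sin (?n * u))) = (LINT u|circle. 1 / 2 * (?a u + ?b u))"
  proof (intro Bochner_Integration.integral_cong refl)
    fix u
    have "sin u = chord u * cos (u / 2)" using sin_double[of "u / 2"] by (simp add: chord_def)
    then show "kernel u * (sin u * sin (?n * u)) = 1 / 2 * (?a u + ?b u)"
      unfolding tr by (simp add: algebra_simps)
  qed
  also have "\<dots> = (sine_moment (Suc j) + sine_moment j) / 2"
    using integrable_sine_moment unfolding sine_moment_def by simp
  finally have l: "(LINT u|circle. kernel u * (sin u * sin (?n * u))) = (sine_moment (Suc j) + sine_moment j) / 2" .
  have "(LINT u|circle. kernel u * ((chord u)\<^sup>2 * (?n * cos (?n * u)))) = (LINT u|circle. ?n * (?a u - ?b u))"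
    unfolding tr by (intro Bochner_Integration.integral_cong refl) (simp add: chord_def algebra_simps power2_eq_square)
  also have "\<dots> = ?n * (sine_moment (Suc j) - sine_moment j)"
    using integrable_sine_moment unfolding sine_moment_def by simp
  finally have r: "(LINT u|circle. kernel u * ((chord u)\<^sup>2 * (?n * cos (?n * u)))) = ?n * (sine_moment (Suc j) - sine_moment j)" .
  have "(2 - \<alpha>) * ((sine_moment (Suc j) + sine_moment j) / 2) = - (?n * (sine_moment (Suc j) - sine_moment j))"
    using parts alpha unfolding l r by (simp add: field_simps)
  then show ?thesis
    unfolding of_nat_Suc by (simp add: algebra_simps add_divide_distrib diff_divide_distrib)
qed

text \<open>\<open>gamma_quot\<close> is the quotient in the formula for the bifurcation velocity.
  \<open>gamma_ratio\<close> is, up to the factor \<alpha> - 1, its discrete derivative, and it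
  solves the recurrence of \<open>sine_moment\<close>.\<close>

definition gamma_ratio :: "nat \<Rightarrow> real" where "gamma_ratio j = Gamma (real j + \<alpha> / 2) / Gamma (real j + 2 - \<alpha> / 2)"
definition gamma_quot :: "nat \<Rightarrow> real" where "gamma_quot j = Gamma (real j + \<alpha> / 2) / Gamma (1 + real j - \<alpha> / 2)"

lemma Gamma_Suc: "x > 0 \<Longrightarrow> Gamma (x + 1) = x * Gamma (x :: real)"
  by (rule Gamma_plus1) (auto elim!: nonpos_Ints_cases)

lemma gamma_ratio_pos: "gamma_ratio j > 0" and gamma_quot_pos: "gamma_quot j > 0"
  using alpha by (auto simp: gamma_ratio_def gamma_quot_def intro!: divide_pos_pos Gamma_real_pos)

lemma gamma_quot_gamma_ratio: "gamma_quot j = (real j + 1 - \<alpha> / 2) * gamma_ratio j" "gamma_quot (Suc j) = (real j + \<alpha> / 2) * gamma_ratio j"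
  and gamma_ratio_Suc: "gamma_ratio (Suc j) * (real j + 2 - \<alpha> / 2) = gamma_ratio j * (real j + \<alpha> / 2)"
proof -
  have 1: "Gamma (real j + 2 - \<alpha> / 2) = (real j + 1 - \<alpha> / 2) * Gamma (1 + real j - \<alpha> / 2)"
    using Gamma_Suc[of "real j + 1 - \<alpha> / 2"] alpha by (simp add: algebra_simps)
  have 2: "Gamma (real (Suc j) + \<alpha> / 2) = (real j + \<alpha> / 2) * Gamma (real j + \<alpha> / 2)"
    using Gamma_Suc[of "real j + \<alpha> / 2"] alpha by (simp add: algebra_simps)
  have 3: "Gamma (real (Suc j) + 2 - \<alpha> / 2) = (real j + 2 - \<alpha> / 2) * Gamma (real j + 2 - \<alpha> / 2)"
    using Gamma_Suc[of "real j + 2 - \<alpha> / 2"] alpha by (simp add: algebra_simps)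
  have "1 + real (Suc j) - \<alpha> / 2 = real j + 2 - \<alpha> / 2" by simp
  then show "gamma_quot (Suc j) = (real j + \<alpha> / 2) * gamma_ratio j"
    by (simp only: gamma_quot_def gamma_ratio_def 2) simp
  have p: "real j + 1 - \<alpha> / 2 > 0" "real j + 2 - \<alpha> / 2 > 0" using alpha by auto
  show "gamma_quot j = (real j + 1 - \<alpha> / 2) * gamma_ratio j" using p by (simp add: gamma_quot_def gamma_ratio_def 1)
  show "gamma_ratio (Suc j) * (real j + 2 - \<alpha> / 2) = gamma_ratio j * (real j + \<alpha> / 2)" using p unfolding gamma_ratio_def 2 3 by simp
qed

lemma gamma_quot_diff: "gamma_quot (Suc j) - gamma_quot j = (\<alpha> - 1) * gamma_ratio j"
  using gamma_quot_gamma_ratio(1)[of j] gamma_quot_gamma_ratio(2)[of j] by (simp only:) (simp add: algebra_simps)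

definition velocity_const :: real where "velocity_const = 2 powr (\<alpha> - 1) * (Gamma (1 - \<alpha>) / (Gamma (1 - \<alpha> / 2))\<^sup>2)"

text \<open>1 - \<alpha> lies strictly between the poles -1 and 0. The functional equation moves to
  the positive argument 2 - \<alpha>, which reveals the sign of Gamma (1 - \<alpha>).\<close>

lemma Gamma_one_minus_alpha: "(\<alpha> - 1) * Gamma (1 - \<alpha>) = - Gamma (2 - \<alpha>)"
proof -
  have "1 - \<alpha> \<notin> \<int>\<^sub>\<le>\<^sub>0"
  proof
    assume "1 - \<alpha> \<in> \<int>\<^sub>\<le>\<^sub>0"
    then obtain n :: int where "1 - \<alpha> = of_int n" by (auto elim!: nonpos_Ints_cases)
    then have "real_of_int n < 0" "real_of_int n > real_of_int (- 1)" using alpha by auto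
    then have "n < 0" "- 1 < n" by (simp_all only: of_int_less_iff of_int_less_0_iff)
    then show False by linarith
  qed
  from Gamma_plus1[OF this] show ?thesis by (simp add: algebra_simps)
qed

lemma velocity_const_neg: "velocity_const < 0"
proof -
  have "Gamma (2 - \<alpha>) > 0" using alpha by (intro Gamma_real_pos) auto
  with Gamma_one_minus_alpha have "(\<alpha> - 1) * Gamma (1 - \<alpha>) < 0" by simp
  then have "Gamma (1 - \<alpha>) < 0" using alpha by (simp add: mult_less_0_iff)
  moreover have "Gamma (1 - \<alpha> / 2) > 0" using alpha by (intro Gamma_real_pos) auto
  ultimately show ?thesis unfolding velocity_const_def by (intro mult_pos_neg divide_neg_pos) auto
qed

text \<open>At j = 0 the sine is half a chord, so the moment is a Beta integral at a = (3 -
  \<alpha>) / 2. Duplication at 1 - \<alpha> / 2 and at a itself expresses Gamma a through the Gamma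
  values in the claimed constant.\<close>

lemma sine_moment_0: "C_gsqg \<alpha> * sine_moment 0 = - velocity_const * (\<alpha> - 1) * gamma_ratio 0"
proof -
  define a where "a = (3 - \<alpha>) / 2"
  have a: "a > 0" using alpha by (simp add: a_def)
  have "sine_moment 0 = (LINT u|circle. 1 / 2 * chord u powr (2 - \<alpha>))"
    unfolding sine_moment_def
  proof (intro Bochner_Integration.integral_cong refl)
    fix u assume "u \<in> space circle"
    then have "kernel u * (chord u * chord u) = chord u powr (2 - \<alpha>)" using kernel_w2[of u] by (simp add: space_circle power2_eq_square)
    moreover have s: "sin ((real 0 + 1 / 2) * u) = chord u / 2" by (simp add: chord_def)
    ultimately show "kernel u * (chord u * sin ((real 0 + 1 / 2) * u)) = 1 / 2 * chord u powr (2 - \<alpha>)"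
      unfolding s by simp
  qed
  also have "\<dots> = 1 / 2 * (8 * 4 powr (1 - \<alpha>) * Beta a a)"
    using integral_chord_powr(2)[of "2 - \<alpha>"] alpha by (simp add: a_def)
  finally have s: "sine_moment 0 = 4 * 4 powr (1 - \<alpha>) * (Gamma a * Gamma a / Gamma (3 - \<alpha>))"
    by (simp add: Beta_def a_def)
  define G0 G1 G2 G3 G4 where "G0 = Gamma a" and "G1 = Gamma (1 - \<alpha> / 2)" and "G2 = Gamma (2 - \<alpha> / 2)"
    and "G3 = Gamma (2 - \<alpha>)" and "G4 = Gamma (3 - \<alpha>)"
  have pos: "G0 > 0" "G1 > 0" "G2 > 0" "G3 > 0" "G4 > 0"
    using alpha a unfolding G0_def G1_def G2_def G3_def G4_def by (auto intro!: Gamma_real_pos)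
  have d1: "G1 * G0 = 2 powr (\<alpha> - 1) * sqrt pi * G3"
    using Gamma_duplication_real[of "1 - \<alpha> / 2"] alpha
    by (simp add: a_def G0_def G1_def G3_def algebra_simps add_divide_distrib diff_divide_distrib)
  have d2: "G0 * G2 = 2 powr (\<alpha> - 2) * sqrt pi * G4"
    using Gamma_duplication_real[OF a]
    by (simp add: a_def G0_def G2_def G4_def algebra_simps add_divide_distrib diff_divide_distrib)
  define t where "t = 2 powr (\<alpha> - 1)"
  have t: "t > 0" "2 powr (\<alpha> - 2) = t / 2" "4 powr (1 - \<alpha>) = 1 / (t * t)"
  proof -
    have "4 powr (1 - \<alpha>) = 2 powr - (2 * (\<alpha> - 1))"
      using powr_powr[of 2 2 "1 - \<alpha>"] by (simp add: algebra_simps)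
    also have "\<dots> = inverse (2 powr (2 * (\<alpha> - 1)))" by (rule powr_minus)
    also have "2 * (\<alpha> - 1) = (\<alpha> - 1) + (\<alpha> - 1)" by simp
    finally show "4 powr (1 - \<alpha>) = 1 / (t * t)" by (simp only: t_def powr_add inverse_eq_divide)
  qed (simp_all add: t_def powr_diff)
  \<comment> \<open>Multiplying the two duplication formulas produces the square of
    \<open>G0\<close> that the Beta function contains.\<close>
  have "(G1 * G0) * (G0 * G2) = (t * sqrt pi * G3) * (t / 2 * sqrt pi * G4)"
    unfolding d1 d2 t(2) by (simp add: t_def)
  also have "\<dots> = t * t * pi * G3 * G4 / 2" by simp
  finally have "G0 * G0 / G4 = t * t * pi * G3 / (2 * (G1 * G2))"
    using pos by (simp add: field_simps)
  then have s': "sine_moment 0 = 2 * pi * G3 / (G1 * G2)"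
    unfolding s G0_def [symmetric] G4_def [symmetric] t(3) using t(1) by (simp add: field_simps)
  have C: "C_gsqg \<alpha> = 1 / (2 * pi) * (Gamma (\<alpha> / 2) * t / G1)"
  proof -
    have "2 powr (1 - \<alpha>) = inverse t" using powr_minus[of 2 "\<alpha> - 1"] by (simp add: t_def)
    moreover have "(2 - \<alpha>) / 2 = 1 - \<alpha> / 2" by simp
    ultimately show ?thesis unfolding C_gsqg_def G1_def by (simp only: divide_inverse inverse_mult_distrib
        inverse_inverse_eq mult_ac)
  qed
  have "- velocity_const * (\<alpha> - 1) = t * (G3 / G1\<^sup>2)"
  proof -
    have "G3 = - ((\<alpha> - 1) * Gamma (1 - \<alpha>))" using Gamma_one_minus_alpha by (simp add: G3_def)
    then show ?thesis unfolding velocity_const_def t_def [symmetric] G1_def [symmetric] by simp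
  qed
  then show ?thesis
    unfolding C s' gamma_ratio_def by (simp add: G2_def power2_eq_square mult_ac)
qed

lemma sine_moment_eq: "C_gsqg \<alpha> * sine_moment j = - velocity_const * (gamma_quot (Suc j) - gamma_quot j)"
proof -
  have "C_gsqg \<alpha> * sine_moment j = - velocity_const * (\<alpha> - 1) * gamma_ratio j"
  proof (induction j)
    case (Suc j)
    have p: "real j + 2 - \<alpha> / 2 > 0" using alpha by auto
    have "C_gsqg \<alpha> * sine_moment (Suc j) * (real j + 2 - \<alpha> / 2) = (C_gsqg \<alpha> * sine_moment j) * (real j + \<alpha> / 2)"
      using sine_moment_Suc[of j] by simp
    also have "\<dots> = - velocity_const * (\<alpha> - 1) * (gamma_ratio j * (real j + \<alpha> / 2))" unfolding Suc.IH by simp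
    also have "\<dots> = - velocity_const * (\<alpha> - 1) * gamma_ratio (Suc j) * (real j + 2 - \<alpha> / 2)" unfolding gamma_ratio_Suc [symmetric] by simp
    finally show ?case using p by (metis less_irrefl mult_right_cancel)
  qed (rule sine_moment_0)
  then show ?thesis by (simp add: gamma_quot_diff)
qed

definition velocity :: "int \<Rightarrow> real" where "velocity n = C_gsqg \<alpha> * velocity_integral n"

lemma velocity_uminus: "velocity (- n) = velocity n"
  by (simp add: velocity_def velocity_integral_def)

lemma velocity_eq: "n \<ge> 1 \<Longrightarrow> velocity (int n) = velocity_const * (gamma_quot n - gamma_quot 1)"
proof (induction n rule: dec_induct)
  case base
  show ?case by (simp add: velocity_def velocity_integral_def)
next
  case (step n)
  have "velocity (int (Suc n)) = velocity (int n) - C_gsqg \<alpha> * sine_moment n"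
    unfolding velocity_def velocity_integral_Suc by (simp add: algebra_simps)
  then show ?case using step.IH by (simp add: sine_moment_eq algebra_simps)
qed

lemma velocity_bif: "n \<ge> 1 \<Longrightarrow> velocity (int n) = \<Omega>_bif \<alpha> n"
  by (simp add: velocity_eq \<Omega>_bif_def velocity_const_def gamma_quot_def algebra_simps)

section \<open>Monotonicity and growth of the eigenvalues\<close>

lemma gamma_quot_less: "i < j \<Longrightarrow> gamma_quot i < gamma_quot j"
proof (rule lift_Suc_mono_less[of gamma_quot])
  show "gamma_quot n < gamma_quot (Suc n)" for n
    using gamma_quot_diff[of n] mult_pos_pos[of "\<alpha> - 1" "gamma_ratio n"] gamma_ratio_pos[of n] alpha by linarith
qed

text \<open>With N = n + 1 - \<alpha> / 2, the step to n + 1 multiplies \<open>gamma_quot\<close> by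
  1 + (\<alpha> - 1) / N and the power N^(\<alpha> - 1) by (1 + 1 / N)^(\<alpha> - 1), which is no
  larger by Bernoulli. So their quotient is nondecreasing, and its value at 0 is a lower
  bound.\<close>

lemma gamma_quot_growth: "\<exists>c>0. \<forall>n. c * real n powr (\<alpha> - 1) \<le> gamma_quot n"
proof -
  define N where "N n = real n + 1 - \<alpha> / 2" for n
  have N: "N n > 0" for n using alpha by (simp add: N_def)
  have step: "gamma_quot n / N n powr (\<alpha> - 1) \<le> gamma_quot (Suc n) / N (Suc n) powr (\<alpha> - 1)" for n
  proof -
    have "N (Suc n) = N n * (1 + 1 / N n)" using N[of n] by (simp add: N_def field_simps)
    then have "N (Suc n) powr (\<alpha> - 1) = N n powr (\<alpha> - 1) * (1 + 1 / N n) powr (\<alpha> - 1)"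
      using N[of n] by (simp add: powr_mult)
    also have "\<dots> \<le> N n powr (\<alpha> - 1) * (1 + (\<alpha> - 1) * (1 / N n))"
      using N[of n] alpha by (intro mult_left_mono Bernoulli_powr) auto
    finally have "gamma_quot n * N (Suc n) powr (\<alpha> - 1) \<le> gamma_quot n * (N n powr (\<alpha> - 1) * (1 + (\<alpha> - 1) * (1 / N n)))"
      using gamma_quot_pos[of n] by (intro mult_left_mono) auto
    also have "\<dots> = (gamma_quot n * (1 + (\<alpha> - 1) / N n)) * N n powr (\<alpha> - 1)" by simp
    also have "gamma_quot n * (1 + (\<alpha> - 1) / N n) = gamma_quot (Suc n)"
    proof -
      have "gamma_quot n = N n * gamma_ratio n" by (simp only: gamma_quot_gamma_ratio(1) N_def)
      moreover have "gamma_quot (Suc n) = (N n + (\<alpha> - 1)) * gamma_ratio n" unfolding gamma_quot_gamma_ratio(2) N_def by (simp add: algebra_simps)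
      moreover have "N n * gamma_ratio n * (1 + (\<alpha> - 1) / N n) = (N n + (\<alpha> - 1)) * gamma_ratio n"
        using N[of n] by (simp add: field_simps)
      ultimately show ?thesis by (simp only:)
    qed
    finally show ?thesis using N[of n] N[of "Suc n"] by (simp add: field_simps)
  qed
  define c where "c = gamma_quot 0 / N 0 powr (\<alpha> - 1)"
  have c: "c > 0" using gamma_quot_pos[of 0] N[of 0] by (simp add: c_def)
  have le: "c \<le> gamma_quot n / N n powr (\<alpha> - 1)" for n
    unfolding c_def by (rule lift_Suc_mono_le[of "\<lambda>n. gamma_quot n / N n powr (\<alpha> - 1)"]) (use step in auto)
  have "c * real n powr (\<alpha> - 1) \<le> gamma_quot n" for n
  proof -
    have "real n powr (\<alpha> - 1) \<le> N n powr (\<alpha> - 1)"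
      using alpha by (intro powr_mono2) (auto simp: N_def)
    then have "c * real n powr (\<alpha> - 1) \<le> c * N n powr (\<alpha> - 1)" using c by (intro mult_left_mono) auto
    also have "\<dots> \<le> gamma_quot n" using le[of n] N[of n] by (simp add: field_simps)
    finally show ?thesis .
  qed
  with c show ?thesis by blast
qed

text \<open>Strict monotonicity gives both cases. Below m the gap is at least its value at m - 1.
  Above m, the ratio of \<open>gamma_quot m\<close> to \<open>gamma_quot (Suc m)\<close> is below 1,
  so a fixed fraction of the growth of \<open>gamma_quot n\<close> survives the subtraction.\<close>

lemma velocity_gap:
  assumes m: "m \<ge> 1"
  shows "\<exists>c>0. \<forall>n. n \<noteq> 0 \<longrightarrow> \<bar>n\<bar> \<noteq> int m \<longrightarrow> c * \<bar>of_int n\<bar> powr (\<alpha> - 1) \<le> \<bar>velocity n - velocity (int m)\<bar>"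
proof -
  obtain c where c: "c > 0" "\<And>n. c * real n powr (\<alpha> - 1) \<le> gamma_quot n" using gamma_quot_growth by blast
  define c1 where "c1 = c * (1 - gamma_quot m / gamma_quot (Suc m))"
  define c2 where "c2 = (gamma_quot m - gamma_quot (m - 1)) / real m powr (\<alpha> - 1)"
  have c1: "c1 > 0" using c gamma_quot_less[of m "Suc m"] gamma_quot_pos[of "Suc m"] by (simp add: c1_def field_simps)
  have c2: "c2 > 0" using gamma_quot_less[of "m - 1" m] m by (simp add: c2_def)
  have gap: "min c1 c2 * real n powr (\<alpha> - 1) \<le> \<bar>gamma_quot n - gamma_quot m\<bar>" if n: "n \<ge> 1" "n \<noteq> m" for n
  proof (cases "n < m")
    case True
    have "min c1 c2 * real n powr (\<alpha> - 1) \<le> c2 * real m powr (\<alpha> - 1)"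
      using True c2 alpha by (intro mult_mono powr_mono2) auto
    also have "\<dots> = gamma_quot m - gamma_quot (m - 1)" using m by (simp add: c2_def)
    also have "\<dots> \<le> gamma_quot m - gamma_quot n"
    proof -
      have "n = m - 1 \<or> n < m - 1" using True by linarith
      then show ?thesis using gamma_quot_less[of n "m - 1"] by auto
    qed
    finally show ?thesis by linarith
  next
    case False
    then have nm: "n \<ge> Suc m" using n by auto
    have AA: "gamma_quot (Suc m) \<le> gamma_quot n" using gamma_quot_less[of "Suc m" n] nm by (cases "n = Suc m") auto
    have "min c1 c2 * real n powr (\<alpha> - 1) \<le> c1 * real n powr (\<alpha> - 1)"
      by (intro mult_right_mono) auto
    also have "\<dots> = (c * real n powr (\<alpha> - 1)) * (1 - gamma_quot m / gamma_quot (Suc m))" by (simp add: c1_def)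
    also have "\<dots> \<le> gamma_quot n * (1 - gamma_quot m / gamma_quot (Suc m))"
      using c gamma_quot_less[of m "Suc m"] gamma_quot_pos[of "Suc m"] by (intro mult_right_mono) (auto simp: field_simps)
    also have "\<dots> = gamma_quot n - gamma_quot m * (gamma_quot n / gamma_quot (Suc m))" by (simp add: algebra_simps)
    also have "\<dots> \<le> gamma_quot n - gamma_quot m"
      using AA gamma_quot_pos[of m] gamma_quot_pos[of "Suc m"] by (simp add: field_simps)
    finally show ?thesis by linarith
  qed
  have "\<bar>velocity_const\<bar> * min c1 c2 * \<bar>of_int n\<bar> powr (\<alpha> - 1) \<le> \<bar>velocity n - velocity (int m)\<bar>" if n: "n \<noteq> 0" "\<bar>n\<bar> \<noteq> int m" for n
  proof -
    have "velocity n = velocity (int (nat \<bar>n\<bar>))" using velocity_uminus[of n] by (cases "n \<ge> 0") auto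
    also have "\<dots> = velocity_const * (gamma_quot (nat \<bar>n\<bar>) - gamma_quot 1)" using n by (intro velocity_eq) auto
    finally have "velocity n - velocity (int m) = velocity_const * (gamma_quot (nat \<bar>n\<bar>) - gamma_quot m)" using velocity_eq[OF m] by (simp add: algebra_simps)
    moreover have "min c1 c2 * real (nat \<bar>n\<bar>) powr (\<alpha> - 1) \<le> \<bar>gamma_quot (nat \<bar>n\<bar>) - gamma_quot m\<bar>"
      using n by (intro gap) auto
    then have "\<bar>velocity_const\<bar> * (min c1 c2 * real (nat \<bar>n\<bar>) powr (\<alpha> - 1)) \<le> \<bar>velocity_const\<bar> * \<bar>gamma_quot (nat \<bar>n\<bar>) - gamma_quot m\<bar>"
      by (intro mult_left_mono) auto
    ultimately show ?thesis by (simp add: abs_mult mult.assoc)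
  qed
  moreover have "0 < \<bar>velocity_const\<bar> * min c1 c2" using velocity_const_neg c1 c2 by (intro mult_pos_pos) auto
  ultimately show ?thesis by (intro exI[of _ "\<bar>velocity_const\<bar> * min c1 c2"]) simp
qed

end

lemma binom_ser_0: "binom_ser b 0 = 1"
proof -
  have "(\<Sum>k. (b gchoose k) *\<^sub>R (0 :: 'a) ^ k) = (\<Sum>k\<in>{0}. (b gchoose k) *\<^sub>R 0 ^ k)"
    by (rule suminf_finite) (auto simp: power_0_left)
  then show ?thesis by (simp add: binom_ser_def)
qed

section \<open>The nonlinear remainder\<close>

text \<open>\<open>ord1\<close> and \<open>ord2\<close> collect the families of maps that vanish at the origin to first and
  second order, in Lipschitz form and uniformly in the parameter.\<close>

definition ord1 :: "(real \<Rightarrow> wiener \<Rightarrow> wiener) \<Rightarrow> bool" where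
  "ord1 \<Phi> \<longleftrightarrow> (\<forall>u. \<Phi> u 0 = 0) \<and> (\<exists>K\<ge>0. \<forall>u g h. norm g \<le> 1 / 8 \<longrightarrow> norm h \<le> 1 / 8 \<longrightarrow>
      norm (\<Phi> u g - \<Phi> u h) \<le> K * norm (g - h))"

definition ord2 :: "(real \<Rightarrow> wiener \<Rightarrow> wiener) \<Rightarrow> bool" where
  "ord2 \<Phi> \<longleftrightarrow> (\<forall>u. \<Phi> u 0 = 0) \<and> (\<exists>K\<ge>0. \<forall>u g h. norm g \<le> 1 / 8 \<longrightarrow> norm h \<le> 1 / 8 \<longrightarrow>
      norm (\<Phi> u g - \<Phi> u h) \<le> K * (norm g + norm h) * norm (g - h))"

section \<open>Calculus of first and second order families\<close>

lemma ord1I: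
  assumes "\<And>u. \<Phi> u 0 = 0" "K \<ge> 0"
    "\<And>u g h. norm g \<le> 1 / 8 \<Longrightarrow> norm h \<le> 1 / 8 \<Longrightarrow> norm (\<Phi> u g - \<Phi> u h) \<le> K * norm (g - h)"
  shows "ord1 \<Phi>"
  using assms unfolding ord1_def by blast

lemma ord2I:
  assumes "\<And>u. \<Phi> u 0 = 0" "K \<ge> 0"
    "\<And>u g h. norm g \<le> 1 / 8 \<Longrightarrow> norm h \<le> 1 / 8 \<Longrightarrow>
       norm (\<Phi> u g - \<Phi> u h) \<le> K * (norm g + norm h) * norm (g - h)"
  shows "ord2 \<Phi>"
  using assms unfolding ord2_def by blast

lemma ord1E:
  assumes "ord1 \<Phi>"
  obtains K where "K \<ge> 0" "\<And>u. \<Phi> u 0 = 0"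
    "\<And>u g h. norm g \<le> 1 / 8 \<Longrightarrow> norm h \<le> 1 / 8 \<Longrightarrow> norm (\<Phi> u g - \<Phi> u h) \<le> K * norm (g - h)"
    "\<And>u g. norm g \<le> 1 / 8 \<Longrightarrow> norm (\<Phi> u g) \<le> K * norm g"
proof -
  obtain K where K: "K \<ge> 0" "\<And>u. \<Phi> u 0 = 0"
    "\<And>u g h. norm g \<le> 1 / 8 \<Longrightarrow> norm h \<le> 1 / 8 \<Longrightarrow> norm (\<Phi> u g - \<Phi> u h) \<le> K * norm (g - h)"
    using assms unfolding ord1_def by blast
  moreover have "norm (\<Phi> u g) \<le> K * norm g" if "norm g \<le> 1 / 8" for u g
    using K(3)[OF that, of 0 u] by (simp add: K(2))
  ultimately show thesis by (rule that)
qed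

lemma ord2E:
  assumes "ord2 \<Phi>"
  obtains K where "K \<ge> 0" "\<And>u. \<Phi> u 0 = 0"
    "\<And>u g h. norm g \<le> 1 / 8 \<Longrightarrow> norm h \<le> 1 / 8 \<Longrightarrow>
       norm (\<Phi> u g - \<Phi> u h) \<le> K * (norm g + norm h) * norm (g - h)"
  using assms unfolding ord2_def by blast

lemma ord2_imp_ord1:
  assumes "ord2 \<Phi>" shows "ord1 \<Phi>"
proof -
  obtain K where K: "K \<ge> 0" "\<And>u. \<Phi> u 0 = 0"
    "\<And>u g h. norm g \<le> 1 / 8 \<Longrightarrow> norm h \<le> 1 / 8 \<Longrightarrow>
       norm (\<Phi> u g - \<Phi> u h) \<le> K * (norm g + norm h) * norm (g - h)"
    by (rule ord2E[OF assms], rule that)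
  show ?thesis
  proof (rule ord1I[of \<Phi> K, OF K(2,1)])
    fix u g h assume gh: "norm (g :: wiener) \<le> 1 / 8" "norm (h :: wiener) \<le> 1 / 8"
    have "K * (norm g + norm h) * norm (g - h) \<le> K * 1 * norm (g - h)"
      using gh K(1) by (intro mult_right_mono mult_left_mono) auto
    then show "norm (\<Phi> u g - \<Phi> u h) \<le> K * norm (g - h)" using K(3)[OF gh, of u] by simp
  qed
qed

lemma ord1_add:
  assumes "ord1 \<Phi>" "ord1 \<Gamma>" shows "ord1 (\<lambda>u g. \<Phi> u g + \<Gamma> u g)"
proof -
  obtain K where K: "K \<ge> 0" "\<And>u. \<Phi> u 0 = 0"
    "\<And>u g h. norm g \<le> 1 / 8 \<Longrightarrow> norm h \<le> 1 / 8 \<Longrightarrow> norm (\<Phi> u g - \<Phi> u h) \<le> K * norm (g - h)"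
    "\<And>u g. norm g \<le> 1 / 8 \<Longrightarrow> norm (\<Phi> u g) \<le> K * norm g"
    by (rule ord1E[OF assms(1)], rule that)
  obtain K' where K': "K' \<ge> 0" "\<And>u. \<Gamma> u 0 = 0"
    "\<And>u g h. norm g \<le> 1 / 8 \<Longrightarrow> norm h \<le> 1 / 8 \<Longrightarrow> norm (\<Gamma> u g - \<Gamma> u h) \<le> K' * norm (g - h)"
    "\<And>u g. norm g \<le> 1 / 8 \<Longrightarrow> norm (\<Gamma> u g) \<le> K' * norm g"
    by (rule ord1E[OF assms(2)], rule that)
  show ?thesis
  proof (rule ord1I[of _ "K + K'"])
    fix u g h assume gh: "norm (g :: wiener) \<le> 1 / 8" "norm (h :: wiener) \<le> 1 / 8"
    show "norm (\<Phi> u g + \<Gamma> u g - (\<Phi> u h + \<Gamma> u h)) \<le> (K + K') * norm (g - h)"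
      unfolding distrib_right add_diff_add
      by (rule norm_triangle_mono[OF K(3)[OF gh] K'(3)[OF gh]])
  qed (use K K' in auto)
qed

lemma ord2_add:
  assumes "ord2 \<Phi>" "ord2 \<Gamma>" shows "ord2 (\<lambda>u g. \<Phi> u g + \<Gamma> u g)"
proof -
  obtain K where K: "K \<ge> 0" "\<And>u. \<Phi> u 0 = 0"
    "\<And>u g h. norm g \<le> 1 / 8 \<Longrightarrow> norm h \<le> 1 / 8 \<Longrightarrow>
       norm (\<Phi> u g - \<Phi> u h) \<le> K * (norm g + norm h) * norm (g - h)"
    by (rule ord2E[OF assms(1)], rule that)
  obtain K' where K': "K' \<ge> 0" "\<And>u. \<Gamma> u 0 = 0"
    "\<And>u g h. norm g \<le> 1 / 8 \<Longrightarrow> norm h \<le> 1 / 8 \<Longrightarrow>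
       norm (\<Gamma> u g - \<Gamma> u h) \<le> K' * (norm g + norm h) * norm (g - h)"
    by (rule ord2E[OF assms(2)], rule that)
  show ?thesis
  proof (rule ord2I[of _ "K + K'"])
    fix u g h assume gh: "norm (g :: wiener) \<le> 1 / 8" "norm (h :: wiener) \<le> 1 / 8"
    have "norm (\<Phi> u g - \<Phi> u h + (\<Gamma> u g - \<Gamma> u h))
        \<le> K * (norm g + norm h) * norm (g - h) + K' * (norm g + norm h) * norm (g - h)"
      by (rule norm_triangle_mono[OF K(3)[OF gh] K'(3)[OF gh]])
    also have "\<dots> = (K + K') * (norm g + norm h) * norm (g - h)" by (simp add: algebra_simps)
    finally show "norm (\<Phi> u g + \<Gamma> u g - (\<Phi> u h + \<Gamma> u h)) \<le> (K + K') * (norm g + norm h) * norm (g - h)"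
      by (simp only: add_diff_add)
  qed (use K K' in auto)
qed

lemma ord2_mult:
  assumes "ord1 \<Phi>" "ord1 \<Gamma>" shows "ord2 (\<lambda>u g. \<Phi> u g * \<Gamma> u g)"
proof -
  obtain K where K: "K \<ge> 0" "\<And>u. \<Phi> u 0 = 0"
    "\<And>u g h. norm g \<le> 1 / 8 \<Longrightarrow> norm h \<le> 1 / 8 \<Longrightarrow> norm (\<Phi> u g - \<Phi> u h) \<le> K * norm (g - h)"
    "\<And>u g. norm g \<le> 1 / 8 \<Longrightarrow> norm (\<Phi> u g) \<le> K * norm g"
    by (rule ord1E[OF assms(1)], rule that)
  obtain K' where K': "K' \<ge> 0" "\<And>u. \<Gamma> u 0 = 0"
    "\<And>u g h. norm g \<le> 1 / 8 \<Longrightarrow> norm h \<le> 1 / 8 \<Longrightarrow> norm (\<Gamma> u g - \<Gamma> u h) \<le> K' * norm (g - h)"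
    "\<And>u g. norm g \<le> 1 / 8 \<Longrightarrow> norm (\<Gamma> u g) \<le> K' * norm g"
    by (rule ord1E[OF assms(2)], rule that)
  show ?thesis
  proof (rule ord2I[of _ "K * K'"])
    fix u g h assume gh: "norm (g :: wiener) \<le> 1 / 8" "norm (h :: wiener) \<le> 1 / 8"
    have "\<Phi> u g * \<Gamma> u g - \<Phi> u h * \<Gamma> u h = \<Phi> u g * (\<Gamma> u g - \<Gamma> u h) + (\<Phi> u g - \<Phi> u h) * \<Gamma> u h"
      by (simp add: algebra_simps)
    also have "norm \<dots> \<le> norm (\<Phi> u g) * norm (\<Gamma> u g - \<Gamma> u h) + norm (\<Phi> u g - \<Phi> u h) * norm (\<Gamma> u h)"
      by (rule norm_triangle_mono[OF norm_mult_ineq norm_mult_ineq])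
    also have "\<dots> \<le> (K * norm g) * (K' * norm (g - h)) + (K * norm (g - h)) * (K' * norm h)"
      using K(1) K'(1) by (intro add_mono mult_mono K(3,4) K'(3,4) gh) auto
    also have "\<dots> = K * K' * (norm g + norm h) * norm (g - h)" by (simp add: algebra_simps)
    finally show "norm (\<Phi> u g * \<Gamma> u g - \<Phi> u h * \<Gamma> u h) \<le> K * K' * (norm g + norm h) * norm (g - h)" .
  qed (use K K' in auto)
qed

lemma ord2_scaleR:
  assumes "ord2 \<Phi>" "\<And>u. \<bar>c u\<bar> \<le> 1" shows "ord2 (\<lambda>u g. c u *\<^sub>R \<Phi> u g)"
proof -
  obtain K where K: "K \<ge> 0" "\<And>u. \<Phi> u 0 = 0"
    "\<And>u g h. norm g \<le> 1 / 8 \<Longrightarrow> norm h \<le> 1 / 8 \<Longrightarrow>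
       norm (\<Phi> u g - \<Phi> u h) \<le> K * (norm g + norm h) * norm (g - h)"
    by (rule ord2E[OF assms(1)], rule that)
  show ?thesis
  proof (rule ord2I[of _ K])
    fix u g h assume gh: "norm (g :: wiener) \<le> 1 / 8" "norm (h :: wiener) \<le> 1 / 8"
    have "norm (c u *\<^sub>R \<Phi> u g - c u *\<^sub>R \<Phi> u h) = \<bar>c u\<bar> * norm (\<Phi> u g - \<Phi> u h)"
      by (simp flip: scaleR_diff_right)
    also have "\<dots> \<le> norm (\<Phi> u g - \<Phi> u h)"
      using mult_right_mono[OF assms(2)] by (metis mult_1 norm_ge_zero)
    also note K(3)[OF gh]
    finally show "norm (c u *\<^sub>R \<Phi> u g - c u *\<^sub>R \<Phi> u h) \<le> K * (norm g + norm h) * norm (g - h)" .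
  qed (use K in auto)
qed

lemma ord1_scaleR_const:
  assumes "ord1 \<Phi>" shows "ord1 (\<lambda>u g. c *\<^sub>R \<Phi> u g)"
proof -
  obtain K where K: "K \<ge> 0" "\<And>u. \<Phi> u 0 = 0"
    "\<And>u g h. norm g \<le> 1 / 8 \<Longrightarrow> norm h \<le> 1 / 8 \<Longrightarrow> norm (\<Phi> u g - \<Phi> u h) \<le> K * norm (g - h)"
    "\<And>u g. norm g \<le> 1 / 8 \<Longrightarrow> norm (\<Phi> u g) \<le> K * norm g"
    by (rule ord1E[OF assms(1)], rule that)
  show ?thesis
  proof (rule ord1I[of _ "\<bar>c\<bar> * K"])
    fix u g h assume gh: "norm (g :: wiener) \<le> 1 / 8" "norm (h :: wiener) \<le> 1 / 8"
    show "norm (c *\<^sub>R \<Phi> u g - c *\<^sub>R \<Phi> u h) \<le> \<bar>c\<bar> * K * norm (g - h)"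
      using mult_left_mono[OF K(3)[OF gh, of u], of "\<bar>c\<bar>"]
      by (simp add: mult.assoc flip: scaleR_diff_right)
  qed (use K in auto)
qed

lemma ord1_multiplier:
  assumes "\<And>u n. cmod (\<mu> u n) \<le> B" shows "ord1 (\<lambda>u g. multiplier (\<mu> u) g)"
proof (rule ord1I[of _ B])
  show "B \<ge> 0" using order_trans[OF norm_ge_zero assms] .
  show "multiplier (\<mu> u) 0 = 0" for u by (rule multiplier_zero) (rule assms)
  show "norm (multiplier (\<mu> u) g - multiplier (\<mu> u) h) \<le> B * norm (g - h)" for u g h
    unfolding multiplier_diff[of "\<mu> u" B, OF assms, symmetric] by (rule norm_multiplier_le) (rule assms)
qed

lemma ord2_binom_ser:
  assumes b: "- 1 \<le> b" "b \<le> 0" and p: "ord1 p"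
    and half: "\<And>u g. norm g \<le> 1 / 8 \<Longrightarrow> norm (p u g) \<le> 1 / 2"
  shows "ord2 (\<lambda>u g. binom_ser b (p u g) - 1 - b *\<^sub>R p u g)"
proof -
  obtain K where K: "K \<ge> 0" "\<And>u. p u 0 = 0"
    "\<And>u g h. norm g \<le> 1 / 8 \<Longrightarrow> norm h \<le> 1 / 8 \<Longrightarrow> norm (p u g - p u h) \<le> K * norm (g - h)"
    "\<And>u g. norm g \<le> 1 / 8 \<Longrightarrow> norm (p u g) \<le> K * norm g"
    by (rule ord1E[OF p], rule that)
  show ?thesis
  proof (rule ord2I[of _ "8 * K * K"])
    fix u g h assume gh: "norm (g :: wiener) \<le> 1 / 8" "norm (h :: wiener) \<le> 1 / 8"
    have "norm ((binom_ser b (p u g) - 1 - b *\<^sub>R p u g) - (binom_ser b (p u h) - 1 - b *\<^sub>R p u h))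
        \<le> 8 * (norm (p u g) + norm (p u h)) * norm (p u g - p u h)"
      by (rule binom_ser_quadratic[OF b]) (rule half[OF gh(1)], rule half[OF gh(2)])
    also have "\<dots> \<le> 8 * (K * norm g + K * norm h) * (K * norm (g - h))"
      using K(1) by (intro mult_mono add_mono K(3,4) gh) auto
    also have "\<dots> = 8 * K * K * (norm g + norm h) * norm (g - h)" by (simp add: algebra_simps)
    finally show "norm ((binom_ser b (p u g) - 1 - b *\<^sub>R p u g) - (binom_ser b (p u h) - 1 - b *\<^sub>R p u h))
        \<le> 8 * K * K * (norm g + norm h) * norm (g - h)" .
  qed (use K(1,2) in \<open>auto simp: binom_ser_0\<close>)
qed

section \<open>The unknown, its difference quotients and the splitting of the integrand\<close>

context gsqg
begin

text \<open>The unknown is \<open>g\<close> with \<open>R = 1 + pert g\<close>: smoothing by \<open>\<sigma>\<close> encodes the loss of \<open>\<alpha>\<close>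
  derivatives, so that \<open>g\<close> and the value of the equation live in the same space.\<close>

definition \<sigma> :: "int \<Rightarrow> real" where "\<sigma> n = (1 + \<bar>of_int n\<bar>) powr (- \<alpha>)"
definition symbol :: "int \<Rightarrow> complex" where "symbol n = of_real (\<sigma> n)"
definition symbol_deriv :: "int \<Rightarrow> complex" where "symbol_deriv n = \<i> * of_int n * of_real (\<sigma> n)"

definition pert where "pert g = multiplier symbol g"
definition dpert where "dpert g = multiplier symbol_deriv g"
definition pert_shift where "pert_shift u g = multiplier (\<lambda>n. symbol n * cis (- of_int n * u)) g"
definition dpert_shift where "dpert_shift u g = multiplier (\<lambda>n. symbol_deriv n * cis (- of_int n * u)) g"
text \<open>The symbol is bounded because |1 - cis (-n u)| \<le> |n| |chord u| and |n| times
  \<open>\<sigma> n\<close> is at most 1. Where the chord vanishes so does the numerator, and the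
  convention x / 0 = 0 keeps the bound and the identity \<open>chord_quot\<close> valid for every
  real u.\<close>

definition quot where "quot u g = multiplier (\<lambda>n. symbol n * ((1 - cis (- of_int n * u)) / of_real (chord u))) g"
text \<open>Not divided by the chord: for the derivative the quotient would have a symbol of size
  |n|^(2 - \<alpha>), which is unbounded. Decay at the diagonal is recovered only after integration
  in u.\<close>

definition incr where "incr u g = multiplier (\<lambda>n. symbol_deriv n * (cis (- of_int n * u) - 1)) g"

lemma sigma_pos: "\<sigma> n > 0"
  by (simp add: \<sigma>_def add_pos_nonneg)

lemma sigma_powr: "\<bar>of_int n\<bar> powr \<alpha> * \<sigma> n \<le> 1"
proof -
  have "\<bar>real_of_int n\<bar> powr \<alpha> \<le> (1 + \<bar>of_int n\<bar>) powr \<alpha>" using alpha by (intro powr_mono2) auto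
  then show ?thesis by (simp add: \<sigma>_def powr_minus field_simps)
qed

lemma sigma_le_1: "\<sigma> n \<le> 1"
  using alpha powr_mono[of "- \<alpha>" 0 "1 + \<bar>of_int n\<bar>"] by (simp add: \<sigma>_def split: if_splits)

lemma sigma_lin: "\<bar>of_int n\<bar> * \<sigma> n \<le> 1"
proof -
  have "\<bar>real_of_int n\<bar> * \<sigma> n \<le> (1 + \<bar>of_int n\<bar>) * \<sigma> n"
    using sigma_pos[of n] by (intro mult_right_mono) auto
  also have "\<dots> = (1 + \<bar>of_int n\<bar>) powr (1 - \<alpha>)"
    by (simp add: \<sigma>_def powr_mult_base add_nonneg_nonneg)
  also have "\<dots> \<le> 1" using alpha powr_mono[of "1 - \<alpha>" 0 "1 + \<bar>of_int n\<bar>"] by (simp split: if_splits)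
  finally show ?thesis .
qed

lemma symbol_le: "cmod (symbol n) \<le> 1" and symbol_deriv_le: "cmod (symbol_deriv n) \<le> 1"
  using sigma_le_1[of n] sigma_lin[of n] sigma_pos[of n] by (simp_all add: symbol_def symbol_deriv_def norm_mult)

lemma symbol_shift_le: "cmod (symbol n * cis (- of_int n * u)) \<le> 1" and symbol_deriv_shift_le: "cmod (symbol_deriv n * cis (- of_int n * u)) \<le> 1"
  using symbol_le[of n] symbol_deriv_le[of n] by (simp_all add: norm_mult)

lemma symbol_quot_le: "cmod (symbol n * ((1 - cis (- of_int n * u)) / of_real (chord u))) \<le> 1"
proof (cases "chord u = 0")
  case False
  have "cmod ((1 - cis (- of_int n * u)) / of_real (chord u)) \<le> \<bar>of_int n\<bar>"
    using norm_cis_multiple_le[of n u] False by (simp add: norm_divide norm_minus_commute field_simps)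
  then have "cmod (symbol n) * cmod ((1 - cis (- of_int n * u)) / of_real (chord u)) \<le> \<sigma> n * \<bar>of_int n\<bar>"
    using sigma_pos[of n] by (intro mult_mono) (auto simp: symbol_def)
  also have "\<dots> \<le> 1" using sigma_lin[of n] by (simp add: mult.commute)
  finally show ?thesis by (simp only: norm_mult)
qed simp

lemma symbol_incr_le: "cmod (symbol_deriv n * (cis (- of_int n * u) - 1)) \<le> 2"
  using mult_mono[OF symbol_deriv_le[of n] norm_triangle_ineq4[of "cis (- of_int n * u)" 1]]
  by (simp add: norm_mult)

lemma coef_ops:
  "coef (pert g) n = symbol n * coef g n" "coef (dpert g) n = symbol_deriv n * coef g n"
  "coef (pert_shift u g) n = symbol n * cis (- of_int n * u) * coef g n"
  "coef (dpert_shift u g) n = symbol_deriv n * cis (- of_int n * u) * coef g n"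
  "coef (quot u g) n = symbol n * ((1 - cis (- of_int n * u)) / of_real (chord u)) * coef g n"
  "coef (incr u g) n = symbol_deriv n * (cis (- of_int n * u) - 1) * coef g n"
  unfolding pert_def dpert_def pert_shift_def dpert_shift_def quot_def incr_def
  by (rule coef_multiplier[OF symbol_le] coef_multiplier[OF symbol_deriv_le] coef_multiplier[OF symbol_shift_le] coef_multiplier[OF symbol_deriv_shift_le]
      coef_multiplier[OF symbol_quot_le] coef_multiplier[OF symbol_incr_le])+

lemma chord_quot: "chord u *\<^sub>R quot u g = pert g - pert_shift u g"
proof (rule wiener_eqI)
  fix n
  show "coef (chord u *\<^sub>R quot u g) n = coef (pert g - pert_shift u g) n"
  proof (cases "chord u = 0")
    case True
    then have "cis (- of_int n * u) - 1 = 0" using norm_cis_multiple_le[of n u] by simp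
    then have "cis (- of_int n * u) = 1" by simp
    then show ?thesis unfolding coef_diff coef_ops coef_scaleR using True by simp
  next
    case False
    then show ?thesis unfolding coef_diff coef_ops coef_scaleR
      by (simp add: scaleR_conv_of_real algebra_simps diff_divide_distrib)
  qed
qed

lemma incr_eq: "incr u g = dpert_shift u g - dpert g"
  by (rule wiener_eqI) (simp add: coef_ops coef_diff algebra_simps)

text \<open>With \<open>y = x - u\<close>, the squared distance \<open>D\<close> is \<open>(chord u)\<^sup>2 (1 + dist_pert u g)\<close>, and \<open>R x R y + R' x R' y\<close>
  is \<open>1 + prod_pert u g\<close>.\<close>

definition dist_pert where "dist_pert u g = pert g + pert_shift u g + (pert g * pert_shift u g + quot u g * quot u g)"
definition prod_pert where "prod_pert u g = pert g + pert_shift u g + (pert g * pert_shift u g + dpert g * dpert_shift u g)"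
definition dist_power where "dist_power u g = binom_ser (- \<alpha> / 2) (dist_pert u g)"
definition integrand where "integrand u g = sin u *\<^sub>R ((1 + prod_pert u g) * dist_power u g)
   + cos u *\<^sub>R ((incr u g + pert g * incr u g - dpert g * (pert_shift u g - pert g)) * dist_power u g)"
definition integrand_lin where "integrand_lin u g = sin u *\<^sub>R ((1 - \<alpha> / 2) *\<^sub>R (pert g + pert_shift u g)) + cos u *\<^sub>R incr u g"
text \<open>The quadratic remainder is split by the origin of its decay at the diagonal:
  \<open>rem_smooth\<close> gathers the terms with an explicit factor \<open>chord u\<close>, while
  \<open>rem_factor\<close> multiplies \<open>incr\<close>, which is controlled in integrated
  norm.\<close>

definition rem_smooth where "rem_smooth u g = cos (u / 2) *\<^sub>R ((1 + prod_pert u g) * dist_power u g - 1 - (1 - \<alpha> / 2) *\<^sub>R (pert g + pert_shift u g))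
   + cos u *\<^sub>R (dpert g * (quot u g * dist_power u g))"
definition rem_factor where "rem_factor u g = dist_power u g - 1 + pert g * dist_power u g"
definition integrand_rem where "integrand_rem u g = chord u *\<^sub>R rem_smooth u g + cos u *\<^sub>R (incr u g * rem_factor u g)"

text \<open>The explicit chord factors come from sin u = chord u cos (u / 2) and from writing the
  difference of \<open>pert g\<close> and its shift as the chord times \<open>quot\<close>.\<close>

lemma integrand_split: "integrand u g = sin u *\<^sub>R 1 + integrand_lin u g + integrand_rem u g"
proof -
  have s: "sin u = chord u * cos (u / 2)" using sin_double[of "u / 2"] by (simp add: chord_def)
  have e: "dpert g * (pert_shift u g - pert g) = - (chord u *\<^sub>R (dpert g * quot u g))"
    unfolding mult_scaleR_right [symmetric] chord_quot by (simp add: algebra_simps)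
  show ?thesis
    unfolding integrand_def e integrand_rem_def rem_smooth_def rem_factor_def integrand_lin_def s by (simp add: algebra_simps)
qed

lemma ord1_basic: "ord1 (\<lambda>u. pert)" "ord1 (\<lambda>u. dpert)" "ord1 pert_shift" "ord1 dpert_shift" "ord1 quot"
  using ord1_multiplier[of "\<lambda>u. symbol" 1, OF symbol_le] ord1_multiplier[of "\<lambda>u. symbol_deriv" 1, OF symbol_deriv_le]
    ord1_multiplier[of "\<lambda>u n. symbol n * cis (- of_int n * u)" 1, OF symbol_shift_le]
    ord1_multiplier[of "\<lambda>u n. symbol_deriv n * cis (- of_int n * u)" 1, OF symbol_deriv_shift_le]
    ord1_multiplier[of "\<lambda>u n. symbol n * ((1 - cis (- of_int n * u)) / of_real (chord u))" 1, OF symbol_quot_le]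
  by (simp_all add: pert_def[abs_def] dpert_def[abs_def] pert_shift_def[abs_def] dpert_shift_def[abs_def] quot_def[abs_def])

lemma norm_basic: "norm (pert g) \<le> norm g" "norm (dpert g) \<le> norm g" "norm (pert_shift u g) \<le> norm g"
  "norm (dpert_shift u g) \<le> norm g" "norm (quot u g) \<le> norm g"
  using norm_multiplier_le[OF symbol_le, where a = g] norm_multiplier_le[OF symbol_deriv_le, where a = g]
    norm_multiplier_le[where a = g, OF symbol_shift_le[of _ u]] norm_multiplier_le[where a = g, OF symbol_deriv_shift_le[of _ u]]
    norm_multiplier_le[where a = g, OF symbol_quot_le[of _ u]]
  by (simp_all add: pert_def dpert_def pert_shift_def dpert_shift_def quot_def)

lemma ord1_dist_pert: "ord1 dist_pert" and ord1_prod_pert: "ord1 prod_pert"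
  unfolding dist_pert_def[abs_def] prod_pert_def[abs_def]
  by (intro ord1_add ord2_imp_ord1[OF ord2_add] ord2_mult ord1_basic)+

text \<open>Origin of the radius 1/8: two linear and two quadratic terms give 2/8 + 2/64, inside the
  ball of radius 1/2 on which the binomial series was estimated.\<close>

lemma norm_dist_pert_le: "norm (dist_pert u g) \<le> 1 / 2" if "norm g \<le> 1 / 8"
proof -
  have m: "norm (x * y) \<le> 1 / 64" if "norm x \<le> 1 / 8" "norm y \<le> 1 / 8" for x y :: wiener
    using order_trans[OF norm_mult_ineq mult_mono[OF that]] by simp
  have nb: "norm (pert g) \<le> 1 / 8" "norm (pert_shift u g) \<le> 1 / 8" "norm (quot u g) \<le> 1 / 8"
    using norm_basic(1)[of g] norm_basic(3)[of u g] norm_basic(5)[of u g] that by linarith+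
  have "norm (dist_pert u g) \<le> (1 / 8 + 1 / 8) + (1 / 64 + 1 / 64)"
    unfolding dist_pert_def by (intro norm_triangle_mono m) (use nb in auto)
  then show ?thesis by simp
qed

lemma alpha_half: "- 1 \<le> - \<alpha> / 2" "- \<alpha> / 2 \<le> 0"
  using alpha by auto

lemma ord2_dist_power: "ord2 (\<lambda>u g. dist_power u g - 1 - (- \<alpha> / 2) *\<^sub>R dist_pert u g)"
  unfolding dist_power_def by (rule ord2_binom_ser[OF alpha_half ord1_dist_pert norm_dist_pert_le])

lemma ord1_dist_power: "ord1 (\<lambda>u g. dist_power u g - 1)"
proof -
  have "ord1 (\<lambda>u g. (dist_power u g - 1 - (- \<alpha> / 2) *\<^sub>R dist_pert u g) + (- \<alpha> / 2) *\<^sub>R dist_pert u g)"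
    by (intro ord1_add ord2_imp_ord1[OF ord2_dist_power] ord1_scaleR_const ord1_dist_pert)
  then show ?thesis by simp
qed

lemma ord1_mult_dist_power:
  assumes "ord1 \<Phi>" shows "ord1 (\<lambda>u g. \<Phi> u g * dist_power u g)"
proof -
  have "ord1 (\<lambda>u g. \<Phi> u g + \<Phi> u g * (dist_power u g - 1))"
    by (intro ord1_add assms ord2_imp_ord1[OF ord2_mult] ord1_dist_power)
  then show ?thesis by (simp add: algebra_simps)
qed

lemma ord1_rem_factor: "ord1 rem_factor"
  unfolding rem_factor_def[abs_def] by (intro ord1_add ord1_dist_power ord1_mult_dist_power ord1_basic)

lemma ord2_rem_smooth: "ord2 rem_smooth"
proof -
  \<comment> \<open>The coefficient equals -\<alpha> / 2. This is the quadratic part of the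
    first-order term of the binomial series; the linear part of that term, combined with the one of
    \<open>prod_pert\<close>, makes up the subtracted 1 - \<alpha> / 2.\<close>
  have p2: "ord2 (\<lambda>u g. (- (1 - - \<alpha> / 2 - 1)) *\<^sub>R (pert g * pert_shift u g + quot u g * quot u g))" 
    by (rule ord2_scaleR) (use alpha in \<open>auto intro!: ord2_add ord2_mult ord1_basic\<close>)
  have "(1 + prod_pert u g) * dist_power u g - 1 - (1 - \<alpha> / 2) *\<^sub>R (pert g + pert_shift u g)
     = (dist_power u g - 1 - (- \<alpha> / 2) *\<^sub>R dist_pert u g) + (- (1 - - \<alpha> / 2 - 1)) *\<^sub>R (pert g * pert_shift u g + quot u g * quot u g)
       + prod_pert u g * (dist_power u g - 1) + (pert g * pert_shift u g + dpert g * dpert_shift u g)" for u g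
    by (simp add: dist_pert_def prod_pert_def algebra_simps)
  then have "ord2 (\<lambda>u g. (1 + prod_pert u g) * dist_power u g - 1 - (1 - \<alpha> / 2) *\<^sub>R (pert g + pert_shift u g))"
    by (simp only:) (intro ord2_add ord2_dist_power p2 ord2_mult ord1_prod_pert ord1_dist_power ord1_basic)
  then show ?thesis
    unfolding rem_smooth_def[abs_def]
    by (intro ord2_add ord2_scaleR ord2_mult ord1_basic ord1_mult_dist_power) auto
qed

lemma measurable_ops [measurable]:
  "(\<lambda>u. pert_shift u g) \<in> borel_measurable borel" "(\<lambda>u. dpert_shift u g) \<in> borel_measurable borel"
  "(\<lambda>u. quot u g) \<in> borel_measurable borel" "(\<lambda>u. incr u g) \<in> borel_measurable borel"
  unfolding pert_shift_def dpert_shift_def quot_def incr_def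
  subgoal by (rule borel_measurable_multiplier[OF _ symbol_shift_le]) measurable
  subgoal by (rule borel_measurable_multiplier[OF _ symbol_deriv_shift_le]) measurable
  subgoal by (rule borel_measurable_multiplier[OF _ symbol_quot_le]) measurable
  subgoal by (rule borel_measurable_multiplier[OF _ symbol_incr_le]) measurable
  done

lemma measurable_dist_pert [measurable]: "(\<lambda>u. dist_pert u g) \<in> borel_measurable borel"
  and measurable_prod_pert [measurable]: "(\<lambda>u. prod_pert u g) \<in> borel_measurable borel"
  unfolding dist_pert_def prod_pert_def by measurable

lemma measurable_dist_power: "norm g \<le> 1 / 8 \<Longrightarrow> (\<lambda>u. dist_power u g) \<in> borel_measurable borel"
  unfolding dist_power_def
  by (rule borel_measurable_binom_ser[OF alpha_half measurable_dist_pert])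
     (rule le_less_trans[OF norm_dist_pert_le], assumption, simp)

lemma measurable_integrand_rem: "norm g \<le> 1 / 8 \<Longrightarrow> (\<lambda>u. integrand_rem u g) \<in> borel_measurable borel"
  unfolding integrand_rem_def rem_smooth_def rem_factor_def
  supply measurable_dist_power [measurable] by measurable

text \<open>Mode by mode the cost is |n|^(\<alpha> - 1) for the increment and |n| for the
  derivative, which \<open>\<sigma> n\<close> compensates exactly; hence one constant for all
  modes.\<close>

lemma
  shows integrable_kernel_incr: "integrable circle (\<lambda>u. kernel u * norm (incr u g))"
    and integral_kernel_incr_le: "(LINT u|circle. kernel u * norm (incr u g)) \<le> shift_const * norm g"
proof -
  let ?\<mu> = "\<lambda>u n. symbol_deriv n * (cis (- of_int n * u) - 1)"
  have meas: "(\<lambda>u. ?\<mu> u n) \<in> borel_measurable circle" for n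
    by (rule borel_measurable_circle) measurable
  have eq: "kernel u * cmod (?\<mu> u n) = cmod (symbol_deriv n) * (kernel u * cmod (cis (- of_int n * u) - 1))" for u n
    by (simp add: norm_mult)
  have int: "integrable circle (\<lambda>u. kernel u * cmod (?\<mu> u n))" for n
    unfolding eq by (intro integrable_mult_right integrable_shift)
  have "0 < shift_const" using alpha by (auto simp: shift_const_def intro!: add_pos_pos)
  have le: "(LINT u|circle. kernel u * cmod (?\<mu> u n)) \<le> shift_const" for n
  proof (cases "n = 0")
    case False
    have "(LINT u|circle. kernel u * cmod (?\<mu> u n)) = cmod (symbol_deriv n) * (LINT u|circle. kernel u * cmod (cis (- of_int n * u) - 1))"
      unfolding eq by simp
    also have "\<dots> \<le> cmod (symbol_deriv n) * (shift_const * \<bar>of_int n\<bar> powr (\<alpha> - 1))"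
      by (intro mult_left_mono integral_shift_le False) auto
    also have "\<dots> = shift_const * ((\<bar>of_int n\<bar> * \<bar>of_int n\<bar> powr (\<alpha> - 1)) * \<sigma> n)"
      using sigma_pos[of n] by (simp add: symbol_deriv_def norm_mult)
    also have "\<bar>of_int n\<bar> * \<bar>of_int n\<bar> powr (\<alpha> - 1) = \<bar>real_of_int n\<bar> powr \<alpha>"
      using powr_mult_base[of "\<bar>real_of_int n\<bar>" "\<alpha> - 1"] by simp
    also have "shift_const * (\<bar>real_of_int n\<bar> powr \<alpha> * \<sigma> n) \<le> shift_const * 1"
      using \<open>0 < shift_const\<close> by (intro mult_left_mono sigma_powr) auto
    finally show ?thesis by simp
  qed (use \<open>0 < shift_const\<close> in simp)
  have B: "cmod (?\<mu> u n) \<le> 2" for u n by (rule symbol_incr_le)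
  show "integrable circle (\<lambda>u. kernel u * norm (incr u g))"
    unfolding incr_def
    by (rule integrable_norm_multiplier[OF meas borel_measurable_circle[OF kernel_measurable] B kernel_nonneg int le])
  show "(LINT u|circle. kernel u * norm (incr u g)) \<le> shift_const * norm g"
    unfolding incr_def
    by (rule integral_norm_multiplier_le[OF meas borel_measurable_circle[OF kernel_measurable] B kernel_nonneg int le])
qed

end

section \<open>Integrals of periodic functions over one period\<close>

lemma set_integrable_shift:
  fixes h :: "real \<Rightarrow> real"
  shows "set_integrable lborel {a + c..<b + c} h \<longleftrightarrow> set_integrable lborel {a..<b} (\<lambda>u. h (u + c))"
    and "(LINT u:{a + c..<b + c}|lborel. h u) = (LINT u:{a..<b}|lborel. h (u + c))"
proof -
  let ?f = "\<lambda>u. indicator {a + c..<b + c} u *\<^sub>R h u"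
  have eq: "(\<lambda>u. ?f (c + 1 * u)) = (\<lambda>u. indicator {a..<b} u *\<^sub>R h (u + c))"
    by (auto simp: indicator_def fun_eq_iff add.commute)
  show "set_integrable lborel {a + c..<b + c} h \<longleftrightarrow> set_integrable lborel {a..<b} (\<lambda>u. h (u + c))"
    using lborel_integrable_real_affine_iff[of 1 ?f c] unfolding eq set_integrable_def by simp
  show "(LINT u:{a + c..<b + c}|lborel. h u) = (LINT u:{a..<b}|lborel. h (u + c))"
    using lborel_integral_real_affine[of 1 ?f c] unfolding eq set_lebesgue_integral_def by simp
qed

lemma
  fixes h :: "real \<Rightarrow> real"
  shows set_integrable_Ico: "set_integrable lborel {a..<b} h \<longleftrightarrow> set_integrable lborel {a<..<b} h"
    and set_integral_Ico: "(LINT u:{a..<b}|lborel. h u) = (LINT u:{a<..<b}|lborel. h u)"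
  unfolding set_integrable_def set_lebesgue_integral_def
  by (rule integrable_discrete_difference[of "{a}"] integral_discrete_difference[of "{a}"];
      auto simp: indicator_def)+

lemma set_integral_periodic:
  fixes h :: "real \<Rightarrow> real"
  assumes per: "\<And>u. h (u + 2 * pi) = h u" and int: "integrable circle h"
  shows "(LINT u:{a..<a + 2 * pi}|lborel. h u) = integral\<^sup>L circle h"
proof -
  define k where "k = \<lfloor>a / (2 * pi)\<rfloor>"
  define r where "r = a - of_int k * (2 * pi)"
  have r: "0 \<le> r" "r < 2 * pi"
    using floor_divide_lower[of "2 * pi" a] floor_divide_upper[of "2 * pi" a]
    unfolding r_def k_def distrib_right by simp_all
  have per': "h (u + of_int k * (2 * pi)) = h u" for u
  proof -
    have nat: "h (u + real j * (2 * pi)) = h u" for j u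
      by (induction j) (use per in \<open>auto simp: algebra_simps\<close>, metis add.assoc add.commute)
    show ?thesis
      using nat[of u "nat k"] nat[of "u + of_int k * (2 * pi)" "nat (- k)"] by (cases "k \<ge> 0") auto
  qed
  have base: "set_integrable lborel {0..<2 * pi} h"
    using int by (simp add: set_integrable_Ico integrable_circle_iff)
  have i1: "set_integrable lborel {r..<2 * pi} h" and i2: "set_integrable lborel {0..<r} h"
    by (rule set_integrable_subset[OF base]; use r in auto)+
  have i3: "set_integrable lborel {2 * pi..<r + 2 * pi} h"
    using i2 set_integrable_shift(1)[of 0 "2 * pi" r h] by (simp add: per)
  have un: "{r..<r + 2 * pi} = {r..<2 * pi} \<union> {2 * pi..<r + 2 * pi}" using r by auto
  have un': "{0..<2 * pi} = {0..<r} \<union> {r..<2 * pi}" using r by auto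
  have "(LINT u:{r..<r + 2 * pi}|lborel. h u)
      = (LINT u:{r..<2 * pi}|lborel. h u) + (LINT u:{2 * pi..<r + 2 * pi}|lborel. h u)"
    unfolding un by (rule set_integral_Un[OF _ i1 i3]) auto
  also have "(LINT u:{2 * pi..<r + 2 * pi}|lborel. h u) = (LINT u:{0..<r}|lborel. h u)"
    using set_integrable_shift(2)[of 0 "2 * pi" r h] by (simp add: per)
  also have "(LINT u:{r..<2 * pi}|lborel. h u) + (LINT u:{0..<r}|lborel. h u) = (LINT u:{0..<2 * pi}|lborel. h u)"
    unfolding un' by (subst set_integral_Un[OF _ i2 i1]) auto
  finally have er: "(LINT u:{r..<r + 2 * pi}|lborel. h u) = integral\<^sup>L circle h"
    by (simp add: integral_circle set_integral_Ico)
  have a: "a = r + of_int k * (2 * pi)" "a + 2 * pi = (r + 2 * pi) + of_int k * (2 * pi)" by (simp_all add: r_def)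
  show "(LINT u:{a..<a + 2 * pi}|lborel. h u) = integral\<^sup>L circle h"
    unfolding a(2) unfolding a(1) using er by (subst set_integrable_shift(2)) (simp add: per')
qed

text \<open>Passes from the variable y of the three integrals in F to u = x - y on (0, 2 pi), the
  interval on which the chord is positive.\<close>

lemma set_integral_convolution_periodic:
  fixes h :: "real \<Rightarrow> real"
  assumes per: "\<And>u. h (u + 2 * pi) = h u" and int: "integrable circle h"
  shows "(LINT y:{-pi..pi}|lborel. h (x - y)) = integral\<^sup>L circle h"
proof -
  have ind: "indicator {-pi..pi} (x + - 1 * u) = (indicator {x - pi..x + pi} u :: real)" for u
    by (auto simp: indicator_def)
  have "(LINT y:{-pi..pi}|lborel. h (x - y)) = (LINT u:{x - pi..x + pi}|lborel. h u)"
    using lborel_integral_real_affine[of "- 1" "\<lambda>y. indicator {-pi..pi} y *\<^sub>R h (x - y)" x]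
    by (simp add: set_lebesgue_integral_def ind[simplified])
  also have "\<dots> = (LINT u:{x - pi..<x + pi}|lborel. h u)"
    unfolding set_lebesgue_integral_def
    by (rule integral_discrete_difference[of "{x + pi}"]) (auto simp: indicator_def)
  also have "\<dots> = integral\<^sup>L circle h"
    using set_integral_periodic[OF assms, of "x - pi"] by (simp add: algebra_simps)
  finally show ?thesis .
qed

section \<open>Linear part and remainder as Bochner integrals\<close>

context gsqg
begin

definition nonlin where "nonlin g = (LINT u|circle. kernel u *\<^sub>R integrand_rem u g)"
definition lin_op where "lin_op g = (LINT u|circle. kernel u *\<^sub>R integrand_lin u g)"

lemma incr_diff: "incr u (g - h) = incr u g - incr u h"
  unfolding incr_def by (rule multiplier_diff[OF symbol_incr_le])

lemma integrand_rem_0: "integrand_rem u 0 = 0"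
  using ord2_rem_smooth ord1_rem_factor by (simp add: integrand_rem_def ord1_def ord2_def)

text \<open>The norms of \<open>incr\<close> stay on the right-hand side because they have no usable
  bound pointwise in u. Integration against the kernel replaces each by a multiple of the norm of
  its argument, and every term becomes quadratic.\<close>

lemma integrand_rem_lipschitz:
  "\<exists>K\<ge>0. \<forall>u\<in>{0<..<2 * pi}. \<forall>g h. norm g \<le> 1 / 8 \<longrightarrow> norm h \<le> 1 / 8 \<longrightarrow>
     norm (integrand_rem u g - integrand_rem u h) \<le> K * (norm g + norm h) * norm (g - h) * chord u
       + (K * norm g * norm (incr u (g - h)) + K * norm (g - h) * norm (incr u h))"
proof -
  obtain K2 where K2: "K2 \<ge> 0" "\<And>u. rem_smooth u 0 = 0"
    "\<And>u g h. norm g \<le> 1 / 8 \<Longrightarrow> norm h \<le> 1 / 8 \<Longrightarrow>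
       norm (rem_smooth u g - rem_smooth u h) \<le> K2 * (norm g + norm h) * norm (g - h)"
    by (rule ord2E[OF ord2_rem_smooth], rule that)
  obtain K1 where K1: "K1 \<ge> 0" "\<And>u. rem_factor u 0 = 0"
    "\<And>u g h. norm g \<le> 1 / 8 \<Longrightarrow> norm h \<le> 1 / 8 \<Longrightarrow> norm (rem_factor u g - rem_factor u h) \<le> K1 * norm (g - h)"
    "\<And>u g. norm g \<le> 1 / 8 \<Longrightarrow> norm (rem_factor u g) \<le> K1 * norm g"
    by (rule ord1E[OF ord1_rem_factor], rule that)
  define K where "K = K1 + K2"
  have K: "0 \<le> K" "K1 \<le> K" "K2 \<le> K" using K1(1) K2(1) by (auto simp: K_def)
  have "norm (integrand_rem u g - integrand_rem u h) \<le> K * (norm g + norm h) * norm (g - h) * chord u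
       + (K * norm g * norm (incr u (g - h)) + K * norm (g - h) * norm (incr u h))"
    if u: "u \<in> {0<..<2 * pi}" and gh: "norm g \<le> 1 / 8" "norm h \<le> 1 / 8" for u g h
  proof -
    have "incr u g * rem_factor u g - incr u h * rem_factor u h = incr u (g - h) * rem_factor u g + incr u h * (rem_factor u g - rem_factor u h)"
      by (simp add: incr_diff algebra_simps)
    then have "integrand_rem u g - integrand_rem u h
        = chord u *\<^sub>R (rem_smooth u g - rem_smooth u h) + cos u *\<^sub>R (incr u (g - h) * rem_factor u g + incr u h * (rem_factor u g - rem_factor u h))"
      unfolding integrand_rem_def by (simp add: algebra_simps)
    also have "norm \<dots> \<le> chord u * (K2 * (norm g + norm h) * norm (g - h))
         + (norm (incr u (g - h)) * (K1 * norm g) + norm (incr u h) * (K1 * norm (g - h)))"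
    proof (rule norm_triangle_mono)
      show "norm (chord u *\<^sub>R (rem_smooth u g - rem_smooth u h)) \<le> chord u * (K2 * (norm g + norm h) * norm (g - h))"
        using chord_pos[OF u] K2(3)[OF gh, of u] by (simp add: mult_left_mono)
      have "norm (cos u *\<^sub>R (incr u (g - h) * rem_factor u g + incr u h * (rem_factor u g - rem_factor u h)))
          \<le> 1 * norm (incr u (g - h) * rem_factor u g + incr u h * (rem_factor u g - rem_factor u h))"
        unfolding norm_scaleR by (intro mult_right_mono) auto
      also have "\<dots> \<le> norm (incr u (g - h)) * norm (rem_factor u g) + norm (incr u h) * norm (rem_factor u g - rem_factor u h)"
        unfolding mult_1_left by (rule norm_triangle_mono[OF norm_mult_ineq norm_mult_ineq])
      also have "\<dots> \<le> norm (incr u (g - h)) * (K1 * norm g) + norm (incr u h) * (K1 * norm (g - h))"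
        by (intro add_mono mult_left_mono K1 gh) auto
      finally show "norm (cos u *\<^sub>R (incr u (g - h) * rem_factor u g + incr u h * (rem_factor u g - rem_factor u h)))
          \<le> norm (incr u (g - h)) * (K1 * norm g) + norm (incr u h) * (K1 * norm (g - h))" .
    qed
    also have "\<dots> \<le> chord u * (K * (norm g + norm h) * norm (g - h))
         + (norm (incr u (g - h)) * (K * norm g) + norm (incr u h) * (K * norm (g - h)))"
      using chord_pos[OF u] K by (intro add_mono mult_left_mono mult_right_mono) auto
    finally show ?thesis by (simp only: mult_ac)
  qed
  then show ?thesis using K(1) by blast
qed

lemma
  shows integrable_integrand_rem: "\<And>g. norm g \<le> 1 / 8 \<Longrightarrow> integrable circle (\<lambda>u. kernel u *\<^sub>R integrand_rem u g)"
    and nonlin_lipschitz: "\<exists>K\<ge>0. \<forall>g h. norm g \<le> 1 / 8 \<longrightarrow> norm h \<le> 1 / 8 \<longrightarrow>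
       norm (nonlin g - nonlin h) \<le> K * (norm g + norm h) * norm (g - h)"
proof -
  obtain K where K: "K \<ge> 0" "\<And>u g h. u \<in> {0<..<2 * pi} \<Longrightarrow> norm g \<le> 1 / 8 \<Longrightarrow> norm h \<le> 1 / 8 \<Longrightarrow>
     norm (integrand_rem u g - integrand_rem u h) \<le> K * (norm g + norm h) * norm (g - h) * chord u
       + (K * norm g * norm (incr u (g - h)) + K * norm (g - h) * norm (incr u h))"
    using integrand_rem_lipschitz by blast
  define B where "B g h u = K * (norm g + norm h) * norm (g - h) * (kernel u * chord u)
     + (K * norm g * (kernel u * norm (incr u (g - h))) + K * norm (g - h) * (kernel u * norm (incr u h)))" for g h u
  have B_int: "integrable circle (B g h)" for g h
    unfolding B_def
    by (intro Bochner_Integration.integrable_add integrable_mult_right integrable_kernel_chord integrable_kernel_incr)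
  have B_le: "norm (kernel u *\<^sub>R integrand_rem u g - kernel u *\<^sub>R integrand_rem u h) \<le> B g h u"
    if "u \<in> space circle" "norm g \<le> 1 / 8" "norm h \<le> 1 / 8" for u g h
  proof -
    have "norm (kernel u *\<^sub>R integrand_rem u g - kernel u *\<^sub>R integrand_rem u h) = kernel u * norm (integrand_rem u g - integrand_rem u h)"
      by (simp add: kernel_nonneg flip: scaleR_diff_right)
    also have "\<dots> \<le> kernel u * (K * (norm g + norm h) * norm (g - h) * chord u
       + (K * norm g * norm (incr u (g - h)) + K * norm (g - h) * norm (incr u h)))"
      using that by (intro mult_left_mono K kernel_nonneg) (auto simp: space_circle)
    also have "\<dots> = B g h u" by (simp add: B_def algebra_simps)
    finally show ?thesis .
  qed
  have meas: "(\<lambda>u. kernel u *\<^sub>R integrand_rem u g) \<in> borel_measurable circle" if "norm g \<le> 1 / 8" for g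
    by (intro borel_measurable_scaleR borel_measurable_circle kernel_measurable measurable_integrand_rem that)
  show int: "integrable circle (\<lambda>u. kernel u *\<^sub>R integrand_rem u g)" if g: "norm g \<le> 1 / 8" for g
  proof (rule Bochner_Integration.integrable_bound[OF B_int[of g 0] meas[OF g]])
    show "AE u in circle. norm (kernel u *\<^sub>R integrand_rem u g) \<le> norm (B g 0 u)"
      using B_le[OF _ g, of _ 0] by (intro AE_I2) (force simp: integrand_rem_0)
  qed
  define M where "M = integral\<^sup>L circle (\<lambda>u. kernel u * chord u)"
  have "M \<ge> 0" unfolding M_def
    by (rule integral_nonneg_AE) (use chord_pos in \<open>auto intro!: AE_I2 simp: space_circle kernel_nonneg less_imp_le\<close>)
  have shift_const: "0 \<le> shift_const" using alpha by (auto simp: shift_const_def intro!: add_nonneg_nonneg)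
  have "norm (nonlin g - nonlin h) \<le> (K * M + K * shift_const) * (norm g + norm h) * norm (g - h)"
    if g: "norm g \<le> 1 / 8" and h: "norm h \<le> 1 / 8" for g h
  proof -
    have "nonlin g - nonlin h = (LINT u|circle. kernel u *\<^sub>R integrand_rem u g - kernel u *\<^sub>R integrand_rem u h)"
      unfolding nonlin_def by (rule Bochner_Integration.integral_diff[symmetric]) (rule int, fact)+
    also have "norm \<dots> \<le> integral\<^sup>L circle (B g h)"
    proof (rule order_trans[OF integral_norm_bound integral_mono])
      show "integrable circle (\<lambda>u. norm (kernel u *\<^sub>R integrand_rem u g - kernel u *\<^sub>R integrand_rem u h))"
        by (intro integrable_norm Bochner_Integration.integrable_diff int g h)
    qed (use B_int B_le g h in auto)
    also have "integral\<^sup>L circle (B g h) = K * (norm g + norm h) * norm (g - h) * M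
       + (K * norm g * (LINT u|circle. kernel u * norm (incr u (g - h))) + K * norm (g - h) * (LINT u|circle. kernel u * norm (incr u h)))"
      unfolding B_def M_def using integrable_kernel_chord integrable_kernel_incr by simp
    also have "\<dots> \<le> K * (norm g + norm h) * norm (g - h) * M
       + (K * norm g * (shift_const * norm (g - h)) + K * norm (g - h) * (shift_const * norm h))"
      using K(1) by (intro add_mono mult_left_mono integral_kernel_incr_le) auto
    also have "\<dots> = (K * M + K * shift_const) * (norm g + norm h) * norm (g - h)" by (simp add: algebra_simps)
    finally show ?thesis .
  qed
  then show "\<exists>K\<ge>0. \<forall>g h. norm g \<le> 1 / 8 \<longrightarrow> norm h \<le> 1 / 8 \<longrightarrow>
       norm (nonlin g - nonlin h) \<le> K * (norm g + norm h) * norm (g - h)"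
    using K(1) \<open>M \<ge> 0\<close> shift_const by (intro exI[of _ "K * M + K * shift_const"]) auto
qed

lemma nonlin_0: "nonlin 0 = 0"
  by (simp add: nonlin_def integrand_rem_0)

lemma integrable_integrand_lin: "integrable circle (\<lambda>u. kernel u *\<^sub>R integrand_lin u g)"
proof (rule Bochner_Integration.integrable_bound)
  show "integrable circle (\<lambda>u. 2 * norm g * (kernel u * chord u) + kernel u * norm (incr u g))"
    by (intro Bochner_Integration.integrable_add integrable_mult_right integrable_kernel_chord integrable_kernel_incr)
  have [measurable]: "(\<lambda>u. integrand_lin u g) \<in> borel_measurable borel" unfolding integrand_lin_def by measurable
  show "(\<lambda>u. kernel u *\<^sub>R integrand_lin u g) \<in> borel_measurable circle"
    by (rule borel_measurable_circle) measurable
  have "kernel u * norm (integrand_lin u g) \<le> 2 * norm g * (kernel u * chord u) + kernel u * norm (incr u g)" if u: "u \<in> space circle" for u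
  proof -
    have u': "u \<in> {0<..<2 * pi}" using u by (simp add: space_circle)
    have "norm (integrand_lin u g) \<le> chord u * (1 * (norm g + norm g)) + 1 * norm (incr u g)"
      unfolding integrand_lin_def
    proof (rule norm_triangle_mono)
      show "norm (sin u *\<^sub>R (1 - \<alpha> / 2) *\<^sub>R (pert g + pert_shift u g)) \<le> chord u * (1 * (norm g + norm g))"
        unfolding norm_scaleR using abs_sin_le_chord[OF u'] alpha
        by (intro mult_mono norm_triangle_mono norm_basic) auto
      show "norm (cos u *\<^sub>R incr u g) \<le> 1 * norm (incr u g)"
        unfolding norm_scaleR by (intro mult_right_mono) auto
    qed
    from mult_left_mono[OF this kernel_nonneg[of u]] show ?thesis by (simp add: algebra_simps)
  qed
  then show "AE u in circle. norm (kernel u *\<^sub>R integrand_lin u g) \<le> norm (2 * norm g * (kernel u * chord u) + kernel u * norm (incr u g))"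
    by (intro AE_I2) (force simp: kernel_nonneg)
qed

text \<open>A coefficient is a bounded functional and commutes with the Bochner integral, which
  reduces the operator to the scalar integral of its symbol.\<close>

lemma coef_lin_op: "coef (lin_op g) n = symbol n * (\<i> * of_int n * of_real (velocity_integral n)) * coef g n"
proof -
  have "coef (lin_op g) n = (LINT u|circle. coef (kernel u *\<^sub>R integrand_lin u g) n)"
    unfolding lin_op_def by (rule integral_bounded_linear[OF bounded_linear_coef integrable_integrand_lin, symmetric])
  also have "\<dots> = (LINT u|circle. (kernel u *\<^sub>R linear_symbol n u) * (symbol n * coef g n))"
    unfolding integrand_lin_def linear_symbol_def coef_scaleR coef_add coef_ops symbol_deriv_def symbol_def
    by (intro Bochner_Integration.integral_cong refl) (simp add: scaleR_conv_of_real algebra_simps)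
  also have "\<dots> = (LINT u|circle. kernel u *\<^sub>R linear_symbol n u) * (symbol n * coef g n)"
    by (rule integral_mult_left_zero)
  finally show ?thesis by (simp add: integral_linear_symbol)
qed

lemma
  shows integrable_kernel_sin: "integrable circle (\<lambda>u. kernel u * sin u)"
    and integral_kernel_sin: "(LINT u|circle. kernel u * sin u) = 0"
proof -
  show "integrable circle (\<lambda>u. kernel u * sin u)"
    by (rule integrable_kernel_bound_real[OF _ abs_sin_le_chord]) auto
  show "(LINT u|circle. kernel u * sin u) = 0"
    by (rule integral_circle_odd) (simp add: kernel_reflect sin_2pi_minus)
qed

text \<open>Evaluation commutes with the Bochner integral. The term of order zero is sin u, whose
  integral vanishes by oddness; this reflects that the disk is a solution.\<close>

lemma integral_ev_integrand:
  assumes g: "norm g \<le> 1 / 8"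
  shows "(LINT u|circle. kernel u *\<^sub>R ev (integrand u g) x) = ev (lin_op g + nonlin g) x"
proof -
  have integrand: "kernel u *\<^sub>R integrand u g = (kernel u * sin u) *\<^sub>R 1 + kernel u *\<^sub>R integrand_lin u g + kernel u *\<^sub>R integrand_rem u g" for u
    by (simp add: integrand_split scaleR_add_right)
  have i0: "integrable circle (\<lambda>u. (kernel u * sin u) *\<^sub>R (1 :: wiener))"
    by (intro integrable_scaleR_left integrable_kernel_sin)
  have i: "integrable circle (\<lambda>u. kernel u *\<^sub>R integrand u g)"
    unfolding integrand by (intro Bochner_Integration.integrable_add i0 integrable_integrand_lin integrable_integrand_rem[OF g])
  have "(LINT u|circle. kernel u *\<^sub>R integrand u g) = lin_op g + nonlin g"
    unfolding integrand lin_op_def nonlin_def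
    using i0 integrable_integrand_lin[of g] integrable_integrand_rem[OF g] integral_kernel_sin integrable_kernel_sin by simp
  then show "(LINT u|circle. kernel u *\<^sub>R ev (integrand u g) x) = ev (lin_op g + nonlin g) x"
    using integral_bounded_linear[OF bounded_linear_ev i, of x] by (simp add: ev_scaleR)
qed

end

section \<open>The equation in the Wiener algebra\<close>

lemma real_valued_derivative:
  assumes "\<And>x. (F has_vector_derivative F' x) (at x)" "\<And>x. Im (F x) = 0"
  shows "((\<lambda>x. Re (F x)) has_real_derivative Re (F' x)) (at x)" "Im (F' x) = 0"
proof -
  show "((\<lambda>x. Re (F x)) has_real_derivative Re (F' x)) (at x)"
    using bounded_linear.has_vector_derivative[OF bounded_linear_Re assms(1)]
    by (simp add: has_real_derivative_iff_has_vector_derivative)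
  have "((\<lambda>x. Im (F x)) has_vector_derivative Im (F' x)) (at x)"
    by (rule bounded_linear.has_vector_derivative[OF bounded_linear_Im assms(1)])
  then have "((\<lambda>x. 0 :: real) has_vector_derivative Im (F' x)) (at x)" by (simp add: assms(2))
  then show "Im (F' x) = 0"
    using vector_derivative_unique_at has_vector_derivative_const by blast
qed

lemma ev_periodic: "ev a (x + 2 * pi) = ev a x"
proof -
  have "cis (of_int n * (x + 2 * pi)) = cis (of_int n * x)" for n
    using cis_int_reflect[of n "- x"] by (simp add: add.commute)
  then show ?thesis by (simp only: ev_def)
qed

context gsqg
begin

definition radius :: "wiener \<Rightarrow> real \<Rightarrow> real" where "radius g x = 1 + Re (ev (pert g) x)"
definition radius' :: "wiener \<Rightarrow> real \<Rightarrow> real" where "radius' g x = Re (ev (dpert g) x)"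

definition integrand1 where "integrand1 R R' x u = sin u / D_fun R x (x - u) powr (\<alpha> / 2) * (R x * R (x - u) + R' x * R' (x - u))"
definition integrand2 where "integrand2 R R' x u = cos u / D_fun R x (x - u) powr (\<alpha> / 2) * (R' (x - u) - R' x)"
definition integrand3 where "integrand3 R R' x u = cos u / D_fun R x (x - u) powr (\<alpha> / 2) * (R x - R (x - u))"
definition integrand_sum where "integrand_sum R R' x u = integrand1 R R' x u + R x * integrand2 R R' x u + R' x * integrand3 R R' x u"

lemma pert_has_derivative: "(ev (pert g) has_vector_derivative ev (dpert g) x) (at x)"
  by (rule ev_has_vector_derivative) (simp add: coef_ops symbol_def symbol_deriv_def)

lemma ev_pert_shift: "ev (pert_shift u g) x = ev (pert g) (x - u)" and ev_dpert_shift: "ev (dpert_shift u g) x = ev (dpert g) (x - u)"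
  unfolding pert_shift_def pert_def dpert_shift_def dpert_def by (rule ev_multiplier_shift[OF symbol_le] ev_multiplier_shift[OF symbol_deriv_le])+

text \<open>Pointwise values of the increment do vanish linearly at the diagonal, because the
  exponential weight absorbs the extra factor |n|. This yields absolute convergence of the integral
  in F2 at each x.\<close>

lemma norm_ev_incr_le: "cmod (ev (incr u g) x) \<le> \<bar>chord u\<bar> * norm g"
proof (rule norm_ev_series_le)
  show "((\<lambda>n. symbol_deriv n * (cis (- of_int n * u) - 1) * coef g n * cis (of_int n * x)) has_sum ev (incr u g) x) UNIV"
    unfolding incr_def by (rule ev_multiplier_has_sum[OF symbol_incr_le])
  fix n
  have "cmod (symbol_deriv n) * cmod (cis (- of_int n * u) - 1) \<le> 1 * (\<bar>of_int n\<bar> * \<bar>chord u\<bar>)"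
    by (intro mult_mono symbol_deriv_le norm_cis_multiple_le) auto
  also have "\<dots> \<le> weight n * \<bar>chord u\<bar>" using abs_le_weight[of n] by (auto intro: mult_right_mono)
  finally show "cmod (symbol_deriv n * (cis (- of_int n * u) - 1) * coef g n * cis (of_int n * x)) \<le> \<bar>chord u\<bar> * (cmod (coef g n) * weight n)"
    using mult_right_mono[of "cmod (symbol_deriv n) * cmod (cis (- of_int n * u) - 1)" "weight n * \<bar>chord u\<bar>" "cmod (coef g n)"]
    by (simp add: norm_mult mult_ac)
qed

section \<open>Identification with F for a small real perturbation\<close>

context
  fixes g :: wiener
  assumes small: "norm g \<le> 1 / 8" and real: "\<And>x. Im (ev (pert g) x) = 0"
begin

lemma radius'_deriv: "(radius g has_real_derivative radius' g x) (at x)" and real': "Im (ev (dpert g) x) = 0"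
proof -
  show "Im (ev (dpert g) x) = 0" by (rule real_valued_derivative(2)[OF pert_has_derivative real])
  show "(radius g has_real_derivative radius' g x) (at x)"
    unfolding radius_def[abs_def] radius'_def
    using DERIV_add[OF DERIV_const[of 1] real_valued_derivative(1)[OF pert_has_derivative real, of x]]
    by simp
qed

lemma deriv_radius: "deriv (radius g) x = radius' g x"
  by (rule DERIV_imp_deriv) (rule radius'_deriv)

lemma ev_pert: "ev (pert g) x = of_real (radius g x - 1)" and ev_dpert: "ev (dpert g) x = of_real (radius' g x)"
  by (simp_all add: complex_eq_iff radius_def radius'_def real real')

lemma radius_bounds: "\<bar>radius g x - 1\<bar> \<le> 1 / 8" "\<bar>radius' g x\<bar> \<le> 1 / 8"
proof -
  have "cmod (ev (pert g) x) \<le> 1 / 8" "cmod (ev (dpert g) x) \<le> 1 / 8"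
    using norm_ev_le[of "pert g" x] norm_ev_le[of "dpert g" x] norm_basic(1,2)[of g] small by linarith+
  then show "\<bar>radius g x - 1\<bar> \<le> 1 / 8" "\<bar>radius' g x\<bar> \<le> 1 / 8" by (simp_all only: ev_pert ev_dpert norm_of_real)
qed

lemma radius_pos: "radius g x > 0"
  using radius_bounds(1)[of x] by linarith

lemma radius_periodic: "radius g (x + 2 * pi) = radius g x" and radius'_periodic: "radius' g (x + 2 * pi) = radius' g x"
  by (simp_all add: radius_def radius'_def ev_periodic)

text \<open>With 1 + P defined as D over the squared chord, P is the value of
  \<open>dist_pert u g\<close>, and |P| \<le> 1/2 keeps the base at least 1/2. So the algebraic
  power evaluates to the real one, and (1/2) to the power -\<alpha> / 2 is at most 2.\<close>

lemma kernel_D: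
  assumes u: "u \<in> {0<..<2 * pi}"
  shows "kernel u *\<^sub>R ev (dist_power u g) x = of_real (1 / D_fun (radius g) x (x - u) powr (\<alpha> / 2))"
    and "1 / D_fun (radius g) x (x - u) powr (\<alpha> / 2) \<le> 2 * kernel u"
proof -
  define P where "P = (D_fun (radius g) x (x - u)) / (chord u)\<^sup>2 - 1"
  have chord: "chord u > 0" by (rule chord_pos[OF u])
  have "chord u *\<^sub>R ev (quot u g) x = ev (pert g) x - ev (pert_shift u g) x"
    using arg_cong[OF chord_quot, of "\<lambda>a. ev a x" u g] by (simp only: ev_scaleR ev_diff)
  then have quot: "ev (quot u g) x = of_real ((radius g x - radius g (x - u)) / chord u)"
    using chord by (simp add: ev_pert_shift ev_pert scaleR_conv_of_real field_simps)
  have D: "D_fun (radius g) x (x - u) = (radius g x - radius g (x - u))\<^sup>2 + radius g x * radius g (x - u) * (chord u)\<^sup>2"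
    by (simp add: D_fun_def chord_def power_mult_distrib)
  have P: "ev (dist_pert u g) x = of_real P"
  proof -
    have "P = (radius g x - 1) + (radius g (x - u) - 1) + ((radius g x - 1) * (radius g (x - u) - 1) +
         (radius g x - radius g (x - u)) / chord u * ((radius g x - radius g (x - u)) / chord u))"
      using chord unfolding P_def D by (simp add: field_simps power2_eq_square)
    then show ?thesis by (simp add: dist_pert_def ev_add ev_mult quot ev_pert_shift ev_pert)
  qed
  have "\<bar>P\<bar> \<le> 1 / 2"
    using order_trans[OF norm_ev_le[of "dist_pert u g" x] norm_dist_pert_le[OF small]] by (simp add: P)
  then have P1: "1 + P \<ge> 1 / 2" by (auto simp: abs_le_iff)
  have dist_power: "ev (dist_power u g) x = of_real ((1 + P) powr (- \<alpha> / 2))"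
    unfolding dist_power_def
    by (rule ev_binom_ser[OF alpha_half _ P]) (use norm_dist_pert_le[OF small, of u] in linarith)
  have "D_fun (radius g) x (x - u) = (chord u)\<^sup>2 * (1 + P)" using chord by (simp add: P_def)
  then have Dp: "D_fun (radius g) x (x - u) powr (\<alpha> / 2) = chord u powr \<alpha> * (1 + P) powr (\<alpha> / 2)"
  proof -
    have "(chord u)\<^sup>2 = chord u powr 2" using chord by simp
    then have "((chord u)\<^sup>2) powr (\<alpha> / 2) = chord u powr \<alpha>" by (simp only: powr_powr) simp
    then show ?thesis
      using P1 by (simp only: \<open>D_fun (radius g) x (x - u) = (chord u)\<^sup>2 * (1 + P)\<close>) (subst powr_mult, auto)
  qed
  then have e: "1 / D_fun (radius g) x (x - u) powr (\<alpha> / 2) = kernel u * (1 + P) powr (- \<alpha> / 2)"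
  proof -
    have P2: "(1 + P) powr (- \<alpha> / 2) = inverse ((1 + P) powr (\<alpha> / 2))"
      using powr_minus[of "1 + P" "\<alpha> / 2"] by simp
    show ?thesis unfolding Dp P2 kernel_def powr_minus[of "chord u"]
      by (simp only: inverse_eq_divide [symmetric] inverse_mult_distrib)
  qed
  show "kernel u *\<^sub>R ev (dist_power u g) x = of_real (1 / D_fun (radius g) x (x - u) powr (\<alpha> / 2))"
    unfolding e dist_power by (simp add: scaleR_conv_of_real)
  have "(1 + P) powr (- \<alpha> / 2) \<le> (1 / 2) powr (- \<alpha> / 2)"
    using P1 alpha by (intro powr_mono2') auto
  also have "\<dots> \<le> (1 / 2) powr (- 1)" using alpha by (intro powr_mono') auto
  finally show "1 / D_fun (radius g) x (x - u) powr (\<alpha> / 2) \<le> 2 * kernel u"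
    unfolding e using mult_left_mono[OF _ kernel_nonneg[of u], of "(1 + P) powr (- \<alpha> / 2)" 2]
    by (simp add: powr_minus mult.commute)
qed

lemma ev_integrand:
  assumes u: "u \<in> {0<..<2 * pi}"
  shows "kernel u *\<^sub>R ev (integrand u g) x = of_real (integrand_sum (radius g) (radius' g) x u)"
proof -
  define E where "E = 1 / D_fun (radius g) x (x - u) powr (\<alpha> / 2)"
  let ?A = "sin u * (radius g x * radius g (x - u) + radius' g x * radius' g (x - u))
     + cos u * (radius g x * (radius' g (x - u) - radius' g x) + radius' g x * (radius g x - radius g (x - u)))"
  have "ev (integrand u g) x = of_real ?A * ev (dist_power u g) x"
    unfolding integrand_def prod_pert_def incr_eq ev_add ev_scaleR ev_mult ev_diff ev_one ev_pert_shift ev_dpert_shift ev_pert ev_dpert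
    by (simp add: scaleR_conv_of_real algebra_simps)
  then have "kernel u *\<^sub>R ev (integrand u g) x = of_real ?A * (kernel u *\<^sub>R ev (dist_power u g) x)" by simp
  also have "\<dots> = of_real (?A * E)" unfolding kernel_D(1)[OF u] E_def by simp
  also have "?A * E = integrand_sum (radius g) (radius' g) x u"
    by (simp add: integrand_sum_def integrand1_def integrand2_def integrand3_def E_def algebra_simps add_divide_distrib diff_divide_distrib)
  finally show ?thesis .
qed

lemma R_measurable [measurable]: "radius g \<in> borel_measurable borel" "radius' g \<in> borel_measurable borel"
  unfolding radius_def[abs_def] radius'_def[abs_def]
  by (intro borel_measurable_continuous_onI continuous_intros)+

lemma integrable_over_D:
  assumes m: "G \<in> borel_measurable borel" and le: "\<And>u. u \<in> {0<..<2 * pi} \<Longrightarrow> \<bar>G u\<bar> \<le> B * chord u"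
  shows "integrable circle (\<lambda>u. G u / D_fun (radius g) x (x - u) powr (\<alpha> / 2))"
proof (rule Bochner_Integration.integrable_bound)
  show "integrable circle (\<lambda>u. 2 * B * (kernel u * chord u))" by (intro integrable_mult_right integrable_kernel_chord)
  show "(\<lambda>u. G u / D_fun (radius g) x (x - u) powr (\<alpha> / 2)) \<in> borel_measurable circle"
    unfolding D_fun_def by (rule borel_measurable_circle) (use m in measurable)
  have "\<bar>G u / D_fun (radius g) x (x - u) powr (\<alpha> / 2)\<bar> \<le> \<bar>2 * B * (kernel u * chord u)\<bar>" if "u \<in> space circle" for u
  proof -
    have u: "u \<in> {0<..<2 * pi}" using that by (simp add: space_circle)
    have "\<bar>G u\<bar> * (1 / D_fun (radius g) x (x - u) powr (\<alpha> / 2)) \<le> (B * chord u) * (2 * kernel u)"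
      using kernel_D(2)[OF u] le[OF u] by (intro mult_mono) auto
    then have "\<bar>G u / D_fun (radius g) x (x - u) powr (\<alpha> / 2)\<bar> \<le> 2 * B * (kernel u * chord u)"
      by (simp add: abs_mult mult_ac)
    then show ?thesis by linarith
  qed
  then show "AE u in circle. norm (G u / D_fun (radius g) x (x - u) powr (\<alpha> / 2)) \<le> norm (2 * B * (kernel u * chord u))"
    by (intro AE_I2) simp
qed

text \<open>F is defined by three separate integrals, so they can be merged only after each is known
  to converge. The chord factor comes from sin u, from the increment of R' and from the difference
  quotient of R respectively.\<close>

lemma integrable_integrand_sum:
  "integrable circle (integrand1 (radius g) (radius' g) x)" "integrable circle (integrand2 (radius g) (radius' g) x)" "integrable circle (integrand3 (radius g) (radius' g) x)"
proof -
  have R: "\<bar>radius g y\<bar> \<le> 2" "\<bar>radius' g y\<bar> \<le> 2" for y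
    using radius_bounds[of y] by linarith+
  have "integrable circle (\<lambda>u. (sin u * (radius g x * radius g (x - u) + radius' g x * radius' g (x - u))) / D_fun (radius g) x (x - u) powr (\<alpha> / 2))"
  proof (rule integrable_over_D[of _ 8])
    fix u assume u: "u \<in> {0<..<2 * pi}"
    have "\<bar>radius g x * radius g (x - u) + radius' g x * radius' g (x - u)\<bar> \<le> 2 * 2 + 2 * 2"
      by (rule order_trans[OF abs_triangle_ineq]) (unfold abs_mult, intro add_mono mult_mono R, auto)
    then have "\<bar>sin u\<bar> * \<bar>radius g x * radius g (x - u) + radius' g x * radius' g (x - u)\<bar> \<le> (1 * chord u) * 8"
      using chord_pos[OF u] by (intro mult_mono abs_sin_le_chord u) auto
    then show "\<bar>sin u * (radius g x * radius g (x - u) + radius' g x * radius' g (x - u))\<bar> \<le> 8 * chord u" by (simp add: abs_mult)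
  qed measurable
  then show "integrable circle (integrand1 (radius g) (radius' g) x)" by (simp add: integrand1_def[abs_def])
  have "integrable circle (\<lambda>u. (cos u * (radius' g (x - u) - radius' g x)) / D_fun (radius g) x (x - u) powr (\<alpha> / 2))"
  proof (rule integrable_over_D[of _ 1])
    fix u assume u: "u \<in> {0<..<2 * pi}"
    have "ev (incr u g) x = of_real (radius' g (x - u) - radius' g x)" by (simp add: incr_eq ev_diff ev_dpert_shift ev_dpert)
    then have "\<bar>radius' g (x - u) - radius' g x\<bar> \<le> \<bar>chord u\<bar> * norm g" using norm_ev_incr_le[of u g x] by (simp only: norm_of_real)
    also have "\<dots> \<le> chord u" using chord_pos[OF u] small mult_left_mono[of "norm g" 1 "chord u"] by simp
    finally have "\<bar>cos u\<bar> * \<bar>radius' g (x - u) - radius' g x\<bar> \<le> 1 * chord u" by (intro mult_mono) auto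
    then show "\<bar>cos u * (radius' g (x - u) - radius' g x)\<bar> \<le> 1 * chord u" by (simp add: abs_mult)
  qed measurable
  then show "integrable circle (integrand2 (radius g) (radius' g) x)" by (simp add: integrand2_def[abs_def])
  have "integrable circle (\<lambda>u. (cos u * (radius g x - radius g (x - u))) / D_fun (radius g) x (x - u) powr (\<alpha> / 2))"
  proof (rule integrable_over_D[of _ 1])
    fix u assume u: "u \<in> {0<..<2 * pi}"
    have "of_real (radius g x - radius g (x - u)) = ev (chord u *\<^sub>R quot u g) x" by (simp add: chord_quot ev_diff ev_pert_shift ev_pert)
    also have "\<dots> = chord u *\<^sub>R ev (quot u g) x" by (rule ev_scaleR)
    finally have "\<bar>radius g x - radius g (x - u)\<bar> = \<bar>chord u\<bar> * cmod (ev (quot u g) x)"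
      by (metis norm_of_real norm_scaleR)
    also have "\<dots> \<le> \<bar>chord u\<bar> * 1"
      using norm_ev_le[of "quot u g" x] norm_basic(5)[of u g] small by (intro mult_left_mono) linarith+
    finally have "\<bar>cos u\<bar> * \<bar>radius g x - radius g (x - u)\<bar> \<le> 1 * chord u" 
      using chord_pos[OF u] by (intro mult_mono) auto
    then show "\<bar>cos u * (radius g x - radius g (x - u))\<bar> \<le> 1 * chord u" by (simp add: abs_mult)
  qed measurable
  then show "integrable circle (integrand3 (radius g) (radius' g) x)" by (simp add: integrand3_def[abs_def])
qed

lemma integral_integrand_sum: "of_real (integral\<^sup>L circle (integrand_sum (radius g) (radius' g) x)) = ev (lin_op g + nonlin g) x"
proof -
  have "of_real (integral\<^sup>L circle (integrand_sum (radius g) (radius' g) x)) = (LINT u|circle. complex_of_real (integrand_sum (radius g) (radius' g) x u))"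
    by (rule integral_complex_of_real[symmetric])
  also have "\<dots> = (LINT u|circle. kernel u *\<^sub>R ev (integrand u g) x)"
    by (intro Bochner_Integration.integral_cong refl) (simp add: ev_integrand space_circle)
  also have "\<dots> = ev (lin_op g + nonlin g) x" by (rule integral_ev_integrand[OF small])
  finally show ?thesis .
qed

lemma D_fun_periodic: "D_fun (radius g) x (x - (u + 2 * pi)) = D_fun (radius g) x (x - u)"
  "radius g (x - (u + 2 * pi)) = radius g (x - u)" "radius' g (x - (u + 2 * pi)) = radius' g (x - u)"
proof -
  show R: "radius g (x - (u + 2 * pi)) = radius g (x - u)" "radius' g (x - (u + 2 * pi)) = radius' g (x - u)"
    using radius_periodic[of "x - (u + 2 * pi)"] radius'_periodic[of "x - (u + 2 * pi)"] by (simp_all add: algebra_simps)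
  have "sin ((u + 2 * pi) / 2) = - sin (u / 2)" by (simp add: add_divide_distrib)
  then show "D_fun (radius g) x (x - (u + 2 * pi)) = D_fun (radius g) x (x - u)" unfolding D_fun_def R by simp
qed

lemma F_gsqg_eq:
  "of_real (radius g x * F_gsqg \<alpha> \<Omega> (radius g) x)
     = ev (\<Omega> *\<^sub>R ((1 + pert g) * dpert g) - C_gsqg \<alpha> *\<^sub>R (lin_op g + nonlin g)) x"
proof -
  have 1: "F1 \<alpha> (radius g) x = C_gsqg \<alpha> / radius g x * integral\<^sup>L circle (integrand1 (radius g) (radius' g) x)"
  proof -
    have "(LINT y:{-pi..pi}|lborel. integrand1 (radius g) (radius' g) x (x - y)) = integral\<^sup>L circle (integrand1 (radius g) (radius' g) x)"
      by (rule set_integral_convolution_periodic[OF _ integrable_integrand_sum(1)]) (simp only: integrand1_def D_fun_periodic sin_periodic)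
    then show ?thesis by (simp add: F1_def integrand1_def deriv_radius)
  qed
  have 2: "F2 \<alpha> (radius g) x = C_gsqg \<alpha> * integral\<^sup>L circle (integrand2 (radius g) (radius' g) x)"
  proof -
    have "(LINT y:{-pi..pi}|lborel. integrand2 (radius g) (radius' g) x (x - y)) = integral\<^sup>L circle (integrand2 (radius g) (radius' g) x)"
      by (rule set_integral_convolution_periodic[OF _ integrable_integrand_sum(2)]) (simp only: integrand2_def D_fun_periodic cos_periodic)
    then show ?thesis by (simp add: F2_def integrand2_def deriv_radius)
  qed
  have 3: "F3 \<alpha> (radius g) x = C_gsqg \<alpha> * (radius' g x / radius g x) * integral\<^sup>L circle (integrand3 (radius g) (radius' g) x)"
  proof -
    have "(LINT y:{-pi..pi}|lborel. integrand3 (radius g) (radius' g) x (x - y)) = integral\<^sup>L circle (integrand3 (radius g) (radius' g) x)"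
      by (rule set_integral_convolution_periodic[OF _ integrable_integrand_sum(3)]) (simp only: integrand3_def D_fun_periodic cos_periodic)
    then show ?thesis by (simp add: F3_def integrand3_def deriv_radius)
  qed
  have "integral\<^sup>L circle (integrand_sum (radius g) (radius' g) x) = integral\<^sup>L circle (integrand1 (radius g) (radius' g) x)
     + radius g x * integral\<^sup>L circle (integrand2 (radius g) (radius' g) x) + radius' g x * integral\<^sup>L circle (integrand3 (radius g) (radius' g) x)"
    unfolding integrand_sum_def using integrable_integrand_sum[of x] by simp
  then have "radius g x * F_gsqg \<alpha> \<Omega> (radius g) x = \<Omega> * (radius g x * radius' g x) - C_gsqg \<alpha> * integral\<^sup>L circle (integrand_sum (radius g) (radius' g) x)"
    unfolding F_gsqg_def 1 2 3 deriv_radius using radius_pos[of x] by (simp add: field_simps)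
  then have "complex_of_real (radius g x * F_gsqg \<alpha> \<Omega> (radius g) x)
     = of_real (\<Omega> * (radius g x * radius' g x)) - of_real (C_gsqg \<alpha>) * of_real (integral\<^sup>L circle (integrand_sum (radius g) (radius' g) x))"
    by simp
  also have "\<dots> = ev (\<Omega> *\<^sub>R ((1 + pert g) * dpert g) - C_gsqg \<alpha> *\<^sub>R (lin_op g + nonlin g)) x"
    unfolding integral_integrand_sum ev_diff ev_scaleR ev_mult ev_add ev_one ev_pert ev_dpert by (simp add: scaleR_conv_of_real)
  finally show ?thesis .
qed

end

end

section \<open>Symmetry classes and Sobolev norms\<close>

lemma ev_cnj: "(\<And>n. coef b n = cnj (coef a (- n))) \<Longrightarrow> ev b x = cnj (ev a x)"
proof -
  assume b: "\<And>n. coef b n = cnj (coef a (- n))"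
  have "((\<lambda>n. coef b n * cis (of_int n * x)) has_sum cnj (ev a x)) UNIV"
    by (rule has_sum_reindex_bij_witness[of _ uminus uminus, THEN iffD1, OF _ _ _ _ _ refl
          has_sum_cnj_iff[THEN iffD2, OF ev_has_sum[of a x]]])
       (simp_all add: b cis_cnj)
  then show ?thesis by (rule has_sum_unique[OF ev_has_sum])
qed

lemma ev_neg: "(\<And>n. coef b n = coef a (- n)) \<Longrightarrow> ev b x = ev a (- x)"
proof -
  assume b: "\<And>n. coef b n = coef a (- n)"
  have "((\<lambda>n. coef b n * cis (of_int n * x)) has_sum ev a (- x)) UNIV"
    by (rule has_sum_reindex_bij_witness[of _ uminus uminus, THEN iffD1, OF _ _ _ _ _ refl
          ev_has_sum[of a "- x"]])
       (simp_all add: b)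
  then show ?thesis by (rule has_sum_unique[OF ev_has_sum])
qed

lemma ev_translate: "(\<And>n. coef b n = cis (of_int n * t) * coef a n) \<Longrightarrow> ev b x = ev a (x + t)"
proof -
  assume b: "\<And>n. coef b n = cis (of_int n * t) * coef a n"
  have "coef a n * cis (of_int n * (x + t)) = coef b n * cis (of_int n * x)" for n
  proof -
    have "cis (of_int n * (x + t)) = cis (of_int n * t) * cis (of_int n * x)"
      by (simp add: cis_mult algebra_simps)
    then show ?thesis by (simp add: b)
  qed
  then have "((\<lambda>n. coef b n * cis (of_int n * x)) has_sum ev a (x + t)) UNIV"
    using ev_has_sum[of a "x + t"] by (simp only:)
  then show ?thesis by (rule has_sum_unique[OF ev_has_sum])
qed

lemma reflected_element: "\<exists>b. \<forall>n. coef b n = coef a (- n)"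
proof -
  have "(\<lambda>n. cmod (coef a (- n)) * weight n) summable_on UNIV"
    using summable_on_reindex_bij_witness[of UNIV uminus uminus UNIV "\<lambda>n. cmod (coef a n) * weight n"
        "\<lambda>n. cmod (coef a (- n)) * weight n"] coef_summable[of a] by (simp add: weight_def)
  from coef_Wiener[OF this] show ?thesis by metis
qed

lemma conjugate_element: "\<exists>b. \<forall>n. coef b n = cnj (coef a (- n))"
proof -
  obtain c where c: "\<And>n. coef c n = coef a (- n)" using reflected_element by blast
  have "(\<lambda>n. cmod (cnj (coef c n)) * weight n) summable_on UNIV" using coef_summable[of c] by simp
  from coef_Wiener[OF this] show ?thesis using c by metis
qed

lemma cis_multiple_eq_1:
  assumes "cis (of_int n * (2 * pi / real m)) = 1" "m \<ge> 1" shows "int m dvd n"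
proof -
  have "sin (of_int n * (2 * pi / real m)) = 0" "cos (of_int n * (2 * pi / real m)) = 1"
    using assms(1) by (auto simp: complex_eq_iff)
  then obtain j :: int where "of_int n * (2 * pi / real m) = of_int j * 2 * pi"
    using cos_one_2pi_int by blast
  then have "real_of_int n = of_int j * real m" using assms(2) by (simp add: field_simps)
  then have "n = j * int m" by (metis of_int_eq_iff of_int_mult of_int_of_nat_eq)
  then show ?thesis by simp
qed

text \<open>On coefficients: real odd functions here and real even ones in \<open>evenW\<close>,
  both of period 2 pi / m. Oddness forces the mode 0 to vanish, where the linearisation has no
  inverse.\<close>

definition oddV :: "nat \<Rightarrow> wiener set" where
  "oddV m = {a. \<forall>n. Re (coef a n) = 0 \<and> coef a (- n) = - coef a n \<and> (\<not> int m dvd n \<longrightarrow> coef a n = 0)}"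

definition evenW :: "nat \<Rightarrow> wiener set" where
  "evenW m = {a. \<forall>n. Im (coef a n) = 0 \<and> coef a (- n) = coef a n \<and> (\<not> int m dvd n \<longrightarrow> coef a n = 0)}"

text \<open>The nonlinear term is accessible only through its values. Injectivity of
  \<open>ev\<close>, applied to the conjugated, reflected and translated elements, turns each
  symmetry of the values into one of the coefficients.\<close>

lemma oddV_I:
  assumes m: "m \<ge> 1" and "\<And>x. Im (ev a x) = 0" "\<And>x. ev a (- x) = - ev a x" "\<And>x. ev a (x + 2 * pi / real m) = ev a x"
  shows "a \<in> oddV m"
proof -
  obtain b where b: "\<And>n. coef b n = cnj (coef a (- n))" using conjugate_element by blast
  have "b = a"
    by (rule ev_inject) (use assms(2) in \<open>simp add: ev_cnj[OF b] complex_eq_iff\<close>)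
  then have 1: "coef a n = cnj (coef a (- n))" for n using b by metis
  obtain c where c: "\<And>n. coef c n = coef a (- n)" using reflected_element by blast
  have "c = - a"
    by (rule ev_inject) (simp add: ev_neg[OF c] assms(3) ev_minus)
  then have 2: "coef a (- n) = - coef a n" for n using c by (metis coef_minus)
  have Re: "Re (coef a n) = 0" for n
    using arg_cong[OF 1[of n], of Re] by (simp add: 2)
  define t where "t = 2 * pi / real m"
  have cb: "cmod (cis (of_int n * t)) \<le> 1" for n by simp
  have "multiplier (\<lambda>n. cis (of_int n * t)) a = a"
  proof (rule ev_inject)
    fix x
    have "ev (multiplier (\<lambda>n. cis (of_int n * t)) a) x = ev a (x + t)"
      by (rule ev_translate) (rule coef_multiplier[OF cb])
    then show "ev (multiplier (\<lambda>n. cis (of_int n * t)) a) x = ev a x" by (simp add: t_def assms(4))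
  qed
  then have 3: "cis (of_int n * t) * coef a n = coef a n" for n
    using coef_multiplier[of "\<lambda>n. cis (of_int n * t)" 1 a n] by simp
  have "coef a n = 0" if "\<not> int m dvd n" for n
    using 3[of n] cis_multiple_eq_1[of n m] that m by (auto simp: t_def)
  then show ?thesis by (simp add: oddV_def Re 2)
qed

lemma cis_dvd:
  assumes "int m dvd n" "m \<ge> 1" shows "cis (of_int n * (2 * pi / real m)) = 1"
proof -
  obtain j where "n = int m * j" using assms(1) by blast
  then have "of_int n * (2 * pi / real m) = 2 * pi * of_int j" using assms(2) by simp
  then show ?thesis using cis_multiple_2pi[of "of_int j"] by simp
qed

lemma evenW_ev:
  assumes a: "a \<in> evenW m" and m: "m \<ge> 1"
  shows "Im (ev a x) = 0" "ev a (- x) = ev a x" "ev a (x + 2 * pi / real m) = ev a x"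
proof -
  have 1: "coef a n = coef a (- n)" "Im (coef a n) = 0" "\<not> int m dvd n \<Longrightarrow> coef a n = 0" for n
    using a by (auto simp: evenW_def)
  then have 2: "coef a n = cnj (coef a (- n))" for n by (metis complex_cnj_cancel_iff complex_eq_iff cnj.sel neg_equal_zero)
  show "Im (ev a x) = 0" using ev_cnj[of a a x, OF 2] by (simp add: complex_eq_iff)
  show "ev a (- x) = ev a x" using ev_neg[of a a x, OF 1(1)] by simp
  have "coef a n = cis (of_int n * (2 * pi / real m)) * coef a n" for n
    using 1(3)[of n] cis_dvd[of m n] m by (cases "int m dvd n") auto
  from ev_translate[of a _ a x, OF this] show "ev a (x + 2 * pi / real m) = ev a x" by simp
qed

lemma oddV_ev:
  assumes a: "a \<in> oddV m" and m: "m \<ge> 1"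
  shows "Im (ev a x) = 0" "ev a (- x) = - ev a x" "ev a (x + 2 * pi / real m) = ev a x"
proof -
  have 1: "coef (- a) n = coef a (- n)" "Re (coef a n) = 0" "\<not> int m dvd n \<Longrightarrow> coef a n = 0" for n
    using a by (auto simp: oddV_def coef_minus)
  then have 2: "coef a n = cnj (coef a (- n))" for n
    using 1(1)[of n, symmetric] 1(2)[of n] by (simp add: coef_minus complex_eq_iff)
  show "Im (ev a x) = 0" using ev_cnj[of a a x, OF 2] by (simp add: complex_eq_iff)
  show "ev a (- x) = - ev a x" using ev_neg[of "- a" a x, OF 1(1)] by (simp add: ev_minus)
  have "coef a n = cis (of_int n * (2 * pi / real m)) * coef a n" for n
    using 1(3)[of n] cis_dvd[of m n] m by (cases "int m dvd n") auto
  from ev_translate[of a _ a x, OF this] show "ev a (x + 2 * pi / real m) = ev a x" by simp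
qed

lemma closed_oddV: "closed (oddV m)"
proof -
  have c: "continuous_on UNIV (\<lambda>a. coef a n)" for n
    by (intro linear_continuous_on bounded_linear_coef)
  have "oddV m = (\<Inter>n. {a. Re (coef a n) = 0} \<inter> {a. coef a (- n) = - coef a n} \<inter> {a. \<not> int m dvd n \<longrightarrow> coef a n = 0})"
    by (auto simp: oddV_def)
  moreover have "closed {a. \<not> int m dvd n \<longrightarrow> coef a n = 0}" for n
    by (cases "int m dvd n") (auto intro!: closed_Collect_eq c continuous_intros)
  ultimately show ?thesis
    by (auto intro!: closed_INT closed_Int closed_Collect_eq continuous_intros c)
qed

lemma oddV_closed_ops:
  "0 \<in> oddV m" "a \<in> oddV m \<Longrightarrow> b \<in> oddV m \<Longrightarrow> a - b \<in> oddV m" "a \<in> oddV m \<Longrightarrow> r *\<^sub>R a \<in> oddV m"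
  "a \<in> oddV m \<Longrightarrow> - a \<in> oddV m"
  by (auto simp: oddV_def coef_zero coef_diff coef_scaleR coef_minus)

section \<open>Comparison with Sobolev norms and cosine series\<close>

lemma sobolev_weight_bounded: "\<exists>C>0. \<forall>n::int. (1 + (of_int n)\<^sup>2) ^ k \<le> C * (weight n)\<^sup>2"
proof -
  have "(\<lambda>n :: nat. (1 + (real n)\<^sup>2) ^ k / 4 ^ n) \<longlonglongrightarrow> 0" by real_asymp
  then have "Bseq (\<lambda>n :: nat. (1 + (real n)\<^sup>2) ^ k / 4 ^ n)" by (intro convergent_imp_Bseq convergentI)
  then obtain C where C: "C > 0" "\<And>n. norm ((1 + (real n)\<^sup>2) ^ k / 4 ^ n) \<le> C" by (auto elim!: BseqE)
  have "(1 + (of_int n)\<^sup>2) ^ k \<le> C * (weight n)\<^sup>2" for n :: int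
  proof -
    have "(weight n)\<^sup>2 = 4 ^ nat \<bar>n\<bar>" by (simp add: weight_def power2_eq_square flip: power_mult_distrib)
    then show ?thesis using C(2)[of "nat \<bar>n\<bar>"] by (simp add: field_simps)
  qed
  then show ?thesis using C(1) by blast
qed

lemma fourier_coeff_ev:
  assumes "\<And>x. Im (ev a x) = 0"
  shows "fourier_coeff (\<lambda>x. Re (ev a x)) n = coef a n"
proof -
  have "complex_of_real (Re (ev a x)) = ev a x" for x by (simp add: complex_eq_iff assms)
  moreover have "exp (- \<i> * of_int n * of_real x) = cis (- of_int n * x)" for x
    by (simp add: cis_conv_exp mult.assoc)
  ultimately show ?thesis unfolding fourier_coeff_def coef_eq_integral[of a n] by (simp only:)
qed

text \<open>Of the two factors \<open>cmod (coef a n) * weight n\<close> one is bounded by the norm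
  and the other is summed, so the weighted sum of absolute values controls the Sobolev sum of
  squares.\<close>

lemma sobolev_series:
  assumes C: "\<And>n::int. (1 + (of_int n)\<^sup>2) ^ k \<le> C * (weight n)\<^sup>2"
  shows "(\<lambda>n::int. (1 + (of_int n)\<^sup>2) ^ k * (cmod (coef a n))\<^sup>2) summable_on UNIV"
    and "(\<Sum>\<^sub>\<infinity>n::int. (1 + (of_int n)\<^sup>2) ^ k * (cmod (coef a n))\<^sup>2) \<le> C * (norm a)\<^sup>2"
proof -
  have le: "(1 + (of_int n)\<^sup>2) ^ k * (cmod (coef a n))\<^sup>2 \<le> C * norm a * (cmod (coef a n) * weight n)" for n
  proof -
    have C0: "C \<ge> 0" using C[of 0] by (simp add: weight_def)
    have "(1 + (of_int n)\<^sup>2) ^ k * (cmod (coef a n))\<^sup>2 \<le> (C * (weight n)\<^sup>2) * (cmod (coef a n))\<^sup>2"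
      by (intro mult_right_mono C) auto
    also have "\<dots> = C * ((cmod (coef a n) * weight n) * (cmod (coef a n) * weight n))" by (simp add: power2_eq_square)
    also have "\<dots> \<le> C * (norm a * (cmod (coef a n) * weight n))"
      by (intro mult_left_mono mult_right_mono norm_coef_weight_le C0) auto
    finally show ?thesis by simp
  qed
  have s: "(\<lambda>n. C * norm a * (cmod (coef a n) * weight n)) summable_on UNIV"
    by (intro summable_on_cmult_right coef_summable)
  show 1: "(\<lambda>n::int. (1 + (of_int n)\<^sup>2) ^ k * (cmod (coef a n))\<^sup>2) summable_on UNIV"
    by (rule summable_on_comparison_test[OF s le]) auto
  have "(\<Sum>\<^sub>\<infinity>n::int. (1 + (of_int n)\<^sup>2) ^ k * (cmod (coef a n))\<^sup>2) \<le> (\<Sum>\<^sub>\<infinity>n. C * norm a * (cmod (coef a n) * weight n))"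
    by (rule infsum_mono[OF 1 s le])
  also have "\<dots> = C * (norm a)\<^sup>2"
    by (simp add: infsum_cmult_right coef_summable norm_wiener_def power2_eq_square)
  finally show "(\<Sum>\<^sub>\<infinity>n::int. (1 + (of_int n)\<^sup>2) ^ k * (cmod (coef a n))\<^sup>2) \<le> C * (norm a)\<^sup>2" .
qed

lemma sobolev_norm_ev_le: "\<exists>C\<ge>0. \<forall>a. (\<forall>x. Im (ev a x) = 0) \<longrightarrow> sobolev_norm k (\<lambda>x. Re (ev a x)) \<le> C * norm a"
proof -
  obtain C where C: "C > 0" "\<And>n::int. (1 + (of_int n)\<^sup>2) ^ k \<le> C * (weight n)\<^sup>2"
    using sobolev_weight_bounded by blast
  have "sobolev_norm k (\<lambda>x. Re (ev a x)) \<le> sqrt C * norm a" if "\<forall>x. Im (ev a x) = 0" for a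
  proof -
    have "sobolev_norm k (\<lambda>x. Re (ev a x)) \<le> sqrt (C * (norm a)\<^sup>2)"
      unfolding sobolev_norm_def using that sobolev_series(2)[OF C(2)]
      by (simp add: fourier_coeff_ev del: real_sqrt_mult)
    then show ?thesis by (simp add: real_sqrt_mult)
  qed
  then show ?thesis using C(1) by (intro exI[of _ "sqrt C"]) auto
qed

lemma sobolev_norm_nonneg: "0 \<le> sobolev_norm k f"
  unfolding sobolev_norm_def by (auto intro!: infsum_nonneg)

lemma X_space_ev:
  assumes a: "a \<in> evenW m" and a0: "coef a 0 = 0" and m: "m \<ge> 1"
  shows "(\<lambda>x. Re (ev a x)) \<in> X_space k m"
proof -
  note real = evenW_ev(1)[OF a m]
  obtain C where C: "\<And>n::int. (1 + (of_int n)\<^sup>2) ^ k \<le> C * (weight n)\<^sup>2"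
    using sobolev_weight_bounded by blast
  have cont: "continuous_on S (\<lambda>x. Re (ev a x))" for S by (intro continuous_intros)
  have "(\<lambda>x. Re (ev a x)) \<in> sobolev_space k"
    unfolding sobolev_space_def
    using sobolev_series(1)[OF C, of a]
    by (auto simp: ev_periodic fourier_coeff_ev[OF real] intro!: borel_measurable_continuous_onI cont
        borel_integrable_atLeastAtMost' continuous_intros)
  \<comment> \<open>The factor 2 pairs the frequencies n and -n. Frequency 0 is excluded by
    hypothesis, and among the positive ones only the multiples of m contribute.\<close>
  moreover have "(\<lambda>j. 2 * Re (coef a (int (Suc j * m))) * cos (real (Suc j * m) * x)) sums Re (ev a x)" for x
  proof -
    define h where "h n = Re (coef a n) * cos (of_int n * x)" for n
    have im: "Im (coef a n) = 0" and ev: "coef a (- n) = coef a n" and z: "\<not> int m dvd n \<Longrightarrow> coef a n = 0" for n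
      using a by (auto simp: evenW_def)
    have "((\<lambda>n. Re (coef a n * cis (of_int n * x))) has_sum Re (ev a x)) UNIV"
      by (rule has_sum_Re[OF ev_has_sum])
    then have h: "(h has_sum Re (ev a x)) UNIV" by (simp add: h_def[abs_def] im)
    have "h summable_on {0<..}"
      by (rule summable_on_subset_banach[OF has_sum_imp_summable[OF h]]) auto
    then obtain S where S: "(h has_sum S) {0<..}" by (auto simp: summable_on_def)
    have "(h has_sum S) {..<0}"
      by (rule has_sum_reindex_bij_witness[of _ uminus uminus, THEN iffD1, OF _ _ _ _ _ refl S])
         (auto simp: h_def ev)
    then have "(h has_sum (S + S)) ({0<..} \<union> {..<0})" by (intro has_sum_Un_disjoint S) auto
    moreover have "(h has_sum (S + S)) ({0<..} \<union> {..<0}) \<longleftrightarrow> (h has_sum (S + S)) UNIV"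
      by (rule has_sum_cong_neutral) (auto simp: h_def a0 not_less le_less)
    ultimately have SS: "Re (ev a x) = 2 * S" using has_sum_unique[OF h] by simp
    have sub: "range (\<lambda>j. int (Suc j * m)) \<subseteq> {0<..}" using m by (auto intro!: add_pos_nonneg)
    have "(h has_sum S) (range (\<lambda>j. int (Suc j * m))) \<longleftrightarrow> (h has_sum S) {0<..}"
    proof (rule has_sum_cong_neutral)
      fix n assume n: "n \<in> {0<..} - range (\<lambda>j. int (Suc j * m))"
      have "\<not> int m dvd n"
      proof
        assume "int m dvd n"
        then obtain i where i: "n = int m * i" by blast
        then have "i > 0" using n m by (auto simp: zero_less_mult_iff)
        then have "n = int (Suc (nat (i - 1)) * m)" using i by (simp add: Suc_nat_eq_nat_zadd1 mult.commute)
        then show False using n by blast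
      qed
      then show "h n = 0" by (simp add: h_def z)
    qed (use sub in blast)+
    then have "((h \<circ> (\<lambda>j. int (Suc j * m))) has_sum S) UNIV"
      using S m by (subst has_sum_reindex[symmetric]) (auto simp: inj_on_def)
    then have "(\<lambda>j. h (int (Suc j * m))) sums S" by (auto dest: has_sum_imp_sums simp: o_def)
    then have "(\<lambda>j. 2 * h (int (Suc j * m))) sums (2 * S)" by (rule sums_mult)
    then show ?thesis unfolding SS h_def by (simp only: mult.assoc of_int_of_nat_eq)
  qed
  ultimately show ?thesis
    unfolding X_space_def by (intro CollectI conjI exI[of _ "\<lambda>j. 2 * Re (coef a (int (Suc j * m)))"]) auto
qed

text \<open>The contraction constant is uniform in the parameter, so the fixed points at s and t
  differ by at most |T s x - T t x| / (1 - c) with x the fixed point at t. Hence continuity of T in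
  s at fixed x is enough.\<close>

lemma parametrized_contraction:
  fixes T :: "real \<Rightarrow> 'a :: banach \<Rightarrow> 'a"
  assumes S: "complete S" "S \<noteq> {}" and c: "0 \<le> c" "c < 1"
    and maps: "\<And>s x. s \<in> I \<Longrightarrow> x \<in> S \<Longrightarrow> T s x \<in> S"
    and contr: "\<And>s x y. s \<in> I \<Longrightarrow> x \<in> S \<Longrightarrow> y \<in> S \<Longrightarrow> norm (T s x - T s y) \<le> c * norm (x - y)"
    and cont: "\<And>t x. t \<in> I \<Longrightarrow> x \<in> S \<Longrightarrow> ((\<lambda>s. T s x) \<longlongrightarrow> T t x) (at t within I)"
  shows "\<exists>g. (\<forall>s\<in>I. g s \<in> S \<and> T s (g s) = g s) \<and> (\<forall>t\<in>I. (g \<longlongrightarrow> g t) (at t within I))"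
proof -
  have "\<exists>x\<in>S. T s x = x" if "s \<in> I" for s
    using Banach_fix[OF S c, of "T s"] maps[OF that] contr[OF that] by (auto simp: dist_norm)
  then obtain g where g: "\<And>s. s \<in> I \<Longrightarrow> g s \<in> S" "\<And>s. s \<in> I \<Longrightarrow> T s (g s) = g s" by metis
  have "(g \<longlongrightarrow> g t) (at t within I)" if t: "t \<in> I" for t
  proof -
    have le: "norm (g s - g t) \<le> norm (T s (g t) - T t (g t)) / (1 - c)" if s: "s \<in> I" for s
    proof -
      have e: "(T s (g s) - T s (g t)) + (T s (g t) - T t (g t)) = g s - g t" using g(2) s t by simp
      have "norm ((T s (g s) - T s (g t)) + (T s (g t) - T t (g t)))
          \<le> c * norm (g s - g t) + norm (T s (g t) - T t (g t))"
        by (rule order_trans[OF norm_triangle_ineq add_right_mono[OF contr]]) (use g s t in auto)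
      then have "norm (g s - g t) \<le> c * norm (g s - g t) + norm (T s (g t) - T t (g t))" unfolding e .
      then show ?thesis using c by (simp add: field_simps)
    qed
    have "((\<lambda>s. norm (T s (g t) - T t (g t)) / (1 - c)) \<longlongrightarrow> norm (T t (g t) - T t (g t)) / (1 - c)) (at t within I)"
      using c by (intro tendsto_intros cont t g) auto
    then have lim: "((\<lambda>s. norm (T s (g t) - T t (g t)) / (1 - c)) \<longlongrightarrow> 0) (at t within I)" by simp
    have "((\<lambda>s. g s - g t) \<longlongrightarrow> 0) (at t within I)"
      by (rule Lim_null_comparison[OF _ lim]) (use le in \<open>auto simp: eventually_at_filter\<close>)
    then show ?thesis by (rule LIM_zero_cancel)
  qed
  with g show ?thesis by blast
qed

section \<open>The bifurcating branch\<close>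

context gsqg
begin

lemma symbol_deriv_uminus: "symbol_deriv (- n) = - symbol_deriv n" and symbol_uminus: "symbol (- n) = symbol n" and velocity_integral_uminus: "velocity_integral (- n) = velocity_integral n"
  by (simp_all add: symbol_deriv_def symbol_def \<sigma>_def velocity_integral_def)

lemma Re_symbol_deriv: "Re (symbol_deriv n) = 0" and Im_symbol: "Im (symbol n) = 0"
  by (simp_all add: symbol_deriv_def symbol_def)

lemma pert_evenW: "g \<in> evenW m \<Longrightarrow> pert g \<in> evenW m" and dpert_oddV: "g \<in> evenW m \<Longrightarrow> dpert g \<in> oddV m"
  and lin_op_oddV: "g \<in> evenW m \<Longrightarrow> lin_op g \<in> oddV m"
  by (auto simp: evenW_def oddV_def coef_ops coef_lin_op symbol_deriv_uminus symbol_uminus velocity_integral_uminus Re_symbol_deriv Im_symbol)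

lemma mult_evenW_oddV:
  assumes "a \<in> evenW m" "c \<in> oddV m" "m \<ge> 1" shows "a * c \<in> oddV m"
  by (rule oddV_I[OF assms(3)])
     (simp_all add: ev_mult evenW_ev[OF assms(1,3)] oddV_ev[OF assms(2,3)])

text \<open>Reflecting x together with u -> 2 pi - u sends x - u to its negative up to a period.
  With R even and R' odd, D is unchanged and every term changes sign.\<close>

lemma integrand_sum_reflect:
  assumes "\<And>x. R (- x) = R x" "\<And>x. R' (- x) = - R' x" "\<And>x. R (x + 2 * pi) = R x" "\<And>x. R' (x + 2 * pi) = R' x"
  shows "integrand_sum R R' (- x) (2 * pi - u) = - integrand_sum R R' x u"
proof -
  have R: "R (- x - (2 * pi - u)) = R (x - u)"
    using assms(1)[of "x - u + 2 * pi"] assms(3)[of "x - u"] by (simp add: algebra_simps)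
  have R': "R' (- x - (2 * pi - u)) = - R' (x - u)"
    using assms(2)[of "x - u + 2 * pi"] assms(4)[of "x - u"] by (simp add: algebra_simps)
  have s: "sin ((2 * pi - u) / 2) = sin (u / 2)" by (simp add: diff_divide_distrib)
  have D: "D_fun R (- x) (- x - (2 * pi - u)) = D_fun R x (x - u)"
    unfolding D_fun_def R assms(1) using s by simp
  show ?thesis
    unfolding integrand_sum_def integrand1_def integrand2_def integrand3_def D unfolding R R' assms(1,2) cos_2pi_minus sin_2pi_minus
    by (simp add: algebra_simps add_divide_distrib diff_divide_distrib)
qed

text \<open>The integral over the circle represents the sum of linear part and remainder, so the
  symmetries are proved for the sum. The linear part, whose class is read off its symbol, is then
  subtracted.\<close>

lemma nonlin_oddV:
  assumes g: "g \<in> evenW m" and small: "norm g \<le> 1 / 8" and m: "m \<ge> 1"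
  shows "nonlin g \<in> oddV m"
proof -
  note f = evenW_ev[OF pert_evenW[OF g] m] and f' = oddV_ev[OF dpert_oddV[OF g] m]
  note I = integral_integrand_sum[OF small f(1), symmetric]
  have R: "radius g (- x) = radius g x" "radius g (x + 2 * pi / real m) = radius g x" for x
    by (simp_all add: radius_def f)
  have R': "radius' g (- x) = - radius' g x" "radius' g (x + 2 * pi / real m) = radius' g x" for x
    by (simp_all add: radius'_def f')
  have odd: "integral\<^sup>L circle (integrand_sum (radius g) (radius' g) (- x)) = - integral\<^sup>L circle (integrand_sum (radius g) (radius' g) x)" for x
  proof -
    have "integral\<^sup>L circle (integrand_sum (radius g) (radius' g) (- x)) = (LINT u|circle. integrand_sum (radius g) (radius' g) (- x) (2 * pi - u))"
      by (rule integral_circle_reflect[symmetric])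
    also have "\<dots> = (LINT u|circle. - integrand_sum (radius g) (radius' g) x u)"
      by (subst integrand_sum_reflect)
         (auto simp: R R' radius_periodic[OF small f(1)] radius'_periodic[OF small f(1)])
    finally show ?thesis by simp
  qed
  have shift: "integral\<^sup>L circle (integrand_sum (radius g) (radius' g) (x + 2 * pi / real m)) = integral\<^sup>L circle (integrand_sum (radius g) (radius' g) x)" for x
  proof -
    have "x + 2 * pi / real m - u = (x - u) + 2 * pi / real m" for u by simp
    then have "integrand_sum (radius g) (radius' g) (x + 2 * pi / real m) = integrand_sum (radius g) (radius' g) x"
      unfolding integrand_sum_def[abs_def] integrand1_def integrand2_def integrand3_def D_fun_def by (simp only: R R') simp
    then show ?thesis by simp
  qed
  have "lin_op g + nonlin g \<in> oddV m"
    by (rule oddV_I[OF m]) (simp_all only: I odd shift Im_complex_of_real of_real_minus)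
  from oddV_closed_ops(2)[OF this lin_op_oddV[OF g]] show ?thesis by simp
qed

text \<open>Lyapunov--Schmidt reduction. With \<open>\<Omega> = \<Omega>\<^sub>m + \<omega>\<close> and \<open>R = 1 + s (cos (m x) + h)\<close>, the map
  that sends \<open>(\<omega>, h)\<close> to \<open>\<omega> (cos (m x))'\<close> plus the linearisation at \<open>\<Omega>\<^sub>m\<close> applied to \<open>h\<close> is
  invertible. The unknown \<open>G\<close> below is its value: the modes \<open>\<plusminus>m\<close> of \<open>G\<close> carry \<open>\<omega> = vel_shift m G\<close> and the
  other modes carry \<open>h\<close>, and \<open>branch_map m s\<close> is the equation in fixed-point form, divided by \<open>s\<close>
  (at \<open>s = 0\<close> the junk value \<open>inverse 0 = 0\<close> is the correct limit).\<close>

definition bif_velocity :: "nat \<Rightarrow> real" where "bif_velocity m = velocity (int m)"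

text \<open>Dividing by the symbol undoes the smoothing: \<open>pert (kernel_elem m)\<close> has
  coefficients 1/2 at the modes m and -m, which is cos (m x).\<close>

definition kernel_elem :: "nat \<Rightarrow> wiener" where
  "kernel_elem m = mode (int m) (1 / (2 * symbol (int m))) + mode (- int m) (1 / (2 * symbol (int m)))"

definition inv_symbol :: "nat \<Rightarrow> int \<Rightarrow> complex" where
  "inv_symbol m n = (if n \<noteq> 0 \<and> \<bar>n\<bar> \<noteq> int m \<and> int m dvd n then 1 / (symbol_deriv n * of_real (bif_velocity m - velocity n)) else 0)"

text \<open>The derivative of cos (m x) has coefficient \<i> m / 2 at mode m, and the coefficients
  of elements of \<open>oddV m\<close> are imaginary; comparing them gives this \<omega>.\<close>

definition vel_shift :: "nat \<Rightarrow> wiener \<Rightarrow> real" where "vel_shift m G = 2 * Im (coef G (int m)) / real m"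

definition branch :: "nat \<Rightarrow> wiener \<Rightarrow> wiener" where "branch m G = kernel_elem m + multiplier (inv_symbol m) G"

definition quad :: "nat \<Rightarrow> real \<Rightarrow> wiener \<Rightarrow> wiener" where
  "quad m \<omega> g = (bif_velocity m + \<omega>) *\<^sub>R (pert g * dpert g) - C_gsqg \<alpha> *\<^sub>R nonlin g"

definition branch_map :: "nat \<Rightarrow> real \<Rightarrow> wiener \<Rightarrow> wiener" where
  "branch_map m s G = - (vel_shift m G *\<^sub>R dpert (multiplier (inv_symbol m) G)) - inverse s *\<^sub>R quad m (vel_shift m G) (s *\<^sub>R branch m G)"

text \<open>The denominator is at least c |n|^\<alpha> times \<open>\<sigma> n\<close> by the
  velocity gap: growth of order \<alpha> meets smoothing of order \<alpha>. The 4 comes from (1 +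
  t)^\<alpha> \<le> (2 t)^\<alpha> \<le> 4 t^\<alpha> for t \<ge> 1.\<close>

lemma inv_symbol_bounded:
  assumes "m \<ge> 1" shows "\<exists>B\<ge>0. \<forall>n. cmod (inv_symbol m n) \<le> B"
proof -
  obtain c where c: "c > 0" "\<And>n. n \<noteq> 0 \<Longrightarrow> \<bar>n\<bar> \<noteq> int m \<Longrightarrow> c * \<bar>of_int n\<bar> powr (\<alpha> - 1) \<le> \<bar>velocity n - velocity (int m)\<bar>"
    using velocity_gap[OF assms] by blast
  have "cmod (inv_symbol m n) \<le> 4 / c" for n
  proof (cases "n \<noteq> 0 \<and> \<bar>n\<bar> \<noteq> int m \<and> int m dvd n")
    case True
    define t where "t = \<bar>real_of_int n\<bar>"
    have "n \<noteq> 0" using True by blast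
    then have t: "t \<ge> 1" by (simp add: t_def)
    have "c / 4 \<le> c * (t powr \<alpha> * \<sigma> n)"
    proof -
      have "(1 + t) powr \<alpha> \<le> (2 * t) powr \<alpha>" using t alpha by (intro powr_mono2) auto
      also have "\<dots> = 2 powr \<alpha> * t powr \<alpha>" using t by (simp add: powr_mult)
      also have "\<dots> \<le> 4 * t powr \<alpha>"
        using powr_mono[of \<alpha> 2 "2 :: real"] alpha by (intro mult_right_mono) auto
      finally have "1 \<le> 4 * (t powr \<alpha> * \<sigma> n)"
        using t by (simp add: \<sigma>_def t_def[symmetric] powr_minus field_simps)
      then show ?thesis using c(1) by simp
    qed
    also have "\<dots> = (t * \<sigma> n) * (c * t powr (\<alpha> - 1))"
      using powr_mult_base[of t "\<alpha> - 1"] t by (simp add: mult_ac)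
    also have "\<dots> \<le> (t * \<sigma> n) * \<bar>bif_velocity m - velocity n\<bar>"
      using c(2)[of n] True t sigma_pos[of n]
      by (intro mult_left_mono) (auto simp: bif_velocity_def t_def abs_minus_commute)
    also have "\<dots> = cmod (symbol_deriv n * of_real (bif_velocity m - velocity n))"
      using sigma_pos[of n] by (simp add: symbol_deriv_def norm_mult t_def del: of_real_diff)
    finally have "c / 4 \<le> cmod (symbol_deriv n * of_real (bif_velocity m - velocity n))" .
    then have "1 / cmod (symbol_deriv n * of_real (bif_velocity m - velocity n)) \<le> 1 / (c / 4)"
      using c(1) by (intro divide_left_mono) (auto intro!: mult_pos_pos)
    then show ?thesis using True by (simp add: inv_symbol_def norm_divide)
  next
    case False
    then show ?thesis using c(1) by (auto simp: inv_symbol_def)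
  qed
  then show ?thesis using c(1) by (intro exI[of _ "4 / c"]) auto
qed

lemma coef_nu: "m \<ge> 1 \<Longrightarrow> coef (multiplier (inv_symbol m) G) n = inv_symbol m n * coef G n"
  using inv_symbol_bounded[of m] coef_multiplier[of "inv_symbol m"] by blast


lemma inv_symbol_active:
  assumes "m \<ge> 1" "n \<noteq> 0" "\<bar>n\<bar> \<noteq> int m" "int m dvd n" shows "symbol_deriv n * of_real (bif_velocity m - velocity n) * inv_symbol m n = 1"
proof -
  obtain c where c: "c > 0" "c * \<bar>of_int n\<bar> powr (\<alpha> - 1) \<le> \<bar>velocity n - velocity (int m)\<bar>"
    using velocity_gap[OF assms(1)] assms(2,3) by blast
  have "0 < c * \<bar>of_int n\<bar> powr (\<alpha> - 1)" using c(1) assms(2) by simp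
  then have "bif_velocity m - velocity n \<noteq> 0" using c(2) by (auto simp: bif_velocity_def)
  moreover have "symbol_deriv n \<noteq> 0" using sigma_pos[of n] assms(2) by (simp add: symbol_deriv_def)
  ultimately show ?thesis using assms by (simp add: inv_symbol_def del: of_real_diff)
qed

lemma coef_kernel_elem: "m \<ge> 1 \<Longrightarrow> coef (kernel_elem m) n = (if \<bar>n\<bar> = int m then 1 / (2 * symbol (int m)) else 0)"
  by (auto simp: kernel_elem_def coef_add coef_mode abs_if)

lemma kernel_elem_evenW: "m \<ge> 1 \<Longrightarrow> kernel_elem m \<in> evenW m"
proof -
  assume m: "m \<ge> 1"
  have "int m dvd n" if "\<bar>n\<bar> = int m" for n by (metis that dvd_abs_iff dvd_refl)
  then show ?thesis using m by (auto simp: evenW_def coef_kernel_elem symbol_def Im_divide)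
qed

lemma nu_evenW:
  assumes m: "m \<ge> 1" and G: "G \<in> oddV m" shows "multiplier (inv_symbol m) G \<in> evenW m"
proof -
  have "inv_symbol m (- n) = - inv_symbol m n" for n
    by (simp add: inv_symbol_def symbol_deriv_uminus velocity_uminus)
  moreover have "Re (inv_symbol m n) = 0" for n
    by (simp add: inv_symbol_def Re_divide Re_symbol_deriv del: of_real_diff)
  ultimately show ?thesis using G m by (auto simp: evenW_def oddV_def coef_nu)
qed

lemma branch_evenW: "m \<ge> 1 \<Longrightarrow> G \<in> oddV m \<Longrightarrow> s *\<^sub>R branch m G \<in> evenW m"
  using kernel_elem_evenW[of m] nu_evenW[of m G] by (auto simp: branch_def evenW_def coef_scaleR coef_add)

text \<open>At the modes m and -m the linearisation vanishes and the velocity term reproduces G. At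
  the other nonzero multiples of m the inverse symbol cancels the eigenvalue. At the remaining modes
  both sides vanish because G is in \<open>oddV m\<close>.\<close>

lemma linear_part:
  assumes m: "m \<ge> 1" and G: "G \<in> oddV m"
  shows "vel_shift m G *\<^sub>R dpert (kernel_elem m) + (bif_velocity m *\<^sub>R dpert (branch m G) - C_gsqg \<alpha> *\<^sub>R lin_op (branch m G)) = G"
proof (rule wiener_eqI)
  fix n
  have odd: "coef G (- n) = - coef G n" "Re (coef G n) = 0" "\<not> int m dvd n \<Longrightarrow> coef G n = 0" for n
    using G by (auto simp: oddV_def)
  have lin: "coef (bif_velocity m *\<^sub>R dpert (branch m G) - C_gsqg \<alpha> *\<^sub>R lin_op (branch m G)) n
      = symbol_deriv n * of_real (bif_velocity m - velocity n) * coef (branch m G) n"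
    unfolding coef_diff coef_scaleR coef_ops coef_lin_op symbol_deriv_def symbol_def velocity_def
    by (simp add: scaleR_conv_of_real algebra_simps)
  have k: "coef (branch m G) n = coef (kernel_elem m) n + inv_symbol m n * coef G n"
    by (simp add: branch_def coef_add coef_nu[OF m])
  show "coef (vel_shift m G *\<^sub>R dpert (kernel_elem m) + (bif_velocity m *\<^sub>R dpert (branch m G) - C_gsqg \<alpha> *\<^sub>R lin_op (branch m G))) n = coef G n"
  proof (cases "\<bar>n\<bar> = int m")
    case True
    have nm: "n = int m \<or> n = - int m" using True by linarith
    then have "velocity n = bif_velocity m" by (auto simp: bif_velocity_def velocity_uminus)
    moreover have "vel_shift m G *\<^sub>R coef (dpert (kernel_elem m)) n = coef G n"
    proof -
      have s: "symbol (int m) \<noteq> 0" using sigma_pos[of "int m"] by (simp add: symbol_def)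
      have 1: "vel_shift m G *\<^sub>R coef (dpert (kernel_elem m)) (int m) = coef G (int m)"
        using m s odd(2)[of "int m"]
        by (simp add: coef_ops coef_kernel_elem vel_shift_def symbol_deriv_def symbol_def[symmetric] complex_eq_iff scaleR_conv_of_real)
      have "coef (dpert (kernel_elem m)) (- int m) = - coef (dpert (kernel_elem m)) (int m)"
        using m by (simp add: coef_ops coef_kernel_elem symbol_deriv_uminus)
      then show ?thesis using nm 1 odd(1)[of "int m"] by auto
    qed
    ultimately show ?thesis by (simp add: coef_add lin coef_scaleR)
  next
    case False
    then have g0: "coef (kernel_elem m) n = 0" by (simp add: coef_kernel_elem[OF m])
    have "symbol_deriv n * of_real (bif_velocity m - velocity n) * (inv_symbol m n * coef G n) = coef G n"
    proof (cases "n \<noteq> 0 \<and> int m dvd n")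
      case True
      then show ?thesis using inv_symbol_active[OF m, of n] False by (simp flip: mult.assoc)
    next
      case F: False
      have "coef G n = 0"
        using F odd(3)[of n] odd(1)[of 0] by auto
      then show ?thesis by simp
    qed
    then show ?thesis by (simp add: coef_add lin k g0 coef_scaleR coef_ops del: of_real_diff)
  qed
qed

lemma equation_of_fixed_point:
  assumes m: "m \<ge> 1" and G: "G \<in> oddV m" and fp: "branch_map m s G = G"
  defines "g \<equiv> s *\<^sub>R branch m G"
  shows "(bif_velocity m + vel_shift m G) *\<^sub>R ((1 + pert g) * dpert g) - C_gsqg \<alpha> *\<^sub>R (lin_op g + nonlin g) = 0"
proof -
  obtain B where B: "\<And>n. cmod (inv_symbol m n) \<le> B" using inv_symbol_bounded[OF m] by blast
  have dpert: "dpert g = s *\<^sub>R dpert (branch m G)" and lin_op: "lin_op g = s *\<^sub>R lin_op (branch m G)"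
    by (rule wiener_eqI; simp add: g_def coef_ops coef_lin_op coef_scaleR)+
  have f1k: "dpert (branch m G) = dpert (kernel_elem m) + dpert (multiplier (inv_symbol m) G)"
    by (rule wiener_eqI) (simp add: branch_def coef_ops coef_add algebra_simps)
  have "(bif_velocity m + vel_shift m G) *\<^sub>R ((1 + pert g) * dpert g) - C_gsqg \<alpha> *\<^sub>R (lin_op g + nonlin g)
     = (bif_velocity m + vel_shift m G) *\<^sub>R dpert g - C_gsqg \<alpha> *\<^sub>R lin_op g + quad m (vel_shift m G) g"
    by (simp add: quad_def algebra_simps)
  also have "(bif_velocity m + vel_shift m G) *\<^sub>R dpert g - C_gsqg \<alpha> *\<^sub>R lin_op g
     = s *\<^sub>R ((vel_shift m G *\<^sub>R dpert (kernel_elem m) + (bif_velocity m *\<^sub>R dpert (branch m G) - C_gsqg \<alpha> *\<^sub>R lin_op (branch m G)))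
        + vel_shift m G *\<^sub>R dpert (multiplier (inv_symbol m) G))"
    unfolding dpert lin_op f1k by (simp add: algebra_simps)
  also have "\<dots> = s *\<^sub>R (G + vel_shift m G *\<^sub>R dpert (multiplier (inv_symbol m) G))"
    unfolding linear_part[OF m G] ..
  also have "\<dots> + quad m (vel_shift m G) g = 0"
  proof (cases "s = 0")
    \<comment> \<open>For s = 0 the fixed-point identity says nothing about \<open>quad\<close>, but
      then g = 0 and every term is zero.\<close>
    case True
    then have "g = 0" by (simp add: g_def)
    moreover have "dpert 0 = 0" by (rule wiener_eqI) (simp add: coef_ops coef_zero)
    ultimately show ?thesis using True by (simp add: quad_def nonlin_0)
  next
    case False
    have "G + vel_shift m G *\<^sub>R dpert (multiplier (inv_symbol m) G) = - (inverse s *\<^sub>R quad m (vel_shift m G) g)"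
    proof -
      have "- (vel_shift m G *\<^sub>R dpert (multiplier (inv_symbol m) G)) - inverse s *\<^sub>R quad m (vel_shift m G) g = G"
        using fp unfolding branch_map_def g_def [symmetric] .
      from arg_cong[OF this, of "\<lambda>z. z + vel_shift m G *\<^sub>R dpert (multiplier (inv_symbol m) G)"] show ?thesis by simp
    qed
    then show ?thesis using False by simp
  qed
  finally show ?thesis .
qed

lemma branch_map_oddV:
  assumes m: "m \<ge> 1" and G: "G \<in> oddV m" and small: "norm (s *\<^sub>R branch m G) \<le> 1 / 8"
  shows "branch_map m s G \<in> oddV m"
proof -
  note g = branch_evenW[OF m G, of s]
  have "quad m (vel_shift m G) (s *\<^sub>R branch m G) \<in> oddV m"
    unfolding quad_def by (intro oddV_closed_ops mult_evenW_oddV pert_evenW dpert_oddV nonlin_oddV g small m)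
  then show ?thesis
    unfolding branch_map_def by (intro oddV_closed_ops dpert_oddV nu_evenW m G)
qed

section \<open>Estimates for the contraction\<close>

lemma vel_shift_diff: "vel_shift m G - vel_shift m G' = vel_shift m (G - G')"
  by (simp add: vel_shift_def coef_diff diff_divide_distrib algebra_simps)

lemma vel_shift_le: "m \<ge> 2 \<Longrightarrow> \<bar>vel_shift m G\<bar> \<le> norm G"
proof -
  assume m: "m \<ge> 2"
  have "\<bar>vel_shift m G\<bar> = 2 / real m * \<bar>Im (coef G (int m))\<bar>" by (simp add: vel_shift_def abs_mult)
  also have "\<dots> \<le> 1 * norm G"
    using m order_trans[OF abs_Im_le_cmod norm_coef_le, of G "int m"] by (intro mult_mono) auto
  finally show ?thesis by simp
qed

lemma pert_diff: "pert (a - c) = pert a - pert c" and dpert_diff: "dpert (a - c) = dpert a - dpert c"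
  by (rule wiener_eqI; simp add: coef_ops coef_diff algebra_simps)+

text \<open>The dependence on \<omega> carries the factor \<open>(norm g)\<^sup>2\<close>. With g of
  size s, both terms of the bound are of second order in s and remain small after division by
  s.\<close>

lemma quad_lipschitz:
  "\<exists>K\<ge>0. \<forall>g h \<omega> \<omega>'. norm g \<le> 1 / 8 \<longrightarrow> norm h \<le> 1 / 8 \<longrightarrow> \<bar>\<omega>'\<bar> \<le> 1 \<longrightarrow>
     norm (quad m \<omega> g - quad m \<omega>' h) \<le> K * (norm g + norm h) * norm (g - h) + \<bar>\<omega> - \<omega>'\<bar> * (norm g)\<^sup>2"
proof -
  obtain K where K: "K \<ge> 0" "\<And>g h. norm g \<le> 1 / 8 \<Longrightarrow> norm h \<le> 1 / 8 \<Longrightarrow>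
     norm (nonlin g - nonlin h) \<le> K * (norm g + norm h) * norm (g - h)"
    using nonlin_lipschitz by blast
  have "norm (quad m \<omega> g - quad m \<omega>' h)
      \<le> (\<bar>bif_velocity m\<bar> + 1 + \<bar>C_gsqg \<alpha>\<bar> * K) * (norm g + norm h) * norm (g - h) + \<bar>\<omega> - \<omega>'\<bar> * (norm g)\<^sup>2"
    if gh: "norm g \<le> 1 / 8" "norm h \<le> 1 / 8" and \<omega>: "\<bar>\<omega>'\<bar> \<le> 1" for g h \<omega> \<omega>'
  proof -
    \<comment> \<open>The common velocity is taken with \<omega>', the one assumed bounded; the
      difference \<omega> - \<omega>' then multiplies a product in g alone.\<close>
    have "quad m \<omega> g - quad m \<omega>' h = (bif_velocity m + \<omega>') *\<^sub>R (pert g * dpert (g - h) + pert (g - h) * dpert h)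
        + (\<omega> - \<omega>') *\<^sub>R (pert g * dpert g) - C_gsqg \<alpha> *\<^sub>R (nonlin g - nonlin h)"
      by (simp add: quad_def pert_diff dpert_diff algebra_simps)
    also have "norm \<dots> \<le> \<bar>bif_velocity m + \<omega>'\<bar> * (norm g * norm (g - h) + norm (g - h) * norm h)
        + \<bar>\<omega> - \<omega>'\<bar> * (norm g * norm g) + \<bar>C_gsqg \<alpha>\<bar> * (K * (norm g + norm h) * norm (g - h))"
    proof (rule order_trans[OF norm_triangle_ineq4], rule add_mono[OF order_trans[OF norm_triangle_ineq] _], rule add_mono)
      have m2: "norm (pert a * dpert c) \<le> norm a * norm c" for a c
        by (rule order_trans[OF norm_mult_ineq mult_mono]) (auto intro: norm_basic)
      show "norm ((bif_velocity m + \<omega>') *\<^sub>R (pert g * dpert (g - h) + pert (g - h) * dpert h))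
         \<le> \<bar>bif_velocity m + \<omega>'\<bar> * (norm g * norm (g - h) + norm (g - h) * norm h)"
        unfolding norm_scaleR by (intro mult_left_mono norm_triangle_mono m2) auto
      show "norm ((\<omega> - \<omega>') *\<^sub>R (pert g * dpert g)) \<le> \<bar>\<omega> - \<omega>'\<bar> * (norm g * norm g)"
        unfolding norm_scaleR by (intro mult_left_mono m2) auto
      show "norm (C_gsqg \<alpha> *\<^sub>R (nonlin g - nonlin h)) \<le> \<bar>C_gsqg \<alpha>\<bar> * (K * (norm g + norm h) * norm (g - h))"
        unfolding norm_scaleR by (intro mult_left_mono K gh) auto
    qed
    also have "\<dots> \<le> (\<bar>bif_velocity m\<bar> + 1) * (norm g * norm (g - h) + norm (g - h) * norm h)
        + \<bar>\<omega> - \<omega>'\<bar> * (norm g * norm g) + \<bar>C_gsqg \<alpha>\<bar> * (K * (norm g + norm h) * norm (g - h))"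
      using \<omega> by (intro add_right_mono mult_right_mono) auto
    also have "\<dots> = (\<bar>bif_velocity m\<bar> + 1 + \<bar>C_gsqg \<alpha>\<bar> * K) * (norm g + norm h) * norm (g - h) + \<bar>\<omega> - \<omega>'\<bar> * (norm g)\<^sup>2"
      by (simp add: algebra_simps power2_eq_square)
    finally show ?thesis .
  qed
  then show ?thesis using K(1) by (intro exI[of _ "\<bar>bif_velocity m\<bar> + 1 + \<bar>C_gsqg \<alpha>\<bar> * K"]) auto
qed

lemma quad_0: "quad m \<omega> 0 = 0"
proof -
  have "dpert 0 = 0" by (rule wiener_eqI) (simp add: coef_ops coef_zero)
  then show ?thesis by (simp add: quad_def nonlin_0)
qed

text \<open>Two mechanisms make the map contract. The product of \<open>vel_shift\<close> and the
  correction is quadratic in G, hence small on a small ball; the term from \<open>quad\<close>, once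
  divided by s, is still of order s. Together they give 1/4 + 1/8, and the image of 0 has norm at
  most r / 8, so the ball of radius r is preserved.\<close>

lemma solution_curve:
  assumes m: "m \<ge> 2"
  shows "\<exists>\<epsilon>>0. \<exists>G. (\<forall>s\<in>{-\<epsilon><..<\<epsilon>}. G s \<in> oddV m \<and> branch_map m s (G s) = G s \<and> norm (s *\<^sub>R branch m (G s)) \<le> 1 / 8)
     \<and> (\<forall>t\<in>{-\<epsilon><..<\<epsilon>}. (G \<longlongrightarrow> G t) (at t within {-\<epsilon><..<\<epsilon>})) \<and> G 0 = 0"
proof -
  have m1: "m \<ge> 1" using m by simp
  obtain B where B: "B \<ge> 0" "\<And>n. cmod (inv_symbol m n) \<le> B" using inv_symbol_bounded[OF m1] by blast
  obtain KQ where KQ: "KQ \<ge> 0" "\<And>g h \<omega> \<omega>'. norm g \<le> 1 / 8 \<Longrightarrow> norm h \<le> 1 / 8 \<Longrightarrow> \<bar>\<omega>'\<bar> \<le> 1 \<Longrightarrow>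
     norm (quad m \<omega> g - quad m \<omega>' h) \<le> KQ * (norm g + norm h) * norm (g - h) + \<bar>\<omega> - \<omega>'\<bar> * (norm g)\<^sup>2"
    using quad_lipschitz by blast
  \<comment> \<open>\<open>K1\<close> bounds \<open>branch m G\<close> on the unit ball, and
    \<open>K3\<close> dominates the coefficients that |s| multiplies below. The choice of
    \<open>r\<close> gives 2 r B \<le> 1/4, and that of \<open>\<epsilon>\<close> makes |s| times
    such a coefficient at most r / 8.\<close>
  define K1 where "K1 = norm (kernel_elem m) + B"
  define K3 where "K3 = 2 * KQ * K1 * B + K1\<^sup>2 + KQ * K1\<^sup>2 + K1 + 1"
  define r where "r = min 1 (1 / (8 * (B + 1)))"
  define \<epsilon> where "\<epsilon> = r / (8 * K3)"
  have K1: "K1 \<ge> 0" using B(1) by (simp add: K1_def)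
  have K3: "K3 \<ge> 1" "2 * KQ * K1 * B + K1\<^sup>2 \<le> K3" "KQ * K1\<^sup>2 \<le> K3" "K1 \<le> K3"
    using K1 KQ(1) B(1) by (auto simp: K3_def)
  have r: "0 < r" "r \<le> 1" "2 * r * B \<le> 1 / 4"
  proof -
    have "r * (8 * (B + 1)) \<le> 1 / (8 * (B + 1)) * (8 * (B + 1))"
      using B(1) by (intro mult_right_mono) (auto simp: r_def)
    then show "0 < r" "r \<le> 1" "2 * r * B \<le> 1 / 4" using B(1) by (auto simp: r_def algebra_simps)
  qed
  have \<epsilon>: "\<epsilon> > 0" using r K3 by (simp add: \<epsilon>_def)
  have sK: "\<bar>s\<bar> * K \<le> r / 8" if "s \<in> {-\<epsilon><..<\<epsilon>}" "K \<le> K3" "0 \<le> K" for s K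
  proof -
    have "\<bar>s\<bar> * K \<le> \<epsilon> * K3" using that \<epsilon> by (intro mult_mono) auto
    then show ?thesis using K3 by (simp add: \<epsilon>_def)
  qed
  define S where "S = oddV m \<inter> cball 0 r"
  have nu_le: "norm (multiplier (inv_symbol m) G) \<le> B * norm G" for G by (rule norm_multiplier_le[OF B(2)])
  have branch_diff: "branch m G - branch m G' = multiplier (inv_symbol m) (G - G')" for G G' by (simp add: branch_def multiplier_diff[OF B(2)])
  have branch_le: "norm (branch m G) \<le> K1" if "G \<in> S" for G
  proof -
    have "norm (branch m G) \<le> norm (kernel_elem m) + B * norm G"
      unfolding branch_def by (rule norm_triangle_mono[OF order_refl nu_le])
    also have "B * norm G \<le> B * 1" using that r B(1) by (intro mult_left_mono) (auto simp: S_def)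
    finally show ?thesis by (simp add: K1_def)
  qed
  have skk: "norm (s *\<^sub>R branch m G) \<le> \<bar>s\<bar> * K1" "norm (s *\<^sub>R branch m G) \<le> 1 / 8"
    if "s \<in> {-\<epsilon><..<\<epsilon>}" "G \<in> S" for s G
  proof -
    show 1: "norm (s *\<^sub>R branch m G) \<le> \<bar>s\<bar> * K1" using branch_le[OF that(2)] by (simp add: mult_left_mono)
    show "norm (s *\<^sub>R branch m G) \<le> 1 / 8" using 1 sK[OF that(1) K3(4) K1] r by simp
  qed
  have om1: "\<bar>vel_shift m G\<bar> \<le> 1" if "G \<in> S" for G
    using vel_shift_le[OF m, of G] that r by (auto simp: S_def)
  have contr: "norm (branch_map m s G - branch_map m s G') \<le> 1 / 2 * norm (G - G')"
    if s: "s \<in> {-\<epsilon><..<\<epsilon>}" and G: "G \<in> S" and G': "G' \<in> S" for s G G'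
  proof -
    have nG: "norm G \<le> r" and nH: "norm G' \<le> r" using G G' by (auto simp: S_def)
    let ?n = "norm (G - G')"
    have "vel_shift m G *\<^sub>R dpert (multiplier (inv_symbol m) G) - vel_shift m G' *\<^sub>R dpert (multiplier (inv_symbol m) G')
        = vel_shift m G *\<^sub>R dpert (multiplier (inv_symbol m) (G - G')) + vel_shift m (G - G') *\<^sub>R dpert (multiplier (inv_symbol m) G')"
      by (simp add: multiplier_diff[OF B(2)] dpert_diff vel_shift_diff[symmetric] algebra_simps)
    also have "norm \<dots> \<le> r * (B * ?n) + ?n * (B * r)"
    proof (rule norm_triangle_mono)
      show "norm (vel_shift m G *\<^sub>R dpert (multiplier (inv_symbol m) (G - G'))) \<le> r * (B * ?n)"
        unfolding norm_scaleR
        by (intro mult_mono order_trans[OF vel_shift_le[OF m] nG] order_trans[OF norm_basic(2) nu_le]) (use r in auto)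
      show "norm (vel_shift m (G - G') *\<^sub>R dpert (multiplier (inv_symbol m) G')) \<le> ?n * (B * r)"
        unfolding norm_scaleR
        by (intro mult_mono vel_shift_le[OF m] order_trans[OF norm_basic(2) order_trans[OF nu_le]] nH) (use B(1) nH in auto)
    qed
    finally have 1: "norm (vel_shift m G *\<^sub>R dpert (multiplier (inv_symbol m) G) - vel_shift m G' *\<^sub>R dpert (multiplier (inv_symbol m) G')) \<le> 2 * r * B * ?n"
      by (simp add: algebra_simps)
    have "norm (quad m (vel_shift m G) (s *\<^sub>R branch m G) - quad m (vel_shift m G') (s *\<^sub>R branch m G'))
        \<le> KQ * (norm (s *\<^sub>R branch m G) + norm (s *\<^sub>R branch m G')) * norm (s *\<^sub>R branch m G - s *\<^sub>R branch m G')
          + \<bar>vel_shift m G - vel_shift m G'\<bar> * (norm (s *\<^sub>R branch m G))\<^sup>2"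
      by (intro KQ skk om1 s G G')
    also have "\<dots> \<le> KQ * (\<bar>s\<bar> * K1 + \<bar>s\<bar> * K1) * (\<bar>s\<bar> * (B * ?n)) + ?n * (\<bar>s\<bar> * K1)\<^sup>2"
    proof (intro add_mono mult_mono mult_left_mono power_mono)
      show "norm (s *\<^sub>R branch m G - s *\<^sub>R branch m G') \<le> \<bar>s\<bar> * (B * ?n)"
        using nu_le[of "G - G'"] by (simp add: branch_diff mult_left_mono flip: scaleR_diff_right)
    qed (use skk[OF s G] skk[OF s G'] KQ(1) K1 vel_shift_le[OF m] in \<open>auto simp: vel_shift_diff\<close>)
    also have "\<dots> = \<bar>s\<bar> * (\<bar>s\<bar> * (2 * KQ * K1 * B + K1\<^sup>2)) * ?n" by (simp add: algebra_simps power2_eq_square)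
    also have "\<dots> \<le> \<bar>s\<bar> * (r / 8) * ?n"
      by (intro mult_right_mono mult_left_mono sK s K3) (use KQ(1) K1 B(1) in auto)
    finally have 2: "norm (quad m (vel_shift m G) (s *\<^sub>R branch m G) - quad m (vel_shift m G') (s *\<^sub>R branch m G')) \<le> \<bar>s\<bar> * (r / 8 * ?n)" by simp
    have 3: "norm (inverse s *\<^sub>R (quad m (vel_shift m G) (s *\<^sub>R branch m G) - quad m (vel_shift m G') (s *\<^sub>R branch m G'))) \<le> r / 8 * ?n"
    proof (cases "s = 0")
      case False
      have "\<bar>inverse s\<bar> * norm (quad m (vel_shift m G) (s *\<^sub>R branch m G) - quad m (vel_shift m G') (s *\<^sub>R branch m G')) \<le> \<bar>inverse s\<bar> * (\<bar>s\<bar> * (r / 8 * ?n))"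
        by (intro mult_left_mono 2) auto
      moreover have "\<bar>inverse s\<bar> * (\<bar>s\<bar> * X) = X" for X using False by simp
      ultimately show ?thesis unfolding norm_scaleR by (simp only:)
    qed (use r in simp)
    have "branch_map m s G - branch_map m s G' = - (vel_shift m G *\<^sub>R dpert (multiplier (inv_symbol m) G) - vel_shift m G' *\<^sub>R dpert (multiplier (inv_symbol m) G'))
        - inverse s *\<^sub>R (quad m (vel_shift m G) (s *\<^sub>R branch m G) - quad m (vel_shift m G') (s *\<^sub>R branch m G'))"
      by (simp add: branch_map_def algebra_simps)
    also have "norm \<dots> \<le> 2 * r * B * ?n + r / 8 * ?n"
      using order_trans[OF norm_triangle_ineq4 add_mono[OF _ 3]] 1 by (simp only: norm_minus_cancel)
    also have "\<dots> \<le> 1 / 4 * ?n + 1 / 8 * ?n"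
      using r by (intro add_mono mult_right_mono) auto
    also have "\<dots> \<le> 1 / 2 * ?n" by simp
    finally show ?thesis .
  qed
  have zero: "0 \<in> S" using r by (simp add: S_def oddV_closed_ops)
  have om0: "vel_shift m 0 = 0" by (simp add: vel_shift_def coef_zero)
  have Qs: "norm (quad m (vel_shift m G) (s *\<^sub>R branch m G)) \<le> \<bar>s\<bar> * (\<bar>s\<bar> * (KQ * K1\<^sup>2))"
    if s: "s \<in> {-\<epsilon><..<\<epsilon>}" and G: "G \<in> S" for s G
  proof -
    have "norm (quad m (vel_shift m G) (s *\<^sub>R branch m G) - quad m (vel_shift m G) 0)
        \<le> KQ * (norm (s *\<^sub>R branch m G) + norm (0 :: wiener)) * norm (s *\<^sub>R branch m G - 0) + \<bar>vel_shift m G - vel_shift m G\<bar> * (norm (s *\<^sub>R branch m G))\<^sup>2"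
      by (intro KQ skk om1 s G) auto
    also have "\<dots> \<le> KQ * (\<bar>s\<bar> * K1) * (\<bar>s\<bar> * K1)"
      using skk(1)[OF s G] branch_le[OF G] KQ(1) K1 by (simp, intro mult_mono mult_left_mono) auto
    finally show ?thesis by (simp add: quad_0 power2_eq_square mult_ac)
  qed
  have invQ: "norm (inverse s *\<^sub>R quad m (vel_shift m G) (s *\<^sub>R branch m G)) \<le> \<bar>s\<bar> * (KQ * K1\<^sup>2)"
    if s: "s \<in> {-\<epsilon><..<\<epsilon>}" and G: "G \<in> S" for s G
  proof (cases "s = 0")
    case False
    have "\<bar>inverse s\<bar> * norm (quad m (vel_shift m G) (s *\<^sub>R branch m G)) \<le> \<bar>inverse s\<bar> * (\<bar>s\<bar> * (\<bar>s\<bar> * (KQ * K1\<^sup>2)))"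
      by (intro mult_left_mono Qs that) auto
    moreover have "\<bar>inverse s\<bar> * (\<bar>s\<bar> * X) = X" for X using False by simp
    ultimately show ?thesis unfolding norm_scaleR by (simp only:)
  qed simp
  have maps: "branch_map m s G \<in> S" if s: "s \<in> {-\<epsilon><..<\<epsilon>}" and G: "G \<in> S" for s G
  proof -
    have "norm (branch_map m s 0) = norm (inverse s *\<^sub>R quad m (vel_shift m 0) (s *\<^sub>R branch m 0))"
      by (simp add: branch_map_def om0)
    also have "\<dots> \<le> \<bar>s\<bar> * (KQ * K1\<^sup>2)" by (rule invQ[OF s zero])
    also have "\<dots> \<le> r / 8" by (rule sK[OF s K3(3)]) (use KQ(1) in simp)
    finally have "norm (branch_map m s 0) \<le> r / 8" .
    moreover have "norm (branch_map m s G - branch_map m s 0) \<le> 1 / 2 * r"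
      using contr[OF s G zero] G by (auto simp: S_def)
    ultimately have "norm (branch_map m s G) \<le> r"
      using norm_triangle_ineq[of "branch_map m s G - branch_map m s 0" "branch_map m s 0"] r by simp
    then show ?thesis using branch_map_oddV[OF m1 _ skk(2)[OF s G]] G by (simp add: S_def)
  qed
  have cont: "((\<lambda>s. branch_map m s G) \<longlongrightarrow> branch_map m t G) (at t within {-\<epsilon><..<\<epsilon>})"
    if t: "t \<in> {-\<epsilon><..<\<epsilon>}" and G: "G \<in> S" for t G
  proof -
    define \<phi> where "\<phi> s = quad m (vel_shift m G) (s *\<^sub>R branch m G)" for s
    have "((\<lambda>s. inverse s *\<^sub>R \<phi> s) \<longlongrightarrow> inverse t *\<^sub>R \<phi> t) (at t within {-\<epsilon><..<\<epsilon>})"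
    proof (cases "t = 0")
      case True
      \<comment> \<open>At t = 0 the value is zero by \<open>inverse 0 = 0\<close>, and the bound
        \<open>invQ\<close>, linear in |s|, shows that the limit is zero too.\<close>
      have "((\<lambda>s. \<bar>s\<bar> * (KQ * K1\<^sup>2)) \<longlongrightarrow> \<bar>0\<bar> * (KQ * K1\<^sup>2)) (at 0 within {-\<epsilon><..<\<epsilon>})"
        by (intro tendsto_intros)
      then have lim: "((\<lambda>s. \<bar>s\<bar> * (KQ * K1\<^sup>2)) \<longlongrightarrow> 0) (at 0 within {-\<epsilon><..<\<epsilon>})" by simp
      have "((\<lambda>s. inverse s *\<^sub>R \<phi> s) \<longlongrightarrow> 0) (at 0 within {-\<epsilon><..<\<epsilon>})"
        by (rule Lim_null_comparison[OF _ lim])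
           (use invQ[OF _ G] in \<open>auto simp: eventually_at_filter \<phi>_def simp del: norm_scaleR\<close>)
      then show ?thesis using True by simp
    next
      case False
      have le: "norm (\<phi> s - \<phi> t) \<le> KQ * (\<epsilon> * K1 + \<epsilon> * K1) * (\<bar>s - t\<bar> * K1)" if s: "s \<in> {-\<epsilon><..<\<epsilon>}" for s
      proof -
        have "norm (\<phi> s - \<phi> t) \<le> KQ * (norm (s *\<^sub>R branch m G) + norm (t *\<^sub>R branch m G)) * norm (s *\<^sub>R branch m G - t *\<^sub>R branch m G)
            + \<bar>vel_shift m G - vel_shift m G\<bar> * (norm (s *\<^sub>R branch m G))\<^sup>2"
          unfolding \<phi>_def by (intro KQ skk om1 s t G)
        also have "\<dots> = KQ * (norm (s *\<^sub>R branch m G) + norm (t *\<^sub>R branch m G)) * (\<bar>s - t\<bar> * norm (branch m G))"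
          by (simp flip: scaleR_diff_left)
        also have "\<dots> \<le> KQ * (\<epsilon> * K1 + \<epsilon> * K1) * (\<bar>s - t\<bar> * K1)"
        proof (intro mult_mono mult_left_mono add_mono)
          show "norm (s *\<^sub>R branch m G) \<le> \<epsilon> * K1" "norm (t *\<^sub>R branch m G) \<le> \<epsilon> * K1"
            unfolding norm_scaleR using s t \<epsilon> by (auto intro!: mult_mono branch_le G)
        qed (use KQ(1) K1 \<epsilon> branch_le[OF G] in auto)
        finally show ?thesis .
      qed
      have "((\<lambda>s. KQ * (\<epsilon> * K1 + \<epsilon> * K1) * (\<bar>s - t\<bar> * K1)) \<longlongrightarrow> KQ * (\<epsilon> * K1 + \<epsilon> * K1) * (\<bar>t - t\<bar> * K1)) (at t within {-\<epsilon><..<\<epsilon>})"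
        by (intro tendsto_intros)
      then have lim: "((\<lambda>s. KQ * (\<epsilon> * K1 + \<epsilon> * K1) * (\<bar>s - t\<bar> * K1)) \<longlongrightarrow> 0) (at t within {-\<epsilon><..<\<epsilon>})" by simp
      have "((\<lambda>s. \<phi> s - \<phi> t) \<longlongrightarrow> 0) (at t within {-\<epsilon><..<\<epsilon>})"
        by (rule Lim_null_comparison[OF _ lim]) (use le in \<open>auto simp: eventually_at_filter\<close>)
      then have "(\<phi> \<longlongrightarrow> \<phi> t) (at t within {-\<epsilon><..<\<epsilon>})" by (rule LIM_zero_cancel)
      then show ?thesis using False by (intro tendsto_intros) auto
    qed
    then show ?thesis unfolding branch_map_def \<phi>_def by (rule tendsto_diff[OF tendsto_const])
  qed
  have complete: "complete S"
    unfolding S_def by (intro closed_Int closed_oddV closed_cball complete_eq_closed[THEN iffD2])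
  have "S \<noteq> {}" using zero by blast
  note fixed_points = parametrized_contraction[OF complete this _ _ maps contr cont]
  have "\<exists>G. (\<forall>s\<in>{-\<epsilon><..<\<epsilon>}. G s \<in> S \<and> branch_map m s (G s) = G s)
      \<and> (\<forall>t\<in>{-\<epsilon><..<\<epsilon>}. (G \<longlongrightarrow> G t) (at t within {-\<epsilon><..<\<epsilon>}))"
    by (rule fixed_points) auto
  then obtain G where G: "\<And>s. s \<in> {-\<epsilon><..<\<epsilon>} \<Longrightarrow> G s \<in> S" "\<And>s. s \<in> {-\<epsilon><..<\<epsilon>} \<Longrightarrow> branch_map m s (G s) = G s"
    "\<And>t. t \<in> {-\<epsilon><..<\<epsilon>} \<Longrightarrow> (G \<longlongrightarrow> G t) (at t within {-\<epsilon><..<\<epsilon>})"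
    by blast
  have z: "0 \<in> {-\<epsilon><..<\<epsilon>}" using \<epsilon> by simp
  \<comment> \<open>Since 0 is a fixed point at s = 0, the contraction estimate forces
    \<open>G 0 = 0\<close>; this places the start of the curve at the bifurcation velocity.\<close>
  have "branch_map m 0 0 = 0" by (simp add: branch_map_def om0)
  then have "norm (G 0 - 0) \<le> 1 / 2 * norm (G 0 - 0)"
    using contr[OF z G(1)[OF z] zero] G(2)[OF z] by simp
  then have "G 0 = 0" by simp
  with G skk(2) \<epsilon> show ?thesis by (intro exI[of _ \<epsilon>] conjI exI[of _ G]) (auto simp: S_def)
qed

theorem bifurcation:
  assumes m: "m \<ge> 2"
  shows "bifurcates_from_disk \<alpha> (X_space k m) (sobolev_norm k) (\<Omega>_bif \<alpha> m)"
proof -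
  have m1: "m \<ge> 1" using m by simp
  obtain \<epsilon> G where \<epsilon>: "\<epsilon> > 0"
    and G: "\<And>s. s \<in> {-\<epsilon><..<\<epsilon>} \<Longrightarrow> G s \<in> oddV m" "\<And>s. s \<in> {-\<epsilon><..<\<epsilon>} \<Longrightarrow> branch_map m s (G s) = G s"
      "\<And>s. s \<in> {-\<epsilon><..<\<epsilon>} \<Longrightarrow> norm (s *\<^sub>R branch m (G s)) \<le> 1 / 8"
      "\<And>t. t \<in> {-\<epsilon><..<\<epsilon>} \<Longrightarrow> (G \<longlongrightarrow> G t) (at t within {-\<epsilon><..<\<epsilon>})" "G 0 = 0"
    using solution_curve[OF m] by blast
  obtain B where B: "\<And>n. cmod (inv_symbol m n) \<le> B" using inv_symbol_bounded[OF m1] by blast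
  define g where "g s = s *\<^sub>R branch m (G s)" for s
  define Om' where "Om' s = bif_velocity m + vel_shift m (G s)" for s
  have even: "pert (g s) \<in> evenW m" if "s \<in> {-\<epsilon><..<\<epsilon>}" for s
    unfolding g_def by (intro pert_evenW branch_evenW m1 G that)
  note real = evenW_ev(1)[OF even m1]
  have small: "norm (g s) \<le> 1 / 8" if "s \<in> {-\<epsilon><..<\<epsilon>}" for s
    unfolding g_def by (rule G(3)[OF that])
  \<comment> \<open>The correction has no component at the modes 0 and m. So R - 1 has mean zero,
    and its coefficient at m is exactly s / 2, which makes the branch nontrivial for s \<noteq>
    0.\<close>
  have nuc0: "inv_symbol m 0 = 0" "inv_symbol m (int m) = 0" by (simp_all add: inv_symbol_def)
  have "(\<lambda>x. radius (g s) x - 1) \<in> X_space k m" if s: "s \<in> {-\<epsilon><..<\<epsilon>}" for s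
  proof -
    have "coef (pert (g s)) 0 = 0"
      using m1 by (simp add: g_def coef_ops coef_scaleR branch_def coef_add coef_nu coef_kernel_elem nuc0)
    from X_space_ev[OF even[OF s] this m1, of k] show ?thesis by (simp add: radius_def)
  qed
  moreover have "continuous_on {-\<epsilon><..<\<epsilon>} Om'"
  proof -
    have "((\<lambda>s. bif_velocity m + 2 * Im (coef (G s) (int m)) / real m) \<longlongrightarrow> bif_velocity m + 2 * Im (coef (G t) (int m)) / real m)
        (at t within {-\<epsilon><..<\<epsilon>})" if t: "t \<in> {-\<epsilon><..<\<epsilon>}" for t
      using m1 by (intro tendsto_intros bounded_linear.tendsto[OF bounded_linear_coef] G t) auto
    then show ?thesis unfolding continuous_on_def Om'_def vel_shift_def by blast
  qed
  moreover have "((\<lambda>s. sobolev_norm k (\<lambda>x. (radius (g s) x - 1) - (radius (g t) x - 1))) \<longlongrightarrow> 0) (at t within {-\<epsilon><..<\<epsilon>})"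
    if t: "t \<in> {-\<epsilon><..<\<epsilon>}" for t
  proof -
    obtain C where C: "C \<ge> 0" "\<And>a. (\<And>x. Im (ev a x) = 0) \<Longrightarrow> sobolev_norm k (\<lambda>x. Re (ev a x)) \<le> C * norm a"
      using sobolev_norm_ev_le by blast
    have le: "sobolev_norm k (\<lambda>x. (radius (g s) x - 1) - (radius (g t) x - 1)) \<le> C * norm (g s - g t)"
      if s: "s \<in> {-\<epsilon><..<\<epsilon>}" for s
    proof -
      have "(\<lambda>x. (radius (g s) x - 1) - (radius (g t) x - 1)) = (\<lambda>x. Re (ev (pert (g s - g t)) x))"
        by (simp add: radius_def pert_diff ev_diff)
      then have "sobolev_norm k (\<lambda>x. (radius (g s) x - 1) - (radius (g t) x - 1)) \<le> C * norm (pert (g s - g t))"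
        by (simp only:) (rule C(2), simp add: pert_diff ev_diff real[OF s] real[OF t])
      also have "\<dots> \<le> C * norm (g s - g t)" by (intro mult_left_mono norm_basic C)
      finally show ?thesis .
    qed
    have "(g \<longlongrightarrow> g t) (at t within {-\<epsilon><..<\<epsilon>})"
      unfolding g_def branch_def
      by (intro tendsto_intros bounded_linear.tendsto[OF bounded_linear_multiplier[OF B]] G t)
    then have "((\<lambda>s. C * norm (g s - g t)) \<longlongrightarrow> C * norm (g t - g t)) (at t within {-\<epsilon><..<\<epsilon>})"
      by (intro tendsto_intros)
    then have lim: "((\<lambda>s. C * norm (g s - g t)) \<longlongrightarrow> 0) (at t within {-\<epsilon><..<\<epsilon>})" by simp
    show ?thesis
      by (rule Lim_null_comparison[OF _ lim])
         (use le in \<open>auto simp: eventually_at_filter sobolev_norm_nonneg\<close>)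
  qed
  moreover have "Om' 0 = \<Omega>_bif \<alpha> m"
    using velocity_bif[OF m1] by (simp add: Om'_def bif_velocity_def G vel_shift_def coef_zero)
  moreover have "radius (g 0) = (\<lambda>x. 1)"
  proof -
    have "pert 0 = 0" by (rule wiener_eqI) (simp add: coef_ops coef_zero)
    then show ?thesis by (simp add: g_def radius_def fun_eq_iff ev_zero)
  qed
  moreover have "radius (g s) \<noteq> (\<lambda>x. 1)" if s: "s \<in> {-\<epsilon><..<\<epsilon>}" "s \<noteq> 0" for s
  proof
    assume "radius (g s) = (\<lambda>x. 1)"
    then have "Re (ev (pert (g s)) x) = 0" for x by (simp add: radius_def fun_eq_iff)
    then have "pert (g s) = 0"
      by (intro ev_inject) (simp add: complex_eq_iff real[OF s(1)] ev_zero)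
    then have "coef (pert (g s)) (int m) = 0" by (simp add: coef_zero)
    moreover have "coef (pert (g s)) (int m) = of_real (s / 2)"
      using m1 sigma_pos[of "int m"]
      unfolding g_def coef_ops coef_scaleR branch_def coef_add coef_nu[OF m1] coef_kernel_elem[OF m1] nuc0 symbol_def
      by (simp add: scaleR_conv_of_real)
    ultimately show False using s by simp
  qed
  moreover have "radius (g s) x > 0" if "s \<in> {-\<epsilon><..<\<epsilon>}" for s x
    by (rule radius_pos[OF small real]) fact+
  moreover have "F_gsqg \<alpha> (Om' s) (radius (g s)) x = 0" if s: "s \<in> {-\<epsilon><..<\<epsilon>}" for s x
  proof -
    have "(Om' s) *\<^sub>R ((1 + pert (g s)) * dpert (g s)) - C_gsqg \<alpha> *\<^sub>R (lin_op (g s) + nonlin (g s)) = 0"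
      unfolding Om'_def g_def by (rule equation_of_fixed_point[OF m1 G(1,2)]) fact+
    then have "complex_of_real (radius (g s) x * F_gsqg \<alpha> (Om' s) (radius (g s)) x) = 0"
      unfolding F_gsqg_eq[OF small[OF s] real[OF s]] by (simp only: ev_zero)
    then show ?thesis using radius_pos[OF small[OF s] real[OF s], of x] by simp
  qed
  ultimately show ?thesis
    unfolding bifurcates_from_disk_def using \<epsilon>
    by (intro exI[of _ \<epsilon>] conjI exI[of _ Om'] exI[of _ "\<lambda>s. radius (g s)"] ballI allI impI)
qed

end

theorem theorem1p4:
  fixes k m :: nat and \<alpha> :: real
  assumes "k \<ge> 3" and "m \<ge> 2" and "1 < \<alpha>" and "\<alpha> < 2"
  shows "bifurcates_from_disk \<alpha> (X_space k m) (sobolev_norm k) (\<Omega>_bif \<alpha> m)"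
proof -
  interpret gsqg \<alpha> by unfold_locales fact+
  show ?thesis by (rule bifurcation) fact
qed

end
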